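(* Consider the rescaled process $Z^{(n)}(t)$, the Markov chain $(X^{(n)}_i)_{i\in\mathbb{N}}$, the Poisson process $N^{(n)}$ and the matrix moments $M^{(n)}_j(t)$, $M^{(n)}_{jj'}(t)$ defined in the context, with parameters $\lambda>0$, $\gamma>0$, $\alpha\in(0,1)$ and transition matrix $P$. If $\gamma<\alpha$ then, for all $t\in[0,1]$ and all $j,j'\in\{1,\ldots,k\}$ with $j'\neq j$, the following (entrywise) convergences hold as $n\to\infty$: $$n^{\alpha-\gamma}M^{(n)}_j(t)\longrightarrow\lambda e^{\lambda t(P-I)}\int_0^t\frac{1}{v^\alpha}e^{-\lambda v(P-I)}\Delta_j e^{\lambda v(P-I)}\,dv,$$ $$n^{\alpha-\gamma}M^{(n)}_{jj}(t)\longrightarrow\lambda e^{\lambda t(P-I)}\int_0^t\frac{1}{v^\alpha}e^{-\lambda v(P-I)}\Delta_j^2 e^{\lambda v(P-I)}\,dv,$$ $$n^{\alpha-\gamma}M^{(n)}_{jj'}(t)\longrightarrow 0.$$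
   Context: Let $k,K\in\mathbb{N}^*$ and $\mathcal{S}=\{0,\ldots,K\}^k$. Let $P=(p(x,x'))_{(x,x')\in\mathcal{S}^2}$ be a stochastic matrix (the transition matrix of a stationary Markov chain on $\mathcal{S}$) with stationary distribution $\pi=(\pi(x))_{x\in\mathcal{S}}$; $I$ is the identity matrix. Let $\lambda>0$, $\gamma>0$, $\alpha\in(0,1)$. Service times: $(L_{ij})_{i\in\mathbb{N},\,j=1,\ldots,k}$ are independent nonnegative random variables such that the vectors $(L_{i1},\ldots,L_{ik})$, $i\in\mathbb{N}$, are i.i.d. (the entries $L_{i1},\ldots,L_{ik}$ may have different distributions). With $L_j$ denoting a generic copy of $L_{ij}$, one assumes $\mathbb{P}(L_j>t)\sim t^{-\alpha}$ as $t\to\infty$ for every $j=1,\ldots,k$. Rescaled model, for each integer $n\ge1$: - $\{N^{(n)}_t,\ t\ge0\}$ is a Poisson process with intensity $\lambda_n=\lambda n^\gamma$ and jump times $(T^n_i)_{i\ge1}$ (and $T^n_0=0$); - $(X^{(n)}_i)_{i\in\mathbb{N}}$, with $X^{(n)}_i=(X^{(n)}_{i1},\ldots,X^{(n)}_{ik})\in\mathcal{S}$, is a stationary Markov chain with transition matrix $P_n=P/n^\gamma+(1-1/n^\gamma)I$ and stationary distribution $\pi$; - the service times are $L^{(n)}_{ij}=L_{ij}/n$; - the Poisson process, the Markov chain and the family of service times are mutually independent. The process $Z^{(n)}(t)=(Z^{(n)}_1(t),\ldots,Z^{(n)}_k(t))$ is defined by $$Z^{(n)}_j(t)=\sum_{i=1}^{N^{(n)}_t}X^{(n)}_{ij}\,\mathbf{1}_{[t<L^{(n)}_{ij}+T^n_i]},\qquad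 j=1,\ldots,k,\ t\ge0.$$ The matrix moments are, for $j,j'\in\{1,\ldots,k\}$, $$M^{(n)}_j(t)=\left[\mathbb{E}\left(\left.Z^{(n)}_j(t)\mathbf{1}_{[X^{(n)}_{N^{(n)}_t}=y]}\right|X^{(n)}_0=x\right)\right]_{(x,y)\in\mathcal{S}^2},$$ $$M^{(n)}_{jj'}(t)=\left[\mathbb{E}\left(\left.Z^{(n)}_j(t)Z^{(n)}_{j'}(t)\mathbf{1}_{[X^{(n)}_{N^{(n)}_t}=y]}\right|X^{(n)}_0=x\right)\right]_{(x,y)\in\mathcal{S}^2},$$ where conditioning on $X^{(n)}_0=x$ means that the chain is started at $x$. Finally $\Delta_j=\mathrm{diag}[x_j,\ x=(x_1,\ldots,x_k)\in\mathcal{S}]$ is the diagonal $\mathcal{S}\times\mathcal{S}$ matrix whose $(x,x)$ entry is $x_j$. *)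

theory Defs
  imports "HOL-Probability.Probability" "HOL-Library.Landau_Symbols"
begin

section \<open>Matrices over a finite index set\<close>

text \<open>
  A matrix with rows and columns indexed by a finite set \<open>S\<close> is a function of two arguments, of
  which only the values on \<open>S \<times> S\<close> matter.
\<close>

type_synonym 's matrix = "'s \<Rightarrow> 's \<Rightarrow> real"

definition mat_id :: "'s matrix" where
  "mat_id x y = of_bool (x = y)"

definition mat_diag :: "('s \<Rightarrow> real) \<Rightarrow> 's matrix" where
  "mat_diag d x y = (if x = y then d x else 0)"

definition mat_scale :: "real \<Rightarrow> 's matrix \<Rightarrow> 's matrix" where
  "mat_scale c A x y = c * A x y"

definition mat_mult :: "'s set \<Rightarrow> 's matrix \<Rightarrow> 's matrix \<Rightarrow> 's matrix" where
  "mat_mult S A B x y = (\<Sum>z\<in>S. A x z * B z y)"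

fun mat_pow :: "'s set \<Rightarrow> 's matrix \<Rightarrow> nat \<Rightarrow> 's matrix" where
  "mat_pow S A 0 = mat_id"
| "mat_pow S A (Suc m) = mat_mult S A (mat_pow S A m)"

definition mat_exp :: "'s set \<Rightarrow> 's matrix \<Rightarrow> 's matrix" where
  "mat_exp S A x y = (\<Sum>m. mat_pow S A m x y / fact m)"

definition stochastic_matrix :: "'s set \<Rightarrow> 's matrix \<Rightarrow> bool" where
  "stochastic_matrix S P \<longleftrightarrow>
     (\<forall>x\<in>S. \<forall>y\<in>S. 0 \<le> P x y) \<and> (\<forall>x\<in>S. (\<Sum>y\<in>S. P x y) = 1)"

definition stationary_distribution :: "'s set \<Rightarrow> 's matrix \<Rightarrow> ('s \<Rightarrow> real) \<Rightarrow> bool" where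
  "stationary_distribution S P \<pi> \<longleftrightarrow>
     (\<forall>x\<in>S. 0 \<le> \<pi> x) \<and> (\<Sum>x\<in>S. \<pi> x) = 1 \<and> (\<forall>y\<in>S. (\<Sum>x\<in>S. \<pi> x * P x y) = \<pi> y)"


section \<open>Poisson processes, Markov chains, independence of processes\<close>

text \<open>Only the values \<open>N t\<close> at times \<open>t \<ge> 0\<close> are relevant.\<close>

definition poisson_process :: "'a measure \<Rightarrow> real \<Rightarrow> (real \<Rightarrow> 'a \<Rightarrow> nat) \<Rightarrow> bool" where
  "poisson_process M rate N \<longleftrightarrow>
     (\<forall>t\<ge>0. N t \<in> measurable M (count_space UNIV)) \<and>
     (\<forall>\<omega>\<in>space M. N 0 \<omega> = 0 \<and> mono_on {0..} (\<lambda>t. N t \<omega>) \<and>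
        (\<forall>t\<ge>0. continuous (at_right t) (\<lambda>s. N s \<omega>))) \<and>
     (\<forall>s t. 0 \<le> s \<and> s < t \<longrightarrow>
        distr M (count_space UNIV) (\<lambda>\<omega>. N t \<omega> - N s \<omega>)
          = measure_pmf (poisson_pmf (rate * (t - s)))) \<and>
     (\<forall>(m::nat) (\<tau>::nat \<Rightarrow> real). 0 \<le> \<tau> 0 \<and> strict_mono \<tau> \<longrightarrow>
        prob_space.indep_vars M (\<lambda>_. count_space UNIV)
          (\<lambda>l \<omega>. N (\<tau> (Suc l)) \<omega> - N (\<tau> l) \<omega>) {..<m})"

text \<open>The \<open>0\<close>-th jump time is \<open>0\<close>.\<close>

definition jump_time :: "(real \<Rightarrow> 'a \<Rightarrow> nat) \<Rightarrow> nat \<Rightarrow> 'a \<Rightarrow> real" where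
  "jump_time N i \<omega> = Inf {t. 0 \<le> t \<and> i \<le> N t \<omega>}"

text \<open>The Markov property is written in product form, so that no conditioning on null events occurs.\<close>

definition markov_chain ::
  "'a measure \<Rightarrow> 's set \<Rightarrow> ('s \<Rightarrow> real) \<Rightarrow> 's matrix \<Rightarrow> (nat \<Rightarrow> 'a \<Rightarrow> 's) \<Rightarrow> bool" where
  "markov_chain M S \<nu> Q X \<longleftrightarrow>
     (\<forall>i. X i \<in> measurable M (count_space S)) \<and>
     (\<forall>x\<in>S. measure M {\<omega>\<in>space M. X 0 \<omega> = x} = \<nu> x) \<and>
     (\<forall>m x. (\<forall>i\<le>Suc m. x i \<in> S) \<longrightarrow>
        measure M {\<omega>\<in>space M. \<forall>i\<le>Suc m. X i \<omega> = x i}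
          = measure M {\<omega>\<in>space M. \<forall>i\<le>m. X i \<omega> = x i} * Q (x m) (x (Suc m)))"

definition process_sigma :: "'a measure \<Rightarrow> 'b measure \<Rightarrow> ('i \<Rightarrow> 'a \<Rightarrow> 'b) \<Rightarrow> 'i set \<Rightarrow> 'a set set" where
  "process_sigma M R Y I = sigma_sets (space M) {Y i -` A \<inter> space M | i A. i \<in> I \<and> A \<in> sets R}"


section \<open>The queueing model\<close>

definition states :: "nat \<Rightarrow> nat \<Rightarrow> (nat \<Rightarrow> nat) set" where
  "states k K = {1..k} \<rightarrow>\<^sub>E {0..K}"

text \<open>\<open>D j\<close> is the law of a generic service time \<open>L\<^sub>j\<close>. Full independence of the entries together
  with laws not depending on \<open>i\<close> also makes the vectors \<open>(L\<^sub>i\<^sub>1, \<dots>, L\<^sub>i\<^sub>k)\<close> i.i.d.\<close>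

definition service_times ::
  "nat \<Rightarrow> (nat \<Rightarrow> real measure) \<Rightarrow> 'a measure \<Rightarrow> (nat \<Rightarrow> nat \<Rightarrow> 'a \<Rightarrow> real) \<Rightarrow> bool" where
  "service_times k D M L \<longleftrightarrow>
     prob_space.indep_vars M (\<lambda>_. borel) (\<lambda>(i, j). L i j) (UNIV \<times> {1..k}) \<and>
     (\<forall>i. \<forall>j\<in>{1..k}. (AE \<omega> in M. 0 \<le> L i j \<omega>) \<and> distr M borel (L i j) = D j)"

definition scaled_transition :: "real \<Rightarrow> 's matrix \<Rightarrow> nat \<Rightarrow> 's matrix" where
  "scaled_transition \<gamma> P n x y =
     P x y / real n powr \<gamma> + (1 - 1 / real n powr \<gamma>) * mat_id x y"

text \<open>The \<open>n\<close>-th rescaled model under the probability \<open>M\<close>, with initial law \<open>\<nu>\<close> of the chain.\<close>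

definition rescaled_model ::
  "nat \<Rightarrow> nat \<Rightarrow> real \<Rightarrow> real \<Rightarrow> (nat \<Rightarrow> nat) matrix \<Rightarrow> (nat \<Rightarrow> real measure) \<Rightarrow> nat \<Rightarrow>
   ((nat \<Rightarrow> nat) \<Rightarrow> real) \<Rightarrow> 'a measure \<Rightarrow> (real \<Rightarrow> 'a \<Rightarrow> nat) \<Rightarrow> (nat \<Rightarrow> 'a \<Rightarrow> nat \<Rightarrow> nat) \<Rightarrow>
   (nat \<Rightarrow> nat \<Rightarrow> 'a \<Rightarrow> real) \<Rightarrow> bool" where
  "rescaled_model k K lam \<gamma> P D n \<nu> M N X L \<longleftrightarrow>
     prob_space M \<and>
     poisson_process M (lam * real n powr \<gamma>) N \<and>
     markov_chain M (states k K) \<nu> (scaled_transition \<gamma> P n) X \<and>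
     service_times k D M L \<and>
     prob_space.indep_sets M
       (\<lambda>c. [process_sigma M (count_space UNIV) N {0..},
             process_sigma M (count_space (states k K)) X UNIV,
             process_sigma M borel (\<lambda>(i, j). L i j) (UNIV \<times> {1..k})] ! c) {..<3}"

text \<open>
  \<open>Mx\<close> is the law given \<open>X\<^sub>0 = x\<close>. The product formula determines \<open>Mx\<close> when \<open>\<pi> x > 0\<close>; in every
  case, including \<open>\<pi> x = 0\<close>, the model under \<open>Mx\<close> has its chain started at \<open>x\<close>.
\<close>

definition started_model ::
  "nat \<Rightarrow> nat \<Rightarrow> real \<Rightarrow> real \<Rightarrow> (nat \<Rightarrow> nat) matrix \<Rightarrow> (nat \<Rightarrow> real measure) \<Rightarrow> nat \<Rightarrow>
   ((nat \<Rightarrow> nat) \<Rightarrow> real) \<Rightarrow> 'a measure \<Rightarrow> (real \<Rightarrow> 'a \<Rightarrow> nat) \<Rightarrow> (nat \<Rightarrow> 'a \<Rightarrow> nat \<Rightarrow> nat) \<Rightarrow>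
   (nat \<Rightarrow> nat \<Rightarrow> 'a \<Rightarrow> real) \<Rightarrow> (nat \<Rightarrow> nat) \<Rightarrow> 'a measure \<Rightarrow> bool" where
  "started_model k K lam \<gamma> P D n \<pi> M N X L x Mx \<longleftrightarrow>
     sets Mx = sets M \<and>
     (\<forall>A\<in>sets M. measure M {\<omega>\<in>A. X 0 \<omega> = x} = \<pi> x * measure Mx A) \<and>
     rescaled_model k K lam \<gamma> P D n (\<lambda>z. of_bool (z = x)) Mx N X L"

definition queue_Z ::
  "(real \<Rightarrow> 'a \<Rightarrow> nat) \<Rightarrow> (nat \<Rightarrow> 'a \<Rightarrow> nat \<Rightarrow> nat) \<Rightarrow> (nat \<Rightarrow> nat \<Rightarrow> 'a \<Rightarrow> real) \<Rightarrow>
   nat \<Rightarrow> nat \<Rightarrow> real \<Rightarrow> 'a \<Rightarrow> real" where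
  "queue_Z N X L n j t \<omega> =
     (\<Sum>i=1..N t \<omega>. real (X i \<omega> j) * of_bool (t < L i j \<omega> / real n + jump_time N i \<omega>))"

text \<open>In the moments, \<open>Mx x\<close> is the law of the model given that the chain starts at \<open>x\<close>.\<close>

definition moment1 ::
  "((nat \<Rightarrow> nat) \<Rightarrow> 'a measure) \<Rightarrow> (real \<Rightarrow> 'a \<Rightarrow> nat) \<Rightarrow> (nat \<Rightarrow> 'a \<Rightarrow> nat \<Rightarrow> nat) \<Rightarrow>
   (nat \<Rightarrow> nat \<Rightarrow> 'a \<Rightarrow> real) \<Rightarrow> nat \<Rightarrow> nat \<Rightarrow> real \<Rightarrow> (nat \<Rightarrow> nat) matrix" where
  "moment1 Mx N X L n j t x y =
     (\<integral>\<omega>. queue_Z N X L n j t \<omega> * of_bool (X (N t \<omega>) \<omega> = y) \<partial>(Mx x))"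

definition moment2 ::
  "((nat \<Rightarrow> nat) \<Rightarrow> 'a measure) \<Rightarrow> (real \<Rightarrow> 'a \<Rightarrow> nat) \<Rightarrow> (nat \<Rightarrow> 'a \<Rightarrow> nat \<Rightarrow> nat) \<Rightarrow>
   (nat \<Rightarrow> nat \<Rightarrow> 'a \<Rightarrow> real) \<Rightarrow> nat \<Rightarrow> nat \<Rightarrow> nat \<Rightarrow> real \<Rightarrow> (nat \<Rightarrow> nat) matrix" where
  "moment2 Mx N X L n j j' t x y =
     (\<integral>\<omega>. queue_Z N X L n j t \<omega> * queue_Z N X L n j' t \<omega> * of_bool (X (N t \<omega>) \<omega> = y) \<partial>(Mx x))"

definition Delta :: "nat \<Rightarrow> (nat \<Rightarrow> nat) matrix" where
  "Delta j = mat_diag (\<lambda>x. real (x j))"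

definition generator :: "'s matrix \<Rightarrow> 's matrix" where
  "generator P x y = P x y - mat_id x y"

text \<open>\<open>\<lambda> e\<^bsup>\<lambda>t(P-I)\<^esup> \<integral>\<^sub>0\<^sup>t v\<^bsup>-\<alpha>\<^esup> e\<^bsup>-\<lambda>v(P-I)\<^esup> B e\<^bsup>\<lambda>v(P-I)\<^esup> dv\<close>, the integral being taken entrywise.\<close>

definition limit_matrix ::
  "'s set \<Rightarrow> real \<Rightarrow> real \<Rightarrow> 's matrix \<Rightarrow> 's matrix \<Rightarrow> real \<Rightarrow> 's matrix" where
  "limit_matrix S lam \<alpha> P B t =
     mat_scale lam (mat_mult S (mat_exp S (mat_scale (lam * t) (generator P)))
       (\<lambda>x y. LINT v:{0..t}|lborel. 1 / v powr \<alpha> *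
          mat_mult S (mat_mult S (mat_exp S (mat_scale (- lam * v) (generator P))) B)
            (mat_exp S (mat_scale (lam * v) (generator P))) x y))"

end

theory Submission
  imports Defs
begin

text \<open>
  Job \<open>i\<close> is still in service at time \<open>t\<close> with service time \<open>r\<close> iff \<open>N (t - min t (r / n)) < i\<close>. So,
  with the service time fixed, the joint law of two values of the Poisson process suffices, and its
  derivative in the elapsed time telescopes. Summing over the paths of the chain, where a Poisson
  number of steps of \<open>P\<^sub>n\<close> amounts to \<open>e\<^bsup>\<lambda>s(P-I)\<^esup>\<close>, and integrating over the service time by the
  layer-cake formula gives the exact first moment
  \<open>\<lambda>n\<^sup>\<gamma> \<integral>\<^sub>0\<^sup>t \<P>(L > nv) P\<^sub>n e\<^bsup>\<lambda>(t-v)(P-I)\<^esup> \<Delta> e\<^bsup>\<lambda>v(P-I)\<^esup> dv\<close>, and \<open>n\<^sup>\<alpha> \<P>(L > nv) \<rightarrow> v\<^bsup>-\<alpha>\<^esup>\<close> is dominated by a multiple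
  of \<open>v\<^bsup>-\<alpha>\<^esup>\<close>. In a second moment the diagonal terms are a first moment, with the minimum of the
  two service times, while the pairs of distinct jobs contribute at most
  \<open>K\<^sup>2 \<lambda>\<^sup>2 n\<^bsup>2\<gamma>\<^esup> (\<integral>\<^sub>0\<^sup>t \<P>(L\<^sub>j > nv) dv) (\<integral>\<^sub>0\<^sup>t \<P>(L\<^sub>j\<^sub>' > nv) dv) = O(n\<^bsup>2(\<gamma>-\<alpha>)\<^esup>)\<close>, which is negligible
  because \<open>\<gamma> < \<alpha>\<close>.
\<close>

section \<open>The matrix exponential\<close>

text \<open>Arrivals come at a rate of order n^\<gamma>, while the chain moves with probability of
  order n^(-\<gamma>) per arrival. The two effects cancel, so the law of the state after a given
  time does not depend on n, and n survives only in the prefactor, in the tail at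
  \<open>n * v\<close> and in one single factor \<open>P_n\<close>. That factor is there because job
  i sees the chain after i steps although only i - 1 arrivals precede it; it tends to the identity.

  Jump times are the awkward objects: each is an infimum over a set that may be empty, and their
  joint law is not given. They are therefore used only for jobs with
  \<open>i \<le> N t \<omega>\<close>, where comparing a jump time with a fixed time is the same as
  comparing a count with i.

  Sums over jobs, over states and over the number of arrivals are interchanged with integrals for
  nonnegative extended values, so that real integrability comes out of the computation instead of
  being a prerequisite.

  For two different components the diagonal terms vanish at the scale n^(\<gamma>-\<alpha>), since
  one job must have two independent long service times.\<close>

definition poisson_weight :: "real \<Rightarrow> nat \<Rightarrow> real" where
  "poisson_weight r l = r ^ l / fact l * exp (- r)"

lemma poisson_weight_nonneg: "0 \<le> r \<Longrightarrow> 0 \<le> poisson_weight r l"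
  by (simp add: poisson_weight_def)

section \<open>Products and powers of matrices over a finite index set\<close>

lemma mat_mult_assoc:
  "mat_mult S (mat_mult S A B) C x y = mat_mult S A (mat_mult S B C) x y"
proof -
  have "(\<Sum>z\<in>S. (\<Sum>w\<in>S. A x w * B w z) * C z y) = (\<Sum>z\<in>S. \<Sum>w\<in>S. A x w * (B w z * C z y))"
    by (simp add: sum_distrib_right mult.assoc)
  also have "\<dots> = (\<Sum>w\<in>S. \<Sum>z\<in>S. A x w * (B w z * C z y))"
    by (rule sum.swap)
  finally show ?thesis
    by (simp add: mat_mult_def sum_distrib_left)
qed

lemma mat_mult_cong:
  "(\<And>z. z \<in> S \<Longrightarrow> A x z = A' x z) \<Longrightarrow> (\<And>z. z \<in> S \<Longrightarrow> B z y = B' z y) \<Longrightarrow>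
    mat_mult S A B x y = mat_mult S A' B' x y"
  by (simp add: mat_mult_def)

lemma mat_mult_id_left: "finite S \<Longrightarrow> x \<in> S \<Longrightarrow> mat_mult S mat_id B x y = B x y"
  by (simp add: mat_mult_def mat_id_def)

lemma mat_mult_id_right: "finite S \<Longrightarrow> y \<in> S \<Longrightarrow> mat_mult S B mat_id x y = B x y"
  by (simp add: mat_mult_def mat_id_def)

lemma mat_mult_diag_left: "finite S \<Longrightarrow> x \<in> S \<Longrightarrow> mat_mult S (mat_diag d) B x y = d x * B x y"
  by (simp add: mat_mult_def mat_diag_def if_distrib[of "\<lambda>u. u * _"] cong: if_cong)

lemma mat_mult_diag_right: "finite S \<Longrightarrow> y \<in> S \<Longrightarrow> mat_mult S B (mat_diag d) x y = B x y * d y"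
  by (simp add: mat_mult_def mat_diag_def if_distrib[of "\<lambda>u. _ * u"] cong: if_cong)

lemma mat_pow_add:
  assumes "finite S" "x \<in> S"
  shows "mat_pow S A (a + b) x y = mat_mult S (mat_pow S A a) (mat_pow S A b) x y"
  using assms(2)
proof (induction a arbitrary: x)
  case 0
  then show ?case by (simp add: mat_mult_id_left assms)
next
  case (Suc a)
  have "mat_pow S A (Suc a + b) x y = mat_mult S A (mat_mult S (mat_pow S A a) (mat_pow S A b)) x y"
    by (simp, rule mat_mult_cong, simp_all add: Suc.IH)
  then show ?case by (simp add: mat_mult_assoc)
qed

lemma mat_pow_Suc_right:
  "finite S \<Longrightarrow> x \<in> S \<Longrightarrow> y \<in> S \<Longrightarrow>
    mat_pow S A (Suc m) x y = mat_mult S (mat_pow S A m) A x y"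
  using mat_pow_add[of S x A m 1 y]
  by (simp del: mat_pow.simps(2) add: mat_pow.simps(2)[of S A 0])
     (simp add: mat_mult_def mat_id_def)

lemma mat_pow_scale: "mat_pow S (mat_scale c A) m x y = c ^ m * mat_pow S A m x y"
  by (induction m arbitrary: x)
     (simp_all add: mat_mult_def mat_scale_def sum_distrib_left mult_ac)

section \<open>Convergence, continuity and the semigroup law of the exponential\<close>

lemma mat_pow_bound:
  assumes "finite S" "x \<in> S" "y \<in> S"
  shows "\<bar>mat_pow S A m x y\<bar> \<le> (\<Sum>z\<in>S. \<Sum>w\<in>S. \<bar>A z w\<bar>) ^ m"
  using assms(2)
proof (induction m arbitrary: x)
  case 0
  then show ?case by (simp add: mat_id_def)
next
  case (Suc m)
  let ?r = "\<Sum>z\<in>S. \<Sum>w\<in>S. \<bar>A z w\<bar>"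
  have r: "0 \<le> ?r" by (intro sum_nonneg) auto
  have "\<bar>mat_pow S A (Suc m) x y\<bar> \<le> (\<Sum>w\<in>S. \<bar>A x w\<bar> * \<bar>mat_pow S A m w y\<bar>)"
    unfolding mat_pow.simps mat_mult_def by (rule order_trans[OF sum_abs]) (simp add: abs_mult)
  also have "\<dots> \<le> (\<Sum>w\<in>S. \<bar>A x w\<bar> * ?r ^ m)"
    by (intro sum_mono mult_left_mono Suc.IH) auto
  also have "\<dots> = (\<Sum>w\<in>S. \<bar>A x w\<bar>) * ?r ^ m" by (simp add: sum_distrib_right)
  also have "\<dots> \<le> ?r * ?r ^ m"
    using r Suc.prems assms(1)
    by (intro mult_right_mono member_le_sum[of x S "\<lambda>x. \<Sum>w\<in>S. \<bar>A x w\<bar>"]) (auto intro: sum_nonneg)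
  finally show ?case by simp
qed

text \<open>The sum of the absolute values of all entries acts as a crude matrix norm, so the series
  is dominated by a scalar exponential series. Absolute convergence is recorded because Cauchy
  products require it.\<close>

lemma mat_exp_scale_summable:
  assumes "finite S" "x \<in> S" "y \<in> S"
  shows "summable (\<lambda>m. norm (c ^ m / fact m * mat_pow S A m x y))"
proof (rule summable_comparison_test)
  let ?r = "\<Sum>z\<in>S. \<Sum>w\<in>S. \<bar>A z w\<bar>"
  show "\<exists>N. \<forall>m\<ge>N. norm (norm (c ^ m / fact m * mat_pow S A m x y)) \<le> (\<bar>c\<bar> * ?r) ^ m / fact m"
    using mat_pow_bound[OF assms, of A]
    by (auto simp: abs_mult power_mult_distrib power_abs intro!: mult_left_mono divide_right_mono)
  show "summable (\<lambda>m. (\<bar>c\<bar> * ?r) ^ m / fact m)"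
    using summable_exp_generic[of "\<bar>c\<bar> * ?r"] by (simp add: field_simps)
qed

lemma mat_exp_scale_eq:
  "mat_exp S (mat_scale c A) x y = (\<Sum>m. c ^ m / fact m * mat_pow S A m x y)"
  by (simp add: mat_exp_def mat_pow_scale)

lemma mat_exp_scale_sums:
  assumes "finite S" "x \<in> S" "y \<in> S"
  shows "(\<lambda>m. c ^ m / fact m * mat_pow S A m x y) sums mat_exp S (mat_scale c A) x y"
  using summable_norm_cancel[OF mat_exp_scale_summable[OF assms]]
  by (simp add: mat_exp_scale_eq summable_sums)

text \<open>Each entry is a power series in \<open>c\<close>; its convergence at the larger radius
  \<open>\<bar>c\<bar> + 1\<close> gives continuity at \<open>c\<close>.\<close>

lemma isCont_mat_exp_scale:
  assumes "finite S" "x \<in> S" "y \<in> S"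
  shows "isCont (\<lambda>c. mat_exp S (mat_scale c A) x y) c"
proof -
  have "summable (\<lambda>m. (mat_pow S A m x y / fact m) * (\<bar>c\<bar> + 1) ^ m)"
    using summable_norm_cancel[OF mat_exp_scale_summable[OF assms, of "\<bar>c\<bar> + 1" A]]
    by (simp add: mult_ac)
  then have "isCont (\<lambda>c. \<Sum>m. (mat_pow S A m x y / fact m) * c ^ m) c"
    by (rule isCont_powser) simp
  then show ?thesis by (simp add: mat_exp_scale_eq mult_ac)
qed

lemma continuous_on_mat_exp_scale:
  assumes "finite S" "z \<in> S" "y \<in> S" and h: "continuous_on A h"
  shows "continuous_on A (\<lambda>v. mat_exp S (mat_scale (h v) G) z y)"
proof -
  have "continuous_on UNIV (\<lambda>c. mat_exp S (mat_scale c G) z y)"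
    by (intro continuous_at_imp_continuous_on ballI isCont_mat_exp_scale assms)
  then show ?thesis
    by (rule continuous_on_compose2) (auto intro: h)
qed

lemma sum_exp_coeff_eq_binomial:
  fixes a b :: real
  shows "(\<Sum>i\<le>m. a ^ i / fact i * (b ^ (m - i) / fact (m - i))) = (a + b) ^ m / fact m"
  by (simp add: binomial_ring sum_divide_distrib binomial_fact field_simps)

text \<open>Multiples of one matrix commute, so the Cauchy product of the two series collapses by
  the binomial theorem. Its use is to merge the outer exponential of the limit with the backward
  exponential under the integral.\<close>

lemma mat_exp_add:
  assumes "finite S" "x \<in> S" "y \<in> S"
  shows "mat_mult S (mat_exp S (mat_scale a A)) (mat_exp S (mat_scale b A)) x y
    = mat_exp S (mat_scale (a + b) A) x y"
proof -
  let ?f = "\<lambda>z i. a ^ i / fact i * mat_pow S A i x z"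
  let ?g = "\<lambda>z i. b ^ i / fact i * mat_pow S A i z y"
  have "(\<lambda>m. \<Sum>z\<in>S. \<Sum>i\<le>m. ?f z i * ?g z (m - i)) sums (\<Sum>z\<in>S. (\<Sum>i. ?f z i) * (\<Sum>i. ?g z i))"
    using assms by (intro sums_sum Cauchy_product_sums mat_exp_scale_summable) auto
  also have "(\<Sum>z\<in>S. (\<Sum>i. ?f z i) * (\<Sum>i. ?g z i))
      = mat_mult S (mat_exp S (mat_scale a A)) (mat_exp S (mat_scale b A)) x y"
    by (simp add: mat_mult_def mat_exp_scale_eq)
  also have "(\<lambda>m. \<Sum>z\<in>S. \<Sum>i\<le>m. ?f z i * ?g z (m - i)) = (\<lambda>m. (a + b) ^ m / fact m * mat_pow S A m x y)"
  proof
    fix m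
    have "(\<Sum>z\<in>S. \<Sum>i\<le>m. ?f z i * ?g z (m - i))
        = (\<Sum>i\<le>m. \<Sum>z\<in>S. ?f z i * ?g z (m - i))" by (rule sum.swap)
    also have "\<dots> = (\<Sum>i\<le>m. a ^ i / fact i * (b ^ (m - i) / fact (m - i))
        * mat_mult S (mat_pow S A i) (mat_pow S A (m - i)) x y)"
      by (simp add: mat_mult_def sum_distrib_left mult_ac)
    also have "\<dots> = (\<Sum>i\<le>m. a ^ i / fact i * (b ^ (m - i) / fact (m - i)) * mat_pow S A m x y)"
      using assms by (intro sum.cong) (auto simp flip: mat_pow_add)
    also have "\<dots> = (a + b) ^ m / fact m * mat_pow S A m x y"
      unfolding sum_distrib_right[symmetric] by (simp only: sum_exp_coeff_eq_binomial)
    finally show "(\<Sum>z\<in>S. \<Sum>i\<le>m. ?f z i * ?g z (m - i)) = (a + b) ^ m / fact m * mat_pow S A m x y" .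
  qed
  finally show ?thesis
    using mat_exp_scale_sums[OF assms, of "a + b" A] by (rule sums_unique2)
qed

text \<open>The binomial theorem, available because the identity commutes with \<open>A\<close>. It
  exposes coefficients that can be matched with those of a product of exponential series.\<close>

lemma mat_pow_id_plus:
  assumes "finite S" "x \<in> S" "y \<in> S"
  shows "mat_pow S (\<lambda>x y. mat_id x y + e * A x y) m x y
    = (\<Sum>i\<le>m. real (m choose i) * e ^ i * mat_pow S A i x y)"
  using assms(2)
proof (induction m arbitrary: x)
  case 0
  then show ?case by simp
next
  case (Suc m)
  let ?B = "\<lambda>x y. mat_id x y + e * A x y"
  let ?F = "\<lambda>x. (\<Sum>i\<le>m. real (m choose i) * e ^ i * mat_pow S A i x y)"
  have "mat_pow S ?B (Suc m) x y = mat_pow S ?B m x y + e * (\<Sum>z\<in>S. A x z * mat_pow S ?B m z y)"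
    using Suc.prems assms(1)
    by (simp add: mat_mult_def mat_id_def distrib_right sum.distrib sum_distrib_left mult.assoc)
  also have "\<dots> = ?F x + e * (\<Sum>z\<in>S. A x z * ?F z)"
    using Suc by simp
  also have "(\<Sum>z\<in>S. A x z * ?F z) = (\<Sum>i\<le>m. real (m choose i) * e ^ i * mat_pow S A (Suc i) x y)"
    unfolding sum_distrib_left
    by (subst sum.swap) (simp add: mat_mult_def sum_distrib_left mult_ac)
  also have "e * \<dots> = (\<Sum>i\<le>m. real (m choose i) * e ^ Suc i * mat_pow S A (Suc i) x y)"
    by (simp add: sum_distrib_left mult_ac)
  also have "?F x + \<dots> = (\<Sum>i\<le>Suc m. real (Suc m choose i) * e ^ i * mat_pow S A i x y)"
  proof -
    \<comment> \<open>Adding the index \<open>Suc m\<close> is free because the binomial coefficient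
      \<open>m choose Suc m\<close> is zero; after splitting off index 0 the two sums combine by
      Pascal's rule.\<close>
    have "?F x = (\<Sum>i\<le>Suc m. real (m choose i) * e ^ i * mat_pow S A i x y)" by simp
    also have "\<dots> = mat_id x y + (\<Sum>i\<le>m. real (m choose Suc i) * e ^ Suc i * mat_pow S A (Suc i) x y)"
      by (subst sum.atMost_Suc_shift) simp
    finally show ?thesis
      by (subst sum.atMost_Suc_shift) (simp add: sum.distrib distrib_right del: mat_pow.simps(2))
  qed
  finally show ?case .
qed

text \<open>The expectation of \<open>(I + e A)\<^sup>a\<close> for a Poisson variable \<open>a\<close> of mean \<open>r\<close> is \<open>exp (r e A)\<close>.\<close>

lemma poisson_weight_mat_pow_sums:
  assumes "finite S" "x \<in> S" "y \<in> S"
  shows "(\<lambda>a. poisson_weight r a * mat_pow S (\<lambda>x y. mat_id x y + e * A x y) a x y)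
    sums mat_exp S (mat_scale (r * e) A) x y"
proof -
  let ?f = "\<lambda>i. (r * e) ^ i / fact i * mat_pow S A i x y"
  have *: "summable (\<lambda>i. norm (r ^ i / fact i))"
    using summable_exp_generic[of "\<bar>r\<bar>"] by (simp add: field_simps power_abs)
  \<comment> \<open>The series of the matrix exponential is multiplied by that of
    \<open>exp r\<close>; the normalizing factor \<open>exp (- r)\<close> of the Poisson weights
    then removes the latter.\<close>
  have "(\<lambda>m. exp (- r) * (\<Sum>i\<le>m. ?f i * (r ^ (m - i) / fact (m - i))))
      sums (exp (- r) * ((\<Sum>i. ?f i) * (\<Sum>i. r ^ i / fact i)))"
    using assms by (intro sums_mult Cauchy_product_sums mat_exp_scale_summable *)
  also have "(\<Sum>i. r ^ i / fact i) = exp r"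
    using exp_converges[of r] by (simp add: sums_iff field_simps)
  also have "exp (- r) * ((\<Sum>i. ?f i) * exp r) = mat_exp S (mat_scale (r * e) A) x y"
    by (simp add: mat_exp_scale_eq exp_minus)
  also have "(\<lambda>m. exp (- r) * (\<Sum>i\<le>m. ?f i * (r ^ (m - i) / fact (m - i))))
      = (\<lambda>a. poisson_weight r a * mat_pow S (\<lambda>x y. mat_id x y + e * A x y) a x y)"
  proof
    fix m
    have "?f i * (r ^ (m - i) / fact (m - i))
        = r ^ m / fact m * (real (m choose i) * e ^ i * mat_pow S A i x y)" if "i \<le> m" for i
    proof -
      have "r ^ m = r ^ i * r ^ (m - i)" using that by (simp flip: power_add)
      then show ?thesis using that by (simp add: binomial_fact power_mult_distrib field_simps)
    qed
    then have "(\<Sum>i\<le>m. ?f i * (r ^ (m - i) / fact (m - i)))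
        = r ^ m / fact m * (\<Sum>i\<le>m. real (m choose i) * e ^ i * mat_pow S A i x y)"
      by (simp add: sum_distrib_left)
    then show "exp (- r) * (\<Sum>i\<le>m. ?f i * (r ^ (m - i) / fact (m - i)))
        = poisson_weight r m * mat_pow S (\<lambda>x y. mat_id x y + e * A x y) m x y"
      using assms by (simp add: mat_pow_id_plus poisson_weight_def)
  qed
  finally show ?thesis .
qed

section \<open>The Poisson process\<close>

lemma poisson_weight_0: "poisson_weight 0 l = of_bool (l = 0)"
  by (simp add: poisson_weight_def)

lemma poisson_weight_sums: "poisson_weight r sums 1"
proof -
  have "(\<lambda>l. exp (- r) * (r ^ l / fact l)) sums (exp (- r) * exp r)"
    using exp_converges[of r] by (intro sums_mult) (simp add: field_simps)
  then show ?thesis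
    by (simp add: poisson_weight_def[abs_def] exp_minus mult_ac)
qed

text \<open>The index shift behind both moment identities: a factor equal to the index lowers the
  index by one and releases a factor \<open>r\<close>.\<close>

lemma poisson_weight_Suc: "real (Suc l) * poisson_weight r (Suc l) = r * poisson_weight r l"
proof -
  have "fact (Suc l) = real (Suc l) * fact l" by simp
  then show ?thesis unfolding poisson_weight_def by (simp del: of_nat_Suc)
qed

lemma poisson_weight_first_moment: "(\<lambda>l. real l * poisson_weight r l) sums r"
proof -
  have "(\<lambda>l. real (Suc l) * poisson_weight r (Suc l)) sums (r * 1)"
    unfolding poisson_weight_Suc by (intro sums_mult poisson_weight_sums)
  then show ?thesis by (subst (asm) sums_Suc_iff) simp
qed

lemma poisson_weight_second_factorial_moment:
  "(\<lambda>l. real l * (real l - 1) * poisson_weight r l) sums r\<^sup>2"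
proof -
  have "(\<lambda>l. real (Suc l) * (real (Suc l) - 1) * poisson_weight r (Suc l)) sums (r * r)"
  proof -
    have "real (Suc l) * (real (Suc l) - 1) * poisson_weight r (Suc l)
        = r * (real l * poisson_weight r l)" for l
      using arg_cong[OF poisson_weight_Suc[of l r], of "\<lambda>u. real l * u"] by (simp add: algebra_simps)
    then show ?thesis
      using sums_mult[OF poisson_weight_first_moment[of r], of r] by (simp only:)
  qed
  then show ?thesis by (subst (asm) sums_Suc_iff) (simp add: power2_eq_square)
qed

text \<open>Together with the successor case these are the forward equations of the Poisson process;
  index 0 stands apart because it has no predecessor.\<close>

lemma has_real_derivative_poisson_weight_0:
  "(((\<lambda>r. poisson_weight r 0)) has_real_derivative - poisson_weight r 0) (at r within A)"
  unfolding poisson_weight_def by (auto intro!: derivative_eq_intros)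

lemma has_real_derivative_poisson_weight_Suc:
  "(((\<lambda>r. poisson_weight r (Suc l))) has_real_derivative
     poisson_weight r l - poisson_weight r (Suc l)) (at r within A)"
proof -
  have "((\<lambda>r. r ^ Suc l * exp (- r)) has_real_derivative
      (real (Suc l) * r ^ l * exp (- r) - r ^ Suc l * exp (- r))) (at r within A)"
    by (auto intro!: derivative_eq_intros simp del: of_nat_Suc power_Suc)
  from DERIV_cdivide[OF this, of "fact (Suc l)"]
  have "((\<lambda>r. r ^ Suc l / fact (Suc l) * exp (- r)) has_real_derivative
      (real (Suc l) * r ^ l / fact (Suc l) * exp (- r) - r ^ Suc l / fact (Suc l) * exp (- r))) (at r within A)"
    by (simp add: diff_divide_distrib del: of_nat_Suc power_Suc fact_Suc)
  moreover have "real (Suc l) * r ^ l / fact (Suc l) = r ^ l / fact l"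
    by (simp del: of_nat_Suc)
  ultimately show ?thesis unfolding poisson_weight_def by (simp only:)
qed

lemma borel_measurable_poisson_weight [measurable (raw)]:
  fixes f :: "'a \<Rightarrow> real"
  assumes [measurable]: "f \<in> borel_measurable M"
  shows "(\<lambda>x. poisson_weight (f x) l) \<in> borel_measurable M"
  unfolding poisson_weight_def by measurable

text \<open>The sum is the probability that a Poisson process of rate \<open>\<mu>\<close> has \<open>m\<close> points in \<open>[0, t]\<close>,
  fewer than \<open>i\<close> of them in \<open>[0, t - u]\<close>; on differentiating, the summands telescope.\<close>

lemma has_real_derivative_poisson_late_point:
  assumes "1 \<le> i" "i \<le> m"
  shows "((\<lambda>u. \<Sum>l<i. poisson_weight (\<mu> * (t - u)) l * poisson_weight (\<mu> * u) (m - l))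
    has_real_derivative \<mu> * poisson_weight (\<mu> * (t - u)) (i - 1) * poisson_weight (\<mu> * u) (m - i))
      (at u within A)"
proof -
  have minus: "((\<lambda>u. \<mu> * (t - u)) has_real_derivative - \<mu>) (at u within A)"
    and plus: "((\<lambda>u. \<mu> * u) has_real_derivative \<mu>) (at u within A)"
    by (auto intro!: derivative_eq_intros)
  note d0 = DERIV_chain2[OF has_real_derivative_poisson_weight_0 minus]
    and d1 = DERIV_chain2[OF has_real_derivative_poisson_weight_Suc minus]
    and d2 = DERIV_chain2[OF has_real_derivative_poisson_weight_Suc plus]
  show ?thesis
    using assms
  proof (induction i rule: dec_induct)
    case base
    then obtain m' where m: "m = Suc m'" by (cases m) auto
    have "((\<lambda>u. poisson_weight (\<mu> * (t - u)) 0 * poisson_weight (\<mu> * u) (Suc m'))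
      has_real_derivative \<mu> * poisson_weight (\<mu> * (t - u)) 0 * poisson_weight (\<mu> * u) m') (at u within A)"
      by (rule DERIV_cong[OF DERIV_mult[OF d0 d2]]) (simp add: algebra_simps)
    then show ?case by (simp add: m)
  next
    case (step i)
    then obtain i' where i: "i = Suc i'" by (cases i) auto
    have "m - i = Suc (m - Suc i)" using step by simp
    note m = this[unfolded i]
    \<comment> \<open>The new summand has as derivative the claimed value for \<open>Suc i\<close>
      minus the claimed value for \<open>i\<close>, so adding it to the induction hypothesis
      telescopes.\<close>
    have "((\<lambda>u. poisson_weight (\<mu> * (t - u)) (Suc i') * poisson_weight (\<mu> * u) (Suc (m - Suc (Suc i'))))
      has_real_derivative \<mu> * poisson_weight (\<mu> * (t - u)) i * poisson_weight (\<mu> * u) (m - Suc i)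
        - \<mu> * poisson_weight (\<mu> * (t - u)) (i - 1) * poisson_weight (\<mu> * u) (m - i)) (at u within A)"
      unfolding i m
      by (rule DERIV_cong[OF DERIV_mult[OF d1 d2]]) (simp add: algebra_simps)
    then have A: "((\<lambda>u. poisson_weight (\<mu> * (t - u)) i * poisson_weight (\<mu> * u) (m - i))
      has_real_derivative \<mu> * poisson_weight (\<mu> * (t - u)) i * poisson_weight (\<mu> * u) (m - Suc i)
        - \<mu> * poisson_weight (\<mu> * (t - u)) (i - 1) * poisson_weight (\<mu> * u) (m - i)) (at u within A)"
      using m by (simp add: i)
    have "i \<le> m" using step by simp
    from DERIV_add[OF step.IH[OF this] A] show ?case by simp
  qed
qed

text \<open>The count is expressed by the block sizes \<open>b - a\<close> and \<open>c - b\<close>,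
  which will become independent Poisson increments. Either the first index lies in the earlier
  block, and then the indices differ automatically, or both lie in the common tail.\<close>

lemma card_distinct_pairs_tails:
  fixes a b c :: nat
  assumes "a \<le> b" "b \<le> c"
  shows "card {(i, i'). i \<in> {a<..c} \<and> i' \<in> {b<..c} \<and> i \<noteq> i'}
    = (b - a) * (c - b) + (c - b) * (c - b - 1)"
proof -
  have "{(i, i'). i \<in> {a<..c} \<and> i' \<in> {b<..c} \<and> i \<noteq> i'}
      = {a<..c} \<times> {b<..c} - (\<lambda>i. (i, i)) ` {b<..c}" using assms by auto
  also have "card \<dots> = (c - a) * (c - b) - (c - b)"
    using assms by (subst card_Diff_subset) (auto simp: card_image inj_on_def)
  also have "\<dots> = (b - a) * (c - b) + (c - b) * (c - b - 1)"
  proof -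
    obtain x y where "b = a + x" "c = a + x + y" using assms by (metis le_Suc_ex)
    then show ?thesis by (simp add: algebra_simps)
  qed
  finally show ?thesis .
qed

section \<open>Counts, jump times and increments of a Poisson process\<close>

locale poisson_counting = prob_space M for M :: "'a measure" +
  fixes N :: "real \<Rightarrow> 'a \<Rightarrow> nat" and \<mu> :: real
  assumes poisson: "poisson_process M \<mu> N" and rate_pos: "0 < \<mu>"
begin

lemma measurable_count [measurable]: "0 \<le> t \<Longrightarrow> N t \<in> measurable M (count_space UNIV)"
  using poisson by (simp add: poisson_process_def)

lemma count_0: "\<omega> \<in> space M \<Longrightarrow> N 0 \<omega> = 0"
  using poisson by (simp add: poisson_process_def)

lemma count_mono: "\<omega> \<in> space M \<Longrightarrow> 0 \<le> s \<Longrightarrow> s \<le> t \<Longrightarrow> N s \<omega> \<le> N t \<omega>"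
  using poisson by (auto simp: poisson_process_def mono_on_def)

text \<open>Right-continuity into a discrete space means local constancy to the right. This is what
  makes the infimum in the definition of a jump time attained.\<close>

lemma count_right_const:
  assumes "\<omega> \<in> space M" "0 \<le> t"
  shows "\<exists>b>t. \<forall>s. t < s \<and> s < b \<longrightarrow> N s \<omega> = N t \<omega>"
proof -
  have "continuous (at_right t) (\<lambda>s. N s \<omega>)"
    using poisson assms by (auto simp: poisson_process_def)
  then have "\<forall>\<^sub>F s in at_right t. N s \<omega> = N t \<omega>"
    by (simp add: continuous_within tendsto_discrete)
  then show ?thesis
    by (subst (asm) eventually_at_right[of _ "t + 1"]) auto
qed

lemma jump_time_nonneg:
  assumes "0 \<le> t" "i \<le> N t \<omega>"
  shows "0 \<le> jump_time N i \<omega>"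
  using assms unfolding jump_time_def by (intro cInf_greatest) auto

text \<open>The hypothesis \<open>i \<le> N t \<omega>\<close> keeps the set under the infimum
  nonempty; without it the jump time would be an unspecified real.\<close>

lemma jump_time_le_iff:
  assumes "\<omega> \<in> space M" "0 \<le> t" "i \<le> N t \<omega>" "0 \<le> s"
  shows "jump_time N i \<omega> \<le> s \<longleftrightarrow> i \<le> N s \<omega>"
proof -
  let ?A = "{t. 0 \<le> t \<and> i \<le> N t \<omega>}" and ?T = "jump_time N i \<omega>"
  have ne: "?A \<noteq> {}" and bdd: "bdd_below ?A" using assms by (auto intro: bdd_belowI[of _ 0])
  have T0: "0 \<le> ?T" using jump_time_nonneg assms by blast
  obtain b where b: "b > ?T" "\<And>s. ?T < s \<Longrightarrow> s < b \<Longrightarrow> N s \<omega> = N ?T \<omega>"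
    using count_right_const[OF assms(1) T0] by blast
  obtain a where a: "a \<in> ?A" "a < b"
    using b(1) cInf_less_iff[OF ne bdd, of b] unfolding jump_time_def by blast
  have "?T \<le> a" using a(1) bdd unfolding jump_time_def by (intro cInf_lower)
  then have "N a \<omega> = N ?T \<omega>" using b(2)[of a] a(2) by (cases "?T = a") auto
  then have "i \<le> N ?T \<omega>" using a by simp
  then show ?thesis
    using count_mono[OF assms(1) T0, of s] cInf_lower[OF _ bdd, of s] assms(4)
    by (auto simp: jump_time_def)
qed

text \<open>The definition of the process covers \<open>s < t\<close> only. Equal times are added
  because elapsed times cut off at 0 or \<open>t\<close> occur later, and there the weight of mean 0
  is the point mass at 0.\<close>

lemma prob_increment:
  assumes "0 \<le> s" "s \<le> t"
  shows "prob {\<omega>\<in>space M. N t \<omega> - N s \<omega> = a} = poisson_weight (\<mu> * (t - s)) a"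
proof (cases "s = t")
  case True
  then show ?thesis by (simp add: poisson_weight_0 prob_space)
next
  case False
  then have st: "s < t" using assms by simp
  then have r: "0 < \<mu> * (t - s)" using rate_pos by simp
  have t: "0 \<le> t" using assms by simp
  note [measurable] = measurable_count[OF assms(1)] measurable_count[OF t]
  have "prob {\<omega>\<in>space M. N t \<omega> - N s \<omega> = a}
      = measure (distr M (count_space UNIV) (\<lambda>\<omega>. N t \<omega> - N s \<omega>)) {a}"
    by (subst measure_distr) (auto intro!: arg_cong[where f=prob])
  also have "distr M (count_space UNIV) (\<lambda>\<omega>. N t \<omega> - N s \<omega>) = measure_pmf (poisson_pmf (\<mu> * (t - s)))"
    using poisson[unfolded poisson_process_def, THEN conjunct2, THEN conjunct2, THEN conjunct1] st assms
    by simp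
  finally show ?thesis
    using r by (simp add: measure_pmf_single poisson_weight_def)
qed

lemma prob_two_increments:
  assumes "0 \<le> r" "r \<le> s" "s \<le> t"
  shows "prob {\<omega>\<in>space M. N s \<omega> - N r \<omega> = a \<and> N t \<omega> - N s \<omega> = b}
    = poisson_weight (\<mu> * (s - r)) a * poisson_weight (\<mu> * (t - s)) b"
proof -
  consider "r = s" | "s = t" | "r < s" "s < t" using assms by linarith
  then show ?thesis
  proof cases
    case 1
    then show ?thesis
      using prob_increment[of s t b] assms by (cases "a = 0") (auto simp: poisson_weight_0)
  next
    case 2
    then show ?thesis
      using prob_increment[of r s a] assms by (cases "b = 0") (auto simp: poisson_weight_0)
  next
    case 3
    \<comment> \<open>Independence of increments is given along infinite strictly increasing
      sequences, so the three times are continued after \<open>t\<close> by unit steps.\<close>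
    define \<sigma> where "\<sigma> = (\<lambda>l::nat. if l = 0 then r else if l = 1 then s else t + real (l - 2))"
    have mono: "strict_mono \<sigma>"
      unfolding strict_mono_Suc_iff \<sigma>_def using 3 by auto
    have "indep_vars (\<lambda>_. count_space UNIV) (\<lambda>l \<omega>. N (\<sigma> (Suc l)) \<omega> - N (\<sigma> l) \<omega>) {..<2::nat}"
    proof -
      have "0 \<le> \<sigma> 0" using assms by (simp add: \<sigma>_def)
      with mono show ?thesis
        using poisson[unfolded poisson_process_def, THEN conjunct2, THEN conjunct2, THEN conjunct2] by simp
    qed
    from indep_varsD_finite[OF this, of "\<lambda>l. if l = 0 then {a} else {b}"]
    have "prob (\<Inter>l\<in>{..<2::nat}. (\<lambda>\<omega>. N (\<sigma> (Suc l)) \<omega> - N (\<sigma> l) \<omega>) -` (if l = 0 then {a} else {b}) \<inter> space M)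
      = (\<Prod>l\<in>{..<2::nat}. prob ((\<lambda>\<omega>. N (\<sigma> (Suc l)) \<omega> - N (\<sigma> l) \<omega>) -` (if l = 0 then {a} else {b}) \<inter> space M))"
      by (auto simp: lessThan_empty_iff)
    moreover have "{..<2::nat} = {0, 1}" by auto
    moreover have "((\<lambda>\<omega>. N s \<omega> - N r \<omega>) -` {a} \<inter> space M) = {\<omega>\<in>space M. N s \<omega> - N r \<omega> = a}"
      "((\<lambda>\<omega>. N t \<omega> - N s \<omega>) -` {b} \<inter> space M) = {\<omega>\<in>space M. N t \<omega> - N s \<omega> = b}"
      "{\<omega>\<in>space M. N s \<omega> - N r \<omega> = a} \<inter> {\<omega>\<in>space M. N t \<omega> - N s \<omega> = b}
        = {\<omega>\<in>space M. N s \<omega> - N r \<omega> = a \<and> N t \<omega> - N s \<omega> = b}" by auto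
    ultimately show ?thesis
      using prob_increment[of r s a] prob_increment[of s t b] assms
      by (simp add: \<sigma>_def)
  qed
qed

text \<open>The integrand is the density of having point i at time \<open>t - v\<close>, with i - 1
  points before it and m - i after it. In this form \<open>u\<close> occurs only as the end of the
  range of integration, which is what the layer-cake formula needs when \<open>u\<close> is
  randomized.\<close>

lemma emeasure_late_point:
  assumes "0 \<le> u" "u \<le> t" "1 \<le> i" "i \<le> m"
  shows "emeasure M {\<omega>\<in>space M. N t \<omega> = m \<and> N (t - u) \<omega> < i}
    = (\<integral>\<^sup>+v. ennreal (\<mu> * poisson_weight (\<mu> * (t - v)) (i - 1) * poisson_weight (\<mu> * v) (m - i))
        * indicator {0..u} v \<partial>lborel)"
proof -
  have t: "0 \<le> t" "0 \<le> t - u" using assms by auto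
  note [measurable] = measurable_count[OF t(1)] measurable_count[OF t(2)]
  let ?F = "\<lambda>u. \<Sum>l<i. poisson_weight (\<mu> * (t - u)) l * poisson_weight (\<mu> * u) (m - l)"
  have "{\<omega>\<in>space M. N t \<omega> = m \<and> N (t - u) \<omega> < i}
      = (\<Union>l<i. {\<omega>\<in>space M. N (t - u) \<omega> - N 0 \<omega> = l \<and> N t \<omega> - N (t - u) \<omega> = m - l})"
  proof -
    have "N t \<omega> = m \<and> N (t - u) \<omega> < i
      \<longleftrightarrow> (\<exists>l<i. N (t - u) \<omega> - N 0 \<omega> = l \<and> N t \<omega> - N (t - u) \<omega> = m - l)" if "\<omega> \<in> space M" for \<omega>
      using count_mono[OF that t(2), of t] assms by (auto simp: count_0[OF that])
    then show ?thesis by blast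
  qed
  also have "prob \<dots> = (\<Sum>l<i. prob {\<omega>\<in>space M. N (t - u) \<omega> - N 0 \<omega> = l \<and> N t \<omega> - N (t - u) \<omega> = m - l})"
    using assms by (intro finite_measure_finite_Union) (auto simp: disjoint_family_on_def)
  also have "\<dots> = ?F u"
    using assms by (intro sum.cong refl) (subst prob_two_increments, auto)
  finally have "emeasure M {\<omega>\<in>space M. N t \<omega> = m \<and> N (t - u) \<omega> < i} = ennreal (?F u)"
    by (simp add: emeasure_eq_measure)
  \<comment> \<open>At \<open>u = 0\<close> every summand contains
    \<open>poisson_weight 0 (m - l)\<close> with \<open>l < i \<le> m\<close>, hence is zero; so the
    fundamental theorem of calculus applies to \<open>?F u\<close> itself.\<close>
  also have "?F u = ?F u - ?F 0"
    using assms by (auto simp: poisson_weight_0 intro!: sum.neutral)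
  also have "ennreal \<dots> = (\<integral>\<^sup>+v. ennreal (\<mu> * poisson_weight (\<mu> * (t - v)) (i - 1) * poisson_weight (\<mu> * v) (m - i))
        * indicator {0..u} v \<partial>lborel)"
    using assms rate_pos
    by (intro nn_integral_FTC_Icc[symmetric] DERIV_subset[OF has_real_derivative_poisson_late_point])
       (auto intro!: mult_nonneg_nonneg poisson_weight_nonneg)
  finally show ?thesis .
qed

lemma nn_integral_two_increments:
  fixes h :: "nat \<Rightarrow> nat \<Rightarrow> real"
  assumes "0 \<le> r" "r \<le> s" "s \<le> t" and h: "\<And>a b. 0 \<le> h a b"
  shows "(\<integral>\<^sup>+\<omega>. ennreal (h (N s \<omega> - N r \<omega>) (N t \<omega> - N s \<omega>)) \<partial>M)
    = (\<Sum>a. \<Sum>b. ennreal (h a b * (poisson_weight (\<mu> * (s - r)) a * poisson_weight (\<mu> * (t - s)) b)))"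
proof -
  have [measurable]: "N r \<in> measurable M (count_space UNIV)" "N s \<in> measurable M (count_space UNIV)"
    "N t \<in> measurable M (count_space UNIV)" using assms by auto
  let ?E = "\<lambda>a b. {\<omega>\<in>space M. N s \<omega> - N r \<omega> = a \<and> N t \<omega> - N s \<omega> = b}"
  have "(\<integral>\<^sup>+\<omega>. ennreal (h (N s \<omega> - N r \<omega>) (N t \<omega> - N s \<omega>)) \<partial>M)
      = (\<integral>\<^sup>+\<omega>. (\<Sum>a. \<Sum>b. ennreal (h a b) * indicator (?E a b) \<omega>) \<partial>M)"
  proof (intro nn_integral_cong)
    fix \<omega> assume \<omega>: "\<omega> \<in> space M"
    let ?a = "N s \<omega> - N r \<omega>" and ?b = "N t \<omega> - N s \<omega>"
    have "(\<Sum>a. \<Sum>b. ennreal (h a b) * indicator (?E a b) \<omega>)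
        = (\<Sum>a\<in>{?a}. \<Sum>b. ennreal (h a b) * indicator (?E a b) \<omega>)"
      by (intro suminf_finite) (auto simp: indicator_def)
    also have "\<dots> = (\<Sum>b\<in>{?b}. ennreal (h ?a b) * indicator (?E ?a b) \<omega>)"
      by (subst suminf_finite[of "{?b}"]) (auto simp: indicator_def)
    finally show "ennreal (h ?a ?b) = (\<Sum>a. \<Sum>b. ennreal (h a b) * indicator (?E a b) \<omega>)"
      using \<omega> by (simp add: indicator_def)
  qed
  also have "\<dots> = (\<Sum>a. \<Sum>b. ennreal (h a b) * emeasure M (?E a b))"
    by (simp add: nn_integral_suminf nn_integral_cmult_indicator)
  also have "\<dots> = (\<Sum>a. \<Sum>b. ennreal (h a b * (poisson_weight (\<mu> * (s - r)) a * poisson_weight (\<mu> * (t - s)) b)))"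
    using assms rate_pos
    by (simp add: emeasure_eq_measure prob_two_increments ennreal_mult h poisson_weight_nonneg)
  finally show ?thesis .
qed

text \<open>With independent increments of means x before \<open>s'\<close> and y after it, the mean
  number of pairs is x y + y^2 = (x + y) y. Leaving out equal indices turns the second moment of the
  later increment into its factorial moment, which is why the answer is a pure product.\<close>

lemma nn_integral_distinct_pairs_tails_ordered:
  assumes "0 \<le> s" "s \<le> s'" "s' \<le> t"
  shows "(\<integral>\<^sup>+\<omega>. ennreal (real (card {(i, i'). i \<in> {N s \<omega><..N t \<omega>} \<and> i' \<in> {N s' \<omega><..N t \<omega>} \<and> i \<noteq> i'})) \<partial>M)
    = ennreal (\<mu>\<^sup>2 * (t - s) * (t - s'))"
proof -
  let ?x = "\<mu> * (s' - s)" and ?y = "\<mu> * (t - s')"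
  let ?h = "\<lambda>a b. real a * real b + real b * (real b - 1)"
  have xy: "0 \<le> ?x" "0 \<le> ?y" using assms rate_pos by auto
  have h: "0 \<le> ?h a b" for a b by (cases b) auto
  have "(\<integral>\<^sup>+\<omega>. ennreal (real (card {(i, i'). i \<in> {N s \<omega><..N t \<omega>} \<and> i' \<in> {N s' \<omega><..N t \<omega>} \<and> i \<noteq> i'})) \<partial>M)
      = (\<integral>\<^sup>+\<omega>. ennreal (?h (N s' \<omega> - N s \<omega>) (N t \<omega> - N s' \<omega>)) \<partial>M)"
  proof (intro nn_integral_cong)
    fix \<omega> assume "\<omega> \<in> space M"
    then have "N s \<omega> \<le> N s' \<omega>" "N s' \<omega> \<le> N t \<omega>" using assms by (auto intro: count_mono)
    note card_distinct_pairs_tails[OF this]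
    moreover have "real (b * (b - 1)) = real b * (real b - 1)" for b by (cases b) (auto simp: algebra_simps)
    ultimately show "ennreal (real (card {(i, i'). i \<in> {N s \<omega><..N t \<omega>} \<and> i' \<in> {N s' \<omega><..N t \<omega>} \<and> i \<noteq> i'}))
      = ennreal (?h (N s' \<omega> - N s \<omega>) (N t \<omega> - N s' \<omega>))"
      by (simp only: of_nat_add of_nat_mult)
  qed
  also have "\<dots> = (\<Sum>a. \<Sum>b. ennreal (?h a b * (poisson_weight ?x a * poisson_weight ?y b)))"
    using assms by (intro nn_integral_two_increments h)
  also have "\<dots> = (\<Sum>a. ennreal (poisson_weight ?x a * (real a * ?y + ?y\<^sup>2)))"
  proof (intro suminf_cong suminf_ennreal_eq)
    fix a
    have "(\<lambda>b. poisson_weight ?x a * (real a * (real b * poisson_weight ?y b)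
        + real b * (real b - 1) * poisson_weight ?y b)) sums (poisson_weight ?x a * (real a * ?y + ?y\<^sup>2))"
      by (intro sums_mult sums_add poisson_weight_first_moment poisson_weight_second_factorial_moment)
    then show "(\<lambda>b. ?h a b * (poisson_weight ?x a * poisson_weight ?y b)) sums
        (poisson_weight ?x a * (real a * ?y + ?y\<^sup>2))" by (simp add: algebra_simps)
    show "0 \<le> ?h a b * (poisson_weight ?x a * poisson_weight ?y b)" for b
      by (intro mult_nonneg_nonneg h poisson_weight_nonneg xy)
  qed
  also have "\<dots> = ennreal (?x * ?y + 1 * ?y\<^sup>2)"
  proof (intro suminf_ennreal_eq)
    have "(\<lambda>a. real a * poisson_weight ?x a * ?y + poisson_weight ?x a * ?y\<^sup>2) sums (?x * ?y + 1 * ?y\<^sup>2)"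
      by (intro sums_add sums_mult2 poisson_weight_first_moment poisson_weight_sums)
    then show "(\<lambda>a. poisson_weight ?x a * (real a * ?y + ?y\<^sup>2)) sums (?x * ?y + 1 * ?y\<^sup>2)"
      by (simp add: algebra_simps)
    show "0 \<le> poisson_weight ?x a * (real a * ?y + ?y\<^sup>2)" for a
      by (intro mult_nonneg_nonneg add_nonneg_nonneg poisson_weight_nonneg xy) (use xy in auto)
  qed
  also have "?x * ?y + 1 * ?y\<^sup>2 = \<mu>\<^sup>2 * (t - s) * (t - s')"
    by (simp add: power2_eq_square algebra_simps)
  finally show ?thesis .
qed

lemma nn_integral_distinct_pairs_tails:
  assumes "0 \<le> s" "0 \<le> s'" "s \<le> t" "s' \<le> t"
  shows "(\<integral>\<^sup>+\<omega>. ennreal (real (card {(i, i'). i \<in> {N s \<omega><..N t \<omega>} \<and> i' \<in> {N s' \<omega><..N t \<omega>} \<and> i \<noteq> i'})) \<partial>M)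
    = ennreal (\<mu>\<^sup>2 * (t - s) * (t - s'))"
proof (cases "s \<le> s'")
  case True
  then show ?thesis using assms by (intro nn_integral_distinct_pairs_tails_ordered)
next
  case False
  have "card {(i, i'). i \<in> {N s \<omega><..N t \<omega>} \<and> i' \<in> {N s' \<omega><..N t \<omega>} \<and> i \<noteq> i'}
    = card {(i, i'). i \<in> {N s' \<omega><..N t \<omega>} \<and> i' \<in> {N s \<omega><..N t \<omega>} \<and> i \<noteq> i'}" for \<omega>
    by (intro bij_betw_same_card[of prod.swap] bij_betw_byWitness[where f'=prod.swap]) auto
  then show ?thesis
    using nn_integral_distinct_pairs_tails_ordered[of s' s t] False assms by (simp add: mult_ac)
qed

end

section \<open>The Markov chain\<close>

context prob_space
begin

text \<open>The Markov property is given for complete histories. All histories in \<open>H\<close>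
  end in the same state, so they share one transition factor, and their disjoint events can be
  added.\<close>

lemma markov_chain_path_step:
  assumes mc: "markov_chain M S \<nu> Q X" and fin: "finite S"
    and H: "H \<subseteq> PiE {..m} (\<lambda>_. S)" "\<And>p. p \<in> H \<Longrightarrow> p m = y" and y': "y' \<in> S"
  shows "prob {\<omega>\<in>space M. (\<exists>p\<in>H. \<forall>l\<le>m. X l \<omega> = p l) \<and> X (Suc m) \<omega> = y'}
    = prob {\<omega>\<in>space M. \<exists>p\<in>H. \<forall>l\<le>m. X l \<omega> = p l} * Q y y'"
proof -
  have [measurable]: "X i \<in> measurable M (count_space S)" for i
    using mc by (simp add: markov_chain_def)
  have finH: "finite H"
    using H(1) by (rule finite_subset) (simp add: finite_PiE fin)
  let ?A = "\<lambda>p. {\<omega>\<in>space M. \<forall>l\<le>m. X l \<omega> = p l}"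
  let ?B = "\<lambda>p. {\<omega>\<in>space M. (\<forall>l\<le>m. X l \<omega> = p l) \<and> X (Suc m) \<omega> = y'}"
  have disj: "p = q" if "p \<in> H" "q \<in> H" "\<forall>l\<le>m. p l = q l" for p q
    using that H(1) by (intro PiE_ext[of p "{..m}" "\<lambda>_. S" q]) auto
  have meas: "?A p \<in> events" "?B p \<in> events" for p
    by measurable
  have "prob (\<Union>p\<in>H. ?B p) = (\<Sum>p\<in>H. prob (?B p))"
    using meas finH disj
    by (intro finite_measure_finite_Union) (fastforce simp: disjoint_family_on_def)+
  also have "\<dots> = (\<Sum>p\<in>H. prob (?A p) * Q y y')"
  proof (intro sum.cong refl)
    fix p assume p: "p \<in> H"
    let ?p = "p(Suc m := y')"
    have "\<forall>i\<le>Suc m. ?p i \<in> S" using p H(1) y' by (auto simp: PiE_iff le_Suc_eq)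
    then have "prob {\<omega>\<in>space M. \<forall>i\<le>Suc m. X i \<omega> = ?p i}
      = prob {\<omega>\<in>space M. \<forall>i\<le>m. X i \<omega> = ?p i} * Q (?p m) (?p (Suc m))"
      using mc unfolding markov_chain_def by blast
    moreover have "{\<omega>\<in>space M. \<forall>i\<le>Suc m. X i \<omega> = ?p i} = ?B p" by (auto simp: le_Suc_eq)
    ultimately show "prob (?B p) = prob (?A p) * Q y y'" using H(2)[OF p] by simp
  qed
  also have "\<dots> = prob (\<Union>p\<in>H. ?A p) * Q y y'"
    using meas finH disj unfolding sum_distrib_right[symmetric]
    by (subst finite_measure_finite_Union) (fastforce simp: disjoint_family_on_def)+
  also have "(\<Union>p\<in>H. ?A p) = {\<omega>\<in>space M. \<exists>p\<in>H. \<forall>l\<le>m. X l \<omega> = p l}" by auto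
  also have "(\<Union>p\<in>H. ?B p) = {\<omega>\<in>space M. (\<exists>p\<in>H. \<forall>l\<le>m. X l \<omega> = p l) \<and> X (Suc m) \<omega> = y'}" by auto
  finally show ?thesis .
qed

text \<open>Here the set of histories is fixed by the values at the two times \<open>i\<close> and
  \<open>m\<close>. Carrying the earlier value along lets an induction on the elapsed time run
  without conditional probabilities.\<close>

lemma markov_chain_step:
  assumes mc: "markov_chain M S \<nu> Q X" and fin: "finite S" and "i \<le> m" "y' \<in> S"
  shows "prob {\<omega>\<in>space M. X i \<omega> = z \<and> X m \<omega> = y \<and> X (Suc m) \<omega> = y'}
    = prob {\<omega>\<in>space M. X i \<omega> = z \<and> X m \<omega> = y} * Q y y'"
proof -
  have "X i \<in> measurable M (count_space S)" for i
    using mc by (simp add: markov_chain_def)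
  from measurable_space[OF this] have X: "X i \<omega> \<in> S" if "\<omega> \<in> space M" for i \<omega>
    using that by simp
  let ?H = "{p \<in> PiE {..m} (\<lambda>_. S). p i = z \<and> p m = y}"
  have "(\<exists>p\<in>?H. \<forall>l\<le>m. X l \<omega> = p l) \<longleftrightarrow> X i \<omega> = z \<and> X m \<omega> = y" if "\<omega> \<in> space M" for \<omega>
  proof
    assume "X i \<omega> = z \<and> X m \<omega> = y"
    then show "\<exists>p\<in>?H. \<forall>l\<le>m. X l \<omega> = p l"
      using X[OF that] assms(3) by (intro bexI[of _ "restrict (\<lambda>l. X l \<omega>) {..m}"]) auto
  qed (use assms(3) in auto)
  note iff = this
  have "{\<omega>\<in>space M. (\<exists>p\<in>?H. \<forall>l\<le>m. X l \<omega> = p l) \<and> X (Suc m) \<omega> = y'}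
      = {\<omega>\<in>space M. X i \<omega> = z \<and> X m \<omega> = y \<and> X (Suc m) \<omega> = y'}"
    by (rule Collect_cong) (simp only: iff conj_assoc cong: conj_cong)
  moreover have "{\<omega>\<in>space M. \<exists>p\<in>?H. \<forall>l\<le>m. X l \<omega> = p l}
      = {\<omega>\<in>space M. X i \<omega> = z \<and> X m \<omega> = y}"
    by (rule Collect_cong) (simp only: iff cong: conj_cong)
  moreover have "prob {\<omega>\<in>space M. (\<exists>p\<in>?H. \<forall>l\<le>m. X l \<omega> = p l) \<and> X (Suc m) \<omega> = y'}
      = prob {\<omega>\<in>space M. \<exists>p\<in>?H. \<forall>l\<le>m. X l \<omega> = p l} * Q y y'"
    by (rule markov_chain_path_step[OF mc fin]) (use assms(4) in auto)
  ultimately show ?thesis by (simp only:)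
qed

lemma markov_chain_transition:
  assumes mc: "markov_chain M S \<nu> Q X" and fin: "finite S" and "z \<in> S" "y \<in> S"
  shows "prob {\<omega>\<in>space M. X i \<omega> = z \<and> X (i + d) \<omega> = y}
    = prob {\<omega>\<in>space M. X i \<omega> = z} * mat_pow S Q d z y"
  using assms(4)
proof (induction d arbitrary: y)
  case 0
  have "{\<omega>\<in>space M. X i \<omega> = z \<and> X i \<omega> = y} = (if z = y then {\<omega>\<in>space M. X i \<omega> = z} else {})"
    by auto
  then show ?case by (simp add: mat_id_def)
next
  case (Suc d)
  have [measurable]: "X i \<in> measurable M (count_space S)" for i
    using mc by (simp add: markov_chain_def)
  have X: "X i \<omega> \<in> S" if "\<omega> \<in> space M" for i \<omega>
    using measurable_space[of "X i" M "count_space S" \<omega>] that by simp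
  let ?B = "\<lambda>w. {\<omega>\<in>space M. X i \<omega> = z \<and> X (i + d) \<omega> = w \<and> X (Suc (i + d)) \<omega> = y}"
  have "{\<omega>\<in>space M. X i \<omega> = z \<and> X (i + Suc d) \<omega> = y} = (\<Union>w\<in>S. ?B w)"
    using X by auto
  also have "prob \<dots> = (\<Sum>w\<in>S. prob (?B w))"
    using fin by (intro finite_measure_finite_Union) (auto simp: disjoint_family_on_def)
  also have "\<dots> = (\<Sum>w\<in>S. prob {\<omega>\<in>space M. X i \<omega> = z} * mat_pow S Q d z w * Q w y)"
    using Suc by (intro sum.cong refl) (simp add: markov_chain_step[OF mc fin])
  also have "\<dots> = prob {\<omega>\<in>space M. X i \<omega> = z} * mat_pow S Q (Suc d) z y"
    using Suc.prems fin assms(3)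
    by (subst mat_pow_Suc_right) (auto simp: mat_mult_def sum_distrib_left mult.assoc)
  finally show ?case .
qed

lemma markov_chain_started_two_times:
  assumes mc: "markov_chain M S (\<lambda>z. of_bool (z = x)) Q X" and fin: "finite S"
    and S: "x \<in> S" "z \<in> S" "y \<in> S" and "i \<le> m"
  shows "prob {\<omega>\<in>space M. X i \<omega> = z \<and> X m \<omega> = y} = mat_pow S Q i x z * mat_pow S Q (m - i) z y"
proof -
  have [measurable]: "X i \<in> measurable M (count_space S)" for i
    using mc by (simp add: markov_chain_def)
  have 0: "prob {\<omega>\<in>space M. X 0 \<omega> = x} = 1"
    using mc S by (simp add: markov_chain_def)
  then have "AE \<omega> in M. X 0 \<omega> = x"
    by (subst (asm) prob_Collect_eq_1) auto
  \<comment> \<open>As \<open>X 0\<close> equals \<open>x\<close> almost surely, this may be added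
    to the event, which turns the marginal at time \<open>i\<close> into a transition from time
    0.\<close>
  then have "prob {\<omega>\<in>space M. X i \<omega> = z} = prob {\<omega>\<in>space M. X 0 \<omega> = x \<and> X (0 + i) \<omega> = z}"
    by (intro measure_eq_AE) auto
  also have "\<dots> = mat_pow S Q i x z"
    using 0 by (subst markov_chain_transition[OF mc fin]) (use S in auto)
  finally show ?thesis
    using markov_chain_transition[OF mc fin S(2,3), of i "m - i"] assms(6) by simp
qed

end

section \<open>Integration against independent variables\<close>

text \<open>Freezing an independent variable: \<open>R\<close> is replaced by a constant that is
  integrated against its law. The partner of \<open>R\<close> is the identity map into the
  sigma-algebra of \<open>F\<close>, so a whole process can be kept without describing its joint
  law.\<close>

lemma (in prob_space) emeasure_indep_fubini:
  assumes indep: "indep_set (sets F) (sets G)" and sp: "space F = space M" "space G = space M"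
    and R: "R \<in> measurable G B" and \<Phi>: "\<Phi> \<in> sets (F \<Otimes>\<^sub>M B)"
  shows "emeasure M {\<omega>\<in>space M. (\<omega>, R \<omega>) \<in> \<Phi>}
    = (\<integral>\<^sup>+r. emeasure M {\<omega>\<in>space M. (\<omega>, r) \<in> \<Phi>} \<partial>(distr M B R))"
    and "(\<lambda>r. emeasure M {\<omega>\<in>space M. (\<omega>, r) \<in> \<Phi>}) \<in> borel_measurable B"
proof -
  have FG: "sets F \<subseteq> events" "sets G \<subseteq> events"
    using indep_setD_ev1[OF indep] indep_setD_ev2[OF indep] .
  have idF: "(\<lambda>\<omega>. \<omega>) \<in> measurable M F" 
  proof (rule measurableI)
    fix A assume A: "A \<in> sets F"
    then have "(\<lambda>\<omega>. \<omega>) -` A \<inter> space M = A" using sets.sets_into_space[OF A] sp by auto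
    then show "(\<lambda>\<omega>. \<omega>) -` A \<inter> space M \<in> events" using A FG by auto
  qed (simp add: sp)
  have RM: "R \<in> measurable M B"
    by (rule measurableI) (use measurable_space[OF R] measurable_sets[OF R] FG sp in auto)
  have RF: "(\<lambda>\<omega>. (\<omega>, R \<omega>)) \<in> measurable M (F \<Otimes>\<^sub>M B)"
    by (rule measurable_Pair[OF idF RM])
  interpret F: prob_space "distr M F (\<lambda>\<omega>. \<omega>)" by (rule prob_space_distr[OF idF])
  interpret R: prob_space "distr M B R" by (rule prob_space_distr[OF RM])
  interpret FR: pair_sigma_finite "distr M F (\<lambda>\<omega>. \<omega>)" "distr M B R" ..
  \<comment> \<open>Independence of the two sigma-algebras is exactly the product formula on
    rectangles, and these determine the product measure.\<close>
  have eq: "distr M F (\<lambda>\<omega>. \<omega>) \<Otimes>\<^sub>M distr M B R = distr M (F \<Otimes>\<^sub>M B) (\<lambda>\<omega>. (\<omega>, R \<omega>))"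
  proof (rule pair_measure_eqI)
    fix A C assume "A \<in> sets (distr M F (\<lambda>\<omega>. \<omega>))" "C \<in> sets (distr M B R)"
    then have A: "A \<in> sets F" and C: "C \<in> sets B" by auto
    have AM: "A \<subseteq> space M" using sets.sets_into_space[OF A] sp by simp
    have "R -` C \<inter> space M \<in> sets G" using measurable_sets[OF R C] sp by simp
    then have "prob (A \<inter> (R -` C \<inter> space M)) = prob A * prob (R -` C \<inter> space M)"
      using indep_setD[OF indep A] by simp
    moreover have "(\<lambda>\<omega>. (\<omega>, R \<omega>)) -` (A \<times> C) \<inter> space M = A \<inter> (R -` C \<inter> space M)"
      using AM by auto
    ultimately show "emeasure (distr M F (\<lambda>\<omega>. \<omega>)) A * emeasure (distr M B R) C
      = emeasure (distr M (F \<Otimes>\<^sub>M B) (\<lambda>\<omega>. (\<omega>, R \<omega>))) (A \<times> C)"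
      using A C AM idF RM RF
      by (simp add: emeasure_distr emeasure_eq_measure ennreal_mult[symmetric] Int_absorb2)
  qed (simp_all add: F.sigma_finite_measure_axioms R.sigma_finite_measure_axioms cong: sets_pair_measure_cong)
  have \<Phi>': "\<Phi> \<in> sets (distr M F (\<lambda>\<omega>. \<omega>) \<Otimes>\<^sub>M distr M B R)"
    using \<Phi> by (simp cong: sets_pair_measure_cong)
  have slice: "emeasure (distr M F (\<lambda>\<omega>. \<omega>)) ((\<lambda>\<omega>. (\<omega>, r)) -` \<Phi>) = emeasure M {\<omega>\<in>space M. (\<omega>, r) \<in> \<Phi>}" for r
  proof -
    have "(\<lambda>\<omega>. (\<omega>, r)) -` \<Phi> \<in> sets F" using \<Phi> by (rule sets_Pair2)
    then show ?thesis
      by (subst emeasure_distr[OF idF]) (auto intro!: arg_cong[where f="emeasure M"])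
  qed
  have "{\<omega>\<in>space M. (\<omega>, R \<omega>) \<in> \<Phi>} = (\<lambda>\<omega>. (\<omega>, R \<omega>)) -` \<Phi> \<inter> space M" by auto
  then have "emeasure M {\<omega>\<in>space M. (\<omega>, R \<omega>) \<in> \<Phi>} = emeasure (distr M (F \<Otimes>\<^sub>M B) (\<lambda>\<omega>. (\<omega>, R \<omega>))) \<Phi>"
    by (simp add: emeasure_distr[OF RF \<Phi>])
  also have "\<dots> = (\<integral>\<^sup>+r. emeasure (distr M F (\<lambda>\<omega>. \<omega>)) ((\<lambda>\<omega>. (\<omega>, r)) -` \<Phi>) \<partial>(distr M B R))"
    unfolding eq[symmetric] by (rule FR.emeasure_pair_measure_alt2[OF \<Phi>'])
  finally show "emeasure M {\<omega>\<in>space M. (\<omega>, R \<omega>) \<in> \<Phi>}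
    = (\<integral>\<^sup>+r. emeasure M {\<omega>\<in>space M. (\<omega>, r) \<in> \<Phi>} \<partial>(distr M B R))" by (simp only: slice)
  show "(\<lambda>r. emeasure M {\<omega>\<in>space M. (\<omega>, r) \<in> \<Phi>}) \<in> borel_measurable B"
    using FR.measurable_emeasure_Pair2[OF \<Phi>'] by (simp add: slice)
qed

text \<open>Tonelli's theorem on the region below the graph of r / n, cut off at \<open>t\<close>:
  exchanging the order of integration replaces the upper limit by the tail of the law.\<close>

lemma nn_integral_layer_cake:
  fixes n t :: real and w :: "real \<Rightarrow> ennreal"
  assumes "prob_space D" and D: "sets D = sets borel" and n: "0 < n"
    and w: "w \<in> borel_measurable borel"
  shows "(\<integral>\<^sup>+r. (\<integral>\<^sup>+v. w v * indicator {0..min t (r / n)} v \<partial>lborel) \<partial>D)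
    = (\<integral>\<^sup>+v. w v * emeasure D {n * v<..} * indicator {0..t} v \<partial>lborel)"
proof -
  interpret D: prob_space D by fact
  interpret pair_sigma_finite D lborel ..
  note [measurable_cong] = D and [measurable] = w
  have "(\<integral>\<^sup>+r. (\<integral>\<^sup>+v. w v * indicator {0..min t (r / n)} v \<partial>lborel) \<partial>D)
      = (\<integral>\<^sup>+r. (\<integral>\<^sup>+v. w v * indicator {0..t} v * indicator {n * v<..} r \<partial>lborel) \<partial>D)"
  proof (rule nn_integral_cong, rule nn_integral_cong_AE)
    fix r
    \<comment> \<open>The closed interval and the open tail disagree at most at
      \<open>v = r / n\<close>, a Lebesgue null set.\<close>
    show "AE v in lborel. w v * indicator {0..min t (r / n)} v = w v * indicator {0..t} v * indicator {n * v<..} r"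
    proof (rule AE_mp[OF AE_lborel_singleton[of "r / n"]], rule AE_I2, rule impI)
      fix v :: real assume "v \<noteq> r / n"
      then show "w v * indicator {0..min t (r / n)} v = w v * indicator {0..t} v * indicator {n * v<..} r"
        using n by (auto simp: indicator_def field_simps)
    qed
  qed
  also have "\<dots> = (\<integral>\<^sup>+v. (\<integral>\<^sup>+r. w v * indicator {0..t} v * indicator {n * v<..} r \<partial>D) \<partial>lborel)"
    by (rule Fubini'[symmetric]) (measurable, simp_all)
  also have "\<dots> = (\<integral>\<^sup>+v. w v * emeasure D {n * v<..} * indicator {0..t} v \<partial>lborel)"
    by (intro nn_integral_cong, subst nn_integral_cmult_indicator) (simp_all add: D mult_ac)
  finally show ?thesis .
qed

section \<open>Late jobs of a Poisson stream\<close>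

context poisson_counting
begin

text \<open>On \<open>i \<le> N t \<omega>\<close> a sublevel event is an event about two counts,
  hence lies in \<open>F\<close>. Elsewhere the jump time may be unspecified and is overwritten; any
  nonnegative constant would do there, since the later events only look at jobs that have
  arrived.\<close>

lemma measurable_truncated_jump_time:
  assumes sp: "space F = space M" and N: "\<And>s. 0 \<le> s \<Longrightarrow> N s \<in> measurable F (count_space UNIV)" and t: "0 \<le> t"
  shows "(\<lambda>\<omega>. if i \<le> N t \<omega> then jump_time N i \<omega> else t + 1) \<in> borel_measurable F"
proof (subst borel_measurable_iff_le, intro allI)
  fix a
  note [measurable] = N[OF t]
  show "{\<omega>\<in>space F. (if i \<le> N t \<omega> then jump_time N i \<omega> else t + 1) \<le> a} \<in> sets F"
  proof (cases "0 \<le> a")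
    case True
    note [measurable] = N[OF True]
    have "{\<omega>\<in>space F. (if i \<le> N t \<omega> then jump_time N i \<omega> else t + 1) \<le> a}
        = {\<omega>\<in>space F. (i \<le> N t \<omega> \<and> i \<le> N a \<omega>) \<or> (\<not> i \<le> N t \<omega> \<and> t + 1 \<le> a)}"
      using jump_time_le_iff[OF _ t _ True] by (intro Collect_cong) (auto simp: sp)
    also have "\<dots> \<in> sets F" by measurable
    finally show ?thesis .
  next
    case False
    have "\<not> (if i \<le> N t \<omega> then jump_time N i \<omega> else t + 1) \<le> a" for \<omega>
      using False t jump_time_nonneg[OF t, of i \<omega>] by auto
    then have "{\<omega>\<in>space F. (if i \<le> N t \<omega> then jump_time N i \<omega> else t + 1) \<le> a} = {}"
      by blast
    then show ?thesis by (metis sets.empty_sets)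
  qed
qed

text \<open>For a fixed service time, lateness becomes a condition on the count at a deterministic
  time. The minimum handles a service longer than \<open>t\<close>: then the time is 0, the count is
  0 and, as \<open>1 \<le> i\<close>, both sides hold.\<close>

lemma late_iff:
  assumes "\<omega> \<in> space M" "0 \<le> t" "0 < n" "0 \<le> r" "1 \<le> i" "i \<le> N t \<omega>"
  shows "t < r / n + jump_time N i \<omega> \<longleftrightarrow> N (t - min t (r / n)) \<omega> < i"
proof -
  have T0: "0 \<le> jump_time N i \<omega>" using assms by (intro jump_time_nonneg)
  have rn: "0 \<le> r / n" using assms by simp
  show ?thesis
  proof (cases "r / n \<le> t")
    case True
    then show ?thesis
      using jump_time_le_iff[OF assms(1,2,6), of "t - r / n"] by (auto simp: min_def)
  next
    case False
    then show ?thesis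
      using T0 assms by (simp add: min_def count_0)
  qed
qed

text \<open>The integrand carries a random index, so both its integral and its measurability are
  obtained by summing over the value of the count; each \<open>g m\<close> has to be measurable only
  after restriction to \<open>N t \<omega> = m\<close>.\<close>

lemma nn_integral_split_count:
  fixes g :: "nat \<Rightarrow> 'a \<Rightarrow> ennreal"
  assumes t: "0 \<le> t" and g: "\<And>m. (\<lambda>\<omega>. g m \<omega> * indicator {\<omega>\<in>space M. N t \<omega> = m} \<omega>) \<in> borel_measurable M"
  shows "(\<integral>\<^sup>+\<omega>. g (N t \<omega>) \<omega> \<partial>M) = (\<Sum>m. \<integral>\<^sup>+\<omega>. g m \<omega> * indicator {\<omega>\<in>space M. N t \<omega> = m} \<omega> \<partial>M)"
    and "(\<lambda>\<omega>. g (N t \<omega>) \<omega>) \<in> borel_measurable M"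
proof -
  have eq: "g (N t \<omega>) \<omega> = (\<Sum>m. g m \<omega> * indicator {\<omega>\<in>space M. N t \<omega> = m} \<omega>)" if "\<omega> \<in> space M" for \<omega>
    using that by (subst suminf_finite[of "{N t \<omega>}"]) (auto simp: indicator_def)
  show "(\<integral>\<^sup>+\<omega>. g (N t \<omega>) \<omega> \<partial>M) = (\<Sum>m. \<integral>\<^sup>+\<omega>. g m \<omega> * indicator {\<omega>\<in>space M. N t \<omega> = m} \<omega> \<partial>M)"
    using g by (simp add: nn_integral_suminf eq cong: nn_integral_cong)
  show "(\<lambda>\<omega>. g (N t \<omega>) \<omega>) \<in> borel_measurable M"
    using g by (subst measurable_cong[OF eq]) (auto intro: borel_measurable_suminf)
qed

end

text \<open>\<open>F\<close> and \<open>G\<close> stand for sub-sigma-algebras: \<open>F\<close> is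
  to carry the counts, \<open>G\<close> the service times attached to the jobs.\<close>

locale poisson_marked = poisson_counting M N \<mu> for M :: "'a measure" and N \<mu> +
  fixes F G :: "'a measure"
  assumes indep_FG: "indep_set (sets F) (sets G)"
    and space_F: "space F = space M" and space_G: "space G = space M"
    and count_F: "\<And>s. 0 \<le> s \<Longrightarrow> N s \<in> measurable F (count_space UNIV)"
begin

lemma measurable_F_M: "f \<in> measurable F B \<Longrightarrow> f \<in> measurable M B"
  using indep_setD_ev1[OF indep_FG] space_F by (auto simp: measurable_def)

lemma measurable_G_M: "f \<in> measurable G B \<Longrightarrow> f \<in> measurable M B"
  using indep_setD_ev2[OF indep_FG] space_G by (auto simp: measurable_def)

definition trunc_jump_time :: "real \<Rightarrow> nat \<Rightarrow> 'a \<Rightarrow> real" where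
  "trunc_jump_time t i \<omega> = (if i \<le> N t \<omega> then jump_time N i \<omega> else t + 1)"

lemma measurable_trunc_jump_time: "0 \<le> t \<Longrightarrow> trunc_jump_time t i \<in> borel_measurable F"
  unfolding trunc_jump_time_def by (rule measurable_truncated_jump_time[OF space_F count_F])

lemma late_eq:
  "i \<le> m \<Longrightarrow> N t \<omega> = m \<and> t < r + jump_time N i \<omega> \<longleftrightarrow> N t \<omega> = m \<and> t < r + trunc_jump_time t i \<omega>"
  by (auto simp: trunc_jump_time_def)

text \<open>After freezing the service time at \<open>r\<close>, \<open>emeasure_late_point\<close>
  applies with \<open>u = min t (r / n)\<close>. Averaging over \<open>r\<close> then merely inserts
  the tail into the integrand. The total count \<open>m\<close> stays fixed because the number of
  chain steps after job i depends on it.\<close>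

lemma emeasure_late:
  fixes R :: "'a \<Rightarrow> real"
  assumes R: "R \<in> borel_measurable G" and R0: "AE \<omega> in M. 0 \<le> R \<omega>"
    and im: "1 \<le> i" "i \<le> m" and t: "0 \<le> t" and n: "0 < n"
  shows "emeasure M {\<omega>\<in>space M. N t \<omega> = m \<and> t < R \<omega> / n + jump_time N i \<omega>}
    = (\<integral>\<^sup>+v. ennreal (\<mu> * poisson_weight (\<mu> * (t - v)) (i - 1) * poisson_weight (\<mu> * v) (m - i))
        * emeasure (distr M borel R) {n * v<..} * indicator {0..t} v \<partial>lborel)"
proof -
  let ?\<Phi> = "{p\<in>space (F \<Otimes>\<^sub>M borel). N t (fst p) = m \<and> t < snd p / n + trunc_jump_time t i (fst p)}"
  let ?w = "\<lambda>v. ennreal (\<mu> * poisson_weight (\<mu> * (t - v)) (i - 1) * poisson_weight (\<mu> * v) (m - i))"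
  note [measurable] = count_F[OF t] measurable_trunc_jump_time[OF t]
  have RM: "R \<in> borel_measurable M" using R by (rule measurable_G_M)
  have \<Phi>: "?\<Phi> \<in> sets (F \<Otimes>\<^sub>M borel)" by measurable
  have "{\<omega>\<in>space M. N t \<omega> = m \<and> t < R \<omega> / n + jump_time N i \<omega>} = {\<omega>\<in>space M. (\<omega>, R \<omega>) \<in> ?\<Phi>}"
    by (auto simp: late_eq[OF im(2)] space_F space_pair_measure)
  also have "emeasure M \<dots> = (\<integral>\<^sup>+r. emeasure M {\<omega>\<in>space M. (\<omega>, r) \<in> ?\<Phi>} \<partial>(distr M borel R))"
    by (rule emeasure_indep_fubini[OF indep_FG space_F space_G R \<Phi>])
  also have "\<dots> = (\<integral>\<^sup>+r. (\<integral>\<^sup>+v. ?w v * indicator {0..min t (r / n)} v \<partial>lborel) \<partial>(distr M borel R))"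
  proof (rule nn_integral_cong_AE)
    have "AE r in distr M borel R. 0 \<le> r"
      using R0 by (subst AE_distr_iff[OF RM]) auto
    then show "AE r in distr M borel R. emeasure M {\<omega>\<in>space M. (\<omega>, r) \<in> ?\<Phi>}
        = (\<integral>\<^sup>+v. ?w v * indicator {0..min t (r / n)} v \<partial>lborel)"
    proof (rule AE_mp, intro AE_I2 impI)
      fix r :: real assume r: "0 \<le> r"
      have "{\<omega>\<in>space M. (\<omega>, r) \<in> ?\<Phi>} = {\<omega>\<in>space M. N t \<omega> = m \<and> N (t - min t (r / n)) \<omega> < i}"
      proof (rule Collect_cong, rule conj_cong[OF refl])
        fix \<omega> assume \<omega>: "\<omega> \<in> space M"
        have "(\<omega>, r) \<in> ?\<Phi> \<longleftrightarrow> N t \<omega> = m \<and> t < r / n + jump_time N i \<omega>"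
          using \<omega> by (simp add: late_eq[OF im(2)] space_F space_pair_measure)
        also have "\<dots> \<longleftrightarrow> N t \<omega> = m \<and> N (t - min t (r / n)) \<omega> < i"
          using late_iff[OF \<omega> t n r im(1)] im(2) by (intro conj_cong refl) simp
        finally show "(\<omega>, r) \<in> ?\<Phi> \<longleftrightarrow> N t \<omega> = m \<and> N (t - min t (r / n)) \<omega> < i" .
      qed
      then show "emeasure M {\<omega>\<in>space M. (\<omega>, r) \<in> ?\<Phi>}
          = (\<integral>\<^sup>+v. ?w v * indicator {0..min t (r / n)} v \<partial>lborel)"
        using emeasure_late_point[of "min t (r / n)" t i m] r n t im by simp
    qed
  qed
  also have "\<dots> = (\<integral>\<^sup>+v. ?w v * emeasure (distr M borel R) {n * v<..} * indicator {0..t} v \<partial>lborel)"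
    using n by (intro nn_integral_layer_cake prob_space_distr RM) auto
  finally show ?thesis .
qed

text \<open>With both service times frozen, the late pairs are the pairs of distinct indices in two
  tails of the count. Their mean is a function of one service time multiplied by a function of the
  other, so integration against the product law factorizes. Equal indices are left out, so
  independence is asked only across different jobs and \<open>R\<close> and \<open>R'\<close> may be
  the same family.\<close>

lemma nn_integral_late_pairs:
  fixes R R' :: "nat \<Rightarrow> 'a \<Rightarrow> real"
  assumes R: "\<And>i. R i \<in> borel_measurable G" "\<And>i. R' i \<in> borel_measurable G"
    and R0: "\<And>i. AE \<omega> in M. 0 \<le> R i \<omega>" "\<And>i. AE \<omega> in M. 0 \<le> R' i \<omega>"
    and D: "\<And>i. distr M borel (R i) = D" "\<And>i. distr M borel (R' i) = D'"
    and indep: "\<And>i i'. i \<noteq> i' \<Longrightarrow> indep_var borel (R i) borel (R' i')"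
    and t: "0 \<le> t" and n: "0 < n"
  shows "(\<integral>\<^sup>+\<omega>. (\<Sum>(i, i')\<in>{(i, i'). i \<in> {1..N t \<omega>} \<and> i' \<in> {1..N t \<omega>} \<and> i \<noteq> i'}.
      ennreal (of_bool (t < R i \<omega> / n + jump_time N i \<omega> \<and> t < R' i' \<omega> / n + jump_time N i' \<omega>))) \<partial>M)
    = ennreal (\<mu>\<^sup>2) * (\<integral>\<^sup>+v. emeasure D {n * v<..} * indicator {0..t} v \<partial>lborel)
        * (\<integral>\<^sup>+v. emeasure D' {n * v<..} * indicator {0..t} v \<partial>lborel)"
    and "(\<lambda>\<omega>. \<Sum>(i, i')\<in>{(i, i'). i \<in> {1..N t \<omega>} \<and> i' \<in> {1..N t \<omega>} \<and> i \<noteq> i'}.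
      ennreal (of_bool (t < R i \<omega> / n + jump_time N i \<omega> \<and> t < R' i' \<omega> / n + jump_time N i' \<omega>)))
    \<in> borel_measurable M"
proof -
  have lborel_Icc: "emeasure lborel {0..u} = ennreal u" for u :: real
    by (cases "0 \<le> u") (auto simp: ennreal_neg)
  define I where "I = (\<lambda>m::nat. {(i, i'). i \<in> {1..m} \<and> i' \<in> {1..m} \<and> i \<noteq> i'})"
  have inter: "{\<omega>\<in>space M. N t \<omega> = m \<and> A \<omega>} \<inter> {\<omega>\<in>space M. N t \<omega> = m}
      = {\<omega>\<in>space M. N t \<omega> = m \<and> A \<omega>}" for m A by auto
  have finI: "finite (I m)" for m
    by (rule finite_subset[of _ "{1..m} \<times> {1..m}"]) (auto simp: I_def)
  have RM: "R i \<in> borel_measurable M" "R' i \<in> borel_measurable M" for i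
    using R by (auto intro: measurable_G_M)
  note [measurable] = count_F[OF t] measurable_trunc_jump_time[OF t] measurable_count[OF t] RM
    measurable_F_M[OF measurable_trunc_jump_time[OF t]]
  have D_prob: "prob_space D" "prob_space D'"
    using prob_space_distr[OF RM(1)[of 0]] prob_space_distr[OF RM(2)[of 0]] by (auto simp: D)
  interpret D: prob_space D by fact
  interpret D': prob_space D' by fact
  interpret DD: pair_prob_space D D' ..
  have sets_D: "sets D = sets borel" "sets D' = sets borel"
    unfolding D(1)[of 0, symmetric] D(2)[of 0, symmetric] by simp_all
  note [measurable_cong] = sets_D
  let ?E = "\<lambda>m i i'. {\<omega>\<in>space M. N t \<omega> = m \<and> t < R i \<omega> / n + trunc_jump_time t i \<omega>
      \<and> t < R' i' \<omega> / n + trunc_jump_time t i' \<omega>}"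
  let ?\<Phi> = "\<lambda>m i i'. {p\<in>space (F \<Otimes>\<^sub>M (borel \<Otimes>\<^sub>M borel)). N t (fst p) = m
      \<and> t < fst (snd p) / n + trunc_jump_time t i (fst p) \<and> t < snd (snd p) / n + trunc_jump_time t i' (fst p)}"
  have \<Phi>: "?\<Phi> m i i' \<in> sets (F \<Otimes>\<^sub>M (borel \<Otimes>\<^sub>M borel))" for m i i'
    by measurable
  let ?A = "\<lambda>m i i' r. {\<omega>\<in>space M. (\<omega>, r) \<in> ?\<Phi> m i i'}"
  have RR: "(\<lambda>\<omega>. (R i \<omega>, R' i' \<omega>)) \<in> measurable G (borel \<Otimes>\<^sub>M borel)" for i i'
    using R by measurable
  note fubini = emeasure_indep_fubini[OF indep_FG space_F space_G RR \<Phi>]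
  have E: "emeasure M (?E m i i') = (\<integral>\<^sup>+r. emeasure M (?A m i i' r) \<partial>(D \<Otimes>\<^sub>M D'))" if "(i, i') \<in> I m" for m i i'
  proof -
    have eq: "?E m i i' = {\<omega>\<in>space M. (\<omega>, (R i \<omega>, R' i' \<omega>)) \<in> ?\<Phi> m i i'}"
      by (auto simp: space_F space_pair_measure)
    have "i \<noteq> i'" using that by (simp add: I_def)
    from indep[OF this, unfolded indep_var_distribution_eq, THEN conjunct2, THEN conjunct2]
    have distr: "distr M (borel \<Otimes>\<^sub>M borel) (\<lambda>\<omega>. (R i \<omega>, R' i' \<omega>)) = D \<Otimes>\<^sub>M D'"
      by (simp only: D)
    show ?thesis
      using fubini(1)[of i i' m i i'] by (simp only: eq distr)
  qed
  have meas_A: "(\<lambda>r. emeasure M (?A m i i' r)) \<in> borel_measurable (D \<Otimes>\<^sub>M D')" for m i i'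
    unfolding measurable_cong_sets[OF sets_pair_measure_cong[OF sets_D] refl] by (rule fubini(2))
  have late_E: "(\<Sum>(i, i')\<in>I (N t \<omega>).
      ennreal (of_bool (t < R i \<omega> / n + jump_time N i \<omega> \<and> t < R' i' \<omega> / n + jump_time N i' \<omega>)))
    = (\<Sum>(i, i')\<in>I (N t \<omega>). indicator (?E (N t \<omega>) i i') \<omega>)" if "\<omega> \<in> space M" for \<omega>
  proof (rule sum.cong[OF refl], simp only: split_paired_all prod.case)
    fix i i' assume "(i, i') \<in> I (N t \<omega>)"
    then show "ennreal (of_bool (t < R i \<omega> / n + jump_time N i \<omega> \<and> t < R' i' \<omega> / n + jump_time N i' \<omega>))
      = indicator (?E (N t \<omega>) i i') \<omega>"
      using that by (simp add: I_def indicator_def trunc_jump_time_def)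
  qed
  have split_meas: "(\<lambda>\<omega>. (\<Sum>(i, i')\<in>I m. indicator (?E m i i') \<omega>)
      * indicator {\<omega>\<in>space M. N t \<omega> = m} \<omega> :: ennreal) \<in> borel_measurable M" for m
    by (simp add: split_beta')
  show "(\<lambda>\<omega>. \<Sum>(i, i')\<in>{(i, i'). i \<in> {1..N t \<omega>} \<and> i' \<in> {1..N t \<omega>} \<and> i \<noteq> i'}.
      ennreal (of_bool (t < R i \<omega> / n + jump_time N i \<omega> \<and> t < R' i' \<omega> / n + jump_time N i' \<omega>)))
    \<in> borel_measurable M"
    using iffD2[OF measurable_cong[OF late_E] nn_integral_split_count(2)[OF t split_meas]]
    unfolding I_def .
  have "(\<integral>\<^sup>+\<omega>. (\<Sum>(i, i')\<in>I (N t \<omega>).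
      ennreal (of_bool (t < R i \<omega> / n + jump_time N i \<omega> \<and> t < R' i' \<omega> / n + jump_time N i' \<omega>))) \<partial>M)
    = (\<integral>\<^sup>+\<omega>. (\<Sum>(i, i')\<in>I (N t \<omega>). indicator (?E (N t \<omega>) i i') \<omega>) \<partial>M)"
    by (rule nn_integral_cong) (rule late_E)
  also have "\<dots> = (\<Sum>m. \<integral>\<^sup>+\<omega>. (\<Sum>(i, i')\<in>I m. indicator (?E m i i') \<omega>)
      * indicator {\<omega>\<in>space M. N t \<omega> = m} \<omega> \<partial>M)"
    by (rule nn_integral_split_count(1)[OF t split_meas])
  also have "\<dots> = (\<Sum>m. \<integral>\<^sup>+\<omega>. (\<Sum>(i, i')\<in>I m. indicator (?E m i i') \<omega>) \<partial>M)"
    by (rule suminf_cong, rule nn_integral_cong)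
       (simp add: sum_distrib_right split_beta' indicator_inter_arith[symmetric] inter)
  also have "\<dots> = (\<Sum>m. \<Sum>(i, i')\<in>I m. emeasure M (?E m i i'))"
    by (simp add: split_beta' nn_integral_sum)
  also have "\<dots> = (\<Sum>m. \<Sum>(i, i')\<in>I m. \<integral>\<^sup>+r. emeasure M (?A m i i' r) \<partial>(D \<Otimes>\<^sub>M D'))"
    by (intro suminf_cong sum.cong) (auto simp: E)
  also have "\<dots> = (\<integral>\<^sup>+r. (\<Sum>m. \<Sum>(i, i')\<in>I m. emeasure M (?A m i i' r)) \<partial>(D \<Otimes>\<^sub>M D'))"
    using meas_A by (simp add: split_beta' nn_integral_sum nn_integral_suminf)
  also have "\<dots> = (\<integral>\<^sup>+r. ennreal (\<mu>\<^sup>2) * ennreal (min t (fst r / n)) * ennreal (min t (snd r / n)) \<partial>(D \<Otimes>\<^sub>M D'))"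
  proof (rule nn_integral_cong_AE)
    have "AE r in D. 0 \<le> r" "AE r in D'. 0 \<le> r"
      using R0 unfolding D(1)[of 0, symmetric] D(2)[of 0, symmetric]
      by (simp_all add: AE_distr_iff RM)
    then have "AE r in D \<Otimes>\<^sub>M D'. 0 \<le> fst r \<and> 0 \<le> snd r"
      by (intro DD.AE_pair_measure) auto
    then show "AE r in D \<Otimes>\<^sub>M D'. (\<Sum>m. \<Sum>(i, i')\<in>I m. emeasure M (?A m i i' r))
      = ennreal (\<mu>\<^sup>2) * ennreal (min t (fst r / n)) * ennreal (min t (snd r / n))"
    proof (rule AE_mp, intro AE_I2 impI)
      fix r :: "real \<times> real" assume r: "0 \<le> fst r \<and> 0 \<le> snd r"
      let ?s = "t - min t (fst r / n)" and ?s' = "t - min t (snd r / n)"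
      have s: "0 \<le> ?s" "0 \<le> ?s'" "?s \<le> t" "?s' \<le> t" using r n t by auto
      note [measurable] = measurable_count[OF s(1)] measurable_count[OF s(2)]
      let ?B = "\<lambda>m i i'. {\<omega>\<in>space M. N t \<omega> = m \<and> N ?s \<omega> < i \<and> N ?s' \<omega> < i'}"
      have A: "?A m i i' r = ?B m i i'" if "(i, i') \<in> I m" for m i i'
      proof (rule Collect_cong, rule conj_cong[OF refl])
        fix \<omega> assume \<omega>: "\<omega> \<in> space M"
        have im: "1 \<le> i" "i \<le> m" "1 \<le> i'" "i' \<le> m" using that by (auto simp: I_def)
        have "(\<omega>, r) \<in> ?\<Phi> m i i' \<longleftrightarrow> N t \<omega> = m \<and> t < fst r / n + jump_time N i \<omega> \<and> t < snd r / n + jump_time N i' \<omega>"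
          using \<omega> im by (auto simp: trunc_jump_time_def space_F space_pair_measure)
        also have "\<dots> \<longleftrightarrow> N t \<omega> = m \<and> N ?s \<omega> < i \<and> N ?s' \<omega> < i'"
          using late_iff[OF \<omega> t n _ im(1)] late_iff[OF \<omega> t n _ im(3)] im r
          by (intro conj_cong refl) simp_all
        finally show "(\<omega>, r) \<in> ?\<Phi> m i i' \<longleftrightarrow> N t \<omega> = m \<and> N ?s \<omega> < i \<and> N ?s' \<omega> < i'" .
      qed
      have "(\<Sum>m. \<Sum>(i, i')\<in>I m. emeasure M (?A m i i' r)) = (\<Sum>m. \<Sum>(i, i')\<in>I m. emeasure M (?B m i i'))"
        by (rule suminf_cong, rule sum.cong[OF refl]) (simp only: split_paired_all prod.case A)
      also have "\<dots> = (\<Sum>m. \<integral>\<^sup>+\<omega>. (\<Sum>(i, i')\<in>I m. indicator (?B m i i') \<omega>) \<partial>M)"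
        by (simp add: split_beta' nn_integral_sum)
      also have "\<dots> = (\<Sum>m. \<integral>\<^sup>+\<omega>. (\<Sum>(i, i')\<in>I m. indicator (?B m i i') \<omega>)
          * indicator {\<omega>\<in>space M. N t \<omega> = m} \<omega> \<partial>M)"
        by (rule suminf_cong, rule nn_integral_cong)
           (simp add: sum_distrib_right split_beta' indicator_inter_arith[symmetric] inter)
      also have "\<dots> = (\<integral>\<^sup>+\<omega>. (\<Sum>(i, i')\<in>I (N t \<omega>). indicator (?B (N t \<omega>) i i') \<omega>) \<partial>M)"
        by (rule nn_integral_split_count(1)[OF t, symmetric]) (simp add: split_beta')
      \<comment> \<open>Point i is late exactly if it lies beyond the count at the corresponding
        earlier time, so the indicators add up to the number of distinct pairs in the two
        tails.\<close>
      also have "\<dots> = (\<integral>\<^sup>+\<omega>. ennreal (real (card {(i, i'). i \<in> {N ?s \<omega><..N t \<omega>} \<and> i' \<in> {N ?s' \<omega><..N t \<omega>} \<and> i \<noteq> i'})) \<partial>M)"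
      proof (rule nn_integral_cong)
        fix \<omega> assume \<omega>: "\<omega> \<in> space M"
        let ?J = "{(i, i'). i \<in> {N ?s \<omega><..N t \<omega>} \<and> i' \<in> {N ?s' \<omega><..N t \<omega>} \<and> i \<noteq> i'}"
        have J: "?J \<subseteq> I (N t \<omega>)" by (auto simp: I_def)
        have "(\<Sum>(i, i')\<in>I (N t \<omega>). indicator (?B (N t \<omega>) i i') \<omega>)
          = (\<Sum>p\<in>I (N t \<omega>). if p \<in> ?J then 1 else 0 :: ennreal)"
          using \<omega> by (intro sum.cong) (auto simp: indicator_def I_def)
        also have "\<dots> = (\<Sum>p\<in>?J. 1)"
          by (simp only: sum.inter_restrict[OF finI, symmetric] Int_absorb1[OF J])
        finally show "(\<Sum>(i, i')\<in>I (N t \<omega>). indicator (?B (N t \<omega>) i i') \<omega>) = ennreal (real (card ?J))"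
          by (simp add: ennreal_of_nat_eq_real_of_nat)
      qed
      also have "\<dots> = ennreal (\<mu>\<^sup>2 * (t - ?s) * (t - ?s'))"
        by (rule nn_integral_distinct_pairs_tails[OF s])
      also have "\<dots> = ennreal (\<mu>\<^sup>2) * ennreal (min t (fst r / n)) * ennreal (min t (snd r / n))"
        using r n t by (simp add: ennreal_mult)
      finally show "(\<Sum>m. \<Sum>(i, i')\<in>I m. emeasure M (?A m i i' r))
        = ennreal (\<mu>\<^sup>2) * ennreal (min t (fst r / n)) * ennreal (min t (snd r / n))" .
    qed
  qed
  also have "\<dots> = (\<integral>\<^sup>+r. \<integral>\<^sup>+r'. ennreal (\<mu>\<^sup>2) * ennreal (min t (r / n)) * ennreal (min t (r' / n)) \<partial>D' \<partial>D)"
    by (subst D'.nn_integral_fst[symmetric]) auto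
  also have "\<dots> = ennreal (\<mu>\<^sup>2) * (\<integral>\<^sup>+r. ennreal (min t (r / n)) \<partial>D) * (\<integral>\<^sup>+r'. ennreal (min t (r' / n)) \<partial>D')"
    by (simp add: nn_integral_cmult nn_integral_multc)
  \<comment> \<open>The layer-cake formula with constant weight 1: the inner integral is the length
    of the interval, and \<open>ennreal\<close> sends a negative length to 0.\<close>
  also have "(\<integral>\<^sup>+r. ennreal (min t (r / n)) \<partial>D) = (\<integral>\<^sup>+v. emeasure D {n * v<..} * indicator {0..t} v \<partial>lborel)"
    using nn_integral_layer_cake[OF D_prob(1) sets_D(1) n, of "\<lambda>_. 1" t] by (simp add: lborel_Icc)
  also have "(\<integral>\<^sup>+r. ennreal (min t (r / n)) \<partial>D') = (\<integral>\<^sup>+v. emeasure D' {n * v<..} * indicator {0..t} v \<partial>lborel)"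
    using nn_integral_layer_cake[OF D_prob(2) sets_D(2) n, of "\<lambda>_. 1" t] by (simp add: lborel_Icc)
  finally show "(\<integral>\<^sup>+\<omega>. (\<Sum>(i, i')\<in>{(i, i'). i \<in> {1..N t \<omega>} \<and> i' \<in> {1..N t \<omega>} \<and> i \<noteq> i'}.
      ennreal (of_bool (t < R i \<omega> / n + jump_time N i \<omega> \<and> t < R' i' \<omega> / n + jump_time N i' \<omega>))) \<partial>M)
    = ennreal (\<mu>\<^sup>2) * (\<integral>\<^sup>+v. emeasure D {n * v<..} * indicator {0..t} v \<partial>lborel)
        * (\<integral>\<^sup>+v. emeasure D' {n * v<..} * indicator {0..t} v \<partial>lborel)"
    unfolding I_def .
qed

end

section \<open>The moments of the queue\<close>

lemma
  shows space_sigma_process: "space (sigma (space M) (process_sigma M R Y I)) = space M"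
    and sets_sigma_process: "sets (sigma (space M) (process_sigma M R Y I)) = process_sigma M R Y I"
    and sigma_sets_process: "sigma_sets (space M) (process_sigma M R Y I) = process_sigma M R Y I"
    and Int_stable_process: "Int_stable (process_sigma M R Y I)"
proof -
  have gen: "{Y i -` A \<inter> space M | i A. i \<in> I \<and> A \<in> sets R} \<subseteq> Pow (space M)" by auto
  interpret sigma_algebra "space M" "process_sigma M R Y I"
    unfolding process_sigma_def by (rule sigma_algebra_sigma_sets[OF gen])
  show "space (sigma (space M) (process_sigma M R Y I)) = space M"
    using space_closed by (rule space_measure_of)
  show "sets (sigma (space M) (process_sigma M R Y I)) = process_sigma M R Y I"
    by (rule sets_measure_of_eq)
  show "sigma_sets (space M) (process_sigma M R Y I) = process_sigma M R Y I"
    by (rule sigma_sets_eq)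
  show "Int_stable (process_sigma M R Y I)"
    by (auto simp: Int_stable_def)
qed

lemma measurable_process:
  assumes "i \<in> I" "Y i \<in> measurable M R"
  shows "Y i \<in> measurable (sigma (space M) (process_sigma M R Y I)) R"
proof (rule measurableI)
  fix A assume "A \<in> sets R"
  then have "Y i -` A \<inter> space M \<in> process_sigma M R Y I"
    unfolding process_sigma_def using assms(1) by (intro sigma_sets.Basic) auto
  then show "Y i -` A \<inter> space (sigma (space M) (process_sigma M R Y I))
      \<in> sets (sigma (space M) (process_sigma M R Y I))"
    by (simp only: space_sigma_process sets_sigma_process)
qed (use measurable_space[OF assms(2)] in \<open>simp add: space_sigma_process\<close>)

lemma borel_measurable_tail:
  fixes a :: real
  assumes "prob_space D" "sets D = sets borel" "0 < a"
  shows "(\<lambda>v. emeasure D {a * v<..}) \<in> borel_measurable borel"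
    and "(\<lambda>v. measure D {a * v<..}) \<in> borel_measurable borel"
proof -
  interpret D: prob_space D by fact
  have "mono (\<lambda>v. - measure D {a * v<..})"
    using assms by (intro monoI le_imp_neg_le D.finite_measure_mono) (auto intro: order_le_less_trans mult_left_mono)
  then have "(\<lambda>v. - (- measure D {a * v<..})) \<in> borel_measurable borel"
    by (intro borel_measurable_uminus borel_measurable_mono)
  then show "(\<lambda>v. measure D {a * v<..}) \<in> borel_measurable borel" by simp
  then show "(\<lambda>v. emeasure D {a * v<..}) \<in> borel_measurable borel"
    by (simp add: D.emeasure_eq_measure)
qed

lemma measurable_larger_source:
  "f \<in> measurable A B \<Longrightarrow> sets A \<subseteq> sets C \<Longrightarrow> space A = space C \<Longrightarrow> f \<in> measurable C B"
  by (auto simp: measurable_def)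

text \<open>Lateness involves only counts and a service time; this places it in the joint
  sigma-algebra from which the chain is independent.\<close>

lemma (in poisson_marked) late_event_in_sigma_sets:
  fixes R :: "'a \<Rightarrow> real"
  assumes R: "R \<in> borel_measurable G" and t: "0 \<le> t"
  shows "{\<omega>\<in>space M. N t \<omega> = m \<and> t < R \<omega> / n + trunc_jump_time t i \<omega>}
    \<in> sigma_sets (space M) (sets F \<union> sets G)"
proof -
  let ?FG = "sigma (space M) (sets F \<union> sets G)"
  have "sets F \<union> sets G \<subseteq> Pow (space M)"
    using sets.space_closed[of F] sets.space_closed[of G] by (simp only: space_F space_G Un_least)
  then have FG: "space ?FG = space M" "sets ?FG = sigma_sets (space M) (sets F \<union> sets G)"
    by (simp_all add: space_measure_of sets_measure_of)
  have sub: "sets F \<subseteq> sets ?FG" "sets G \<subseteq> sets ?FG" "space F = space ?FG" "space G = space ?FG"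
    unfolding FG space_F space_G by auto
  note [measurable] = measurable_larger_source[OF count_F[OF t] sub(1,3)]
    measurable_larger_source[OF measurable_trunc_jump_time[OF t] sub(1,3)]
    measurable_larger_source[OF R sub(2,4)]
  have "{\<omega>\<in>space ?FG. N t \<omega> = m \<and> t < R \<omega> / n + trunc_jump_time t i \<omega>} \<in> sets ?FG"
    by measurable
  then show ?thesis by (simp only: FG)
qed

lemma finite_states: "finite (states k K)"
  unfolding states_def by (intro finite_PiE) auto

section \<open>The model with its chain started at a fixed state\<close>

locale started_queue =
  fixes k K n :: nat and lam \<gamma> :: real and P D x M N X L
  assumes model: "rescaled_model k K lam \<gamma> P D n (\<lambda>z. of_bool (z = x)) M N X L"
    and lam: "0 < lam" and \<gamma>: "0 < \<gamma>" and n: "1 \<le> n"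
    and stochastic: "stochastic_matrix (states k K) P" and x: "x \<in> states k K"
begin

abbreviation "S \<equiv> states k K"
abbreviation "rate \<equiv> lam * real n powr \<gamma>"
abbreviation "Q \<equiv> scaled_transition \<gamma> P n"
abbreviation "flow s \<equiv> mat_exp S (mat_scale (lam * s) (generator P))"
abbreviation "F \<equiv> sigma (space M) (process_sigma M (count_space UNIV) N {0..})"
abbreviation "G \<equiv> sigma (space M) (process_sigma M borel (\<lambda>(i, j). L i j) (UNIV \<times> {1..k}))"
abbreviation "\<X> \<equiv> process_sigma M (count_space S) X UNIV"

lemma rate: "0 < rate"
  using lam n by simp

sublocale prob_space M
  using model by (simp add: rescaled_model_def)

lemma chain: "markov_chain M S (\<lambda>z. of_bool (z = x)) Q X"
  using model by (simp add: rescaled_model_def)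

lemma poisson_N: "poisson_process M rate N"
  using model by (simp add: rescaled_model_def)

lemma services: "service_times k D M L"
  using model by (simp add: rescaled_model_def)

lemma indep_all: "indep_sets (\<lambda>c. [sets F, \<X>, sets G] ! c) {..<3}"
  using model by (simp only: rescaled_model_def sets_sigma_process)

sublocale poisson_counting M N rate
  by unfold_locales (fact poisson_N, fact rate)

lemma measurable_X [measurable]: "X i \<in> measurable M (count_space S)"
  using chain by (simp add: markov_chain_def)

lemma X_in: "\<omega> \<in> space M \<Longrightarrow> X i \<omega> \<in> S"
  using measurable_space[OF measurable_X] by simp

sublocale poisson_marked M N rate F G
proof
  have "prob (a \<inter> b) = prob a * prob b" if "a \<in> sets F" "b \<in> sets G" for a b
    using indep_setsD[OF indep_all, of "{0, 2}" "\<lambda>c. if c = 0 then a else b"] that by (simp add: Int_commute mult.commute)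
  moreover have "sets F \<subseteq> events" "sets G \<subseteq> events"
    using bspec[OF conjunct1[OF indep_all[unfolded indep_sets_def]], of 0]
      bspec[OF conjunct1[OF indep_all[unfolded indep_sets_def]], of 2] by simp_all
  ultimately show "indep_set (sets F) (sets G)"
    by (intro indep_setI)
  show "space F = space M" "space G = space M" by (simp_all only: space_sigma_process)
  show "N s \<in> measurable F (count_space UNIV)" if "0 \<le> s" for s
    using that by (intro measurable_process) auto
qed

lemma measurable_L: "j \<in> {1..k} \<Longrightarrow> L i j \<in> borel_measurable G"
proof -
  assume j: "j \<in> {1..k}"
  have "(\<lambda>(i, j). L i j) (i, j) \<in> borel_measurable M"
    using services j unfolding service_times_def indep_vars_def by blast
  from measurable_process[of "(i, j)" "UNIV \<times> {1..k}" "\<lambda>(i, j). L i j", OF _ this] j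
  show ?thesis by simp
qed

lemma measurable_L_M: "j \<in> {1..k} \<Longrightarrow> L i j \<in> borel_measurable M"
  by (intro measurable_G_M measurable_L)

lemma L_nonneg: "j \<in> {1..k} \<Longrightarrow> AE \<omega> in M. 0 \<le> L i j \<omega>"
  using services by (simp add: service_times_def)

lemma distr_L: "j \<in> {1..k} \<Longrightarrow> distr M borel (L i j) = D j"
  using services by (simp add: service_times_def)

lemma indep_L:
  assumes "j \<in> {1..k}" "j' \<in> {1..k}" "(i, j) \<noteq> (i', j')"
  shows "indep_var borel (L i j) borel (L i' j')"
proof -
  have "indep_vars (\<lambda>_. borel) (\<lambda>(i, j). L i j) (UNIV \<times> {1..k})"
    using services by (simp add: service_times_def)
  from indep_var_restrict[OF this, of "{(i, j)}" "{(i', j')}"]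
  have "indep_var (PiM {(i, j)} (\<lambda>_. borel)) (\<lambda>\<omega>. restrict (\<lambda>p. (case p of (i, j) \<Rightarrow> L i j) \<omega>) {(i, j)})
      (PiM {(i', j')} (\<lambda>_. borel)) (\<lambda>\<omega>. restrict (\<lambda>p. (case p of (i, j) \<Rightarrow> L i j) \<omega>) {(i', j')})"
    using assms by fast
  from indep_var_compose[OF this, of "\<lambda>f. f (i, j)" borel "\<lambda>f. f (i', j')" borel]
  show ?thesis by (simp add: comp_def)
qed

text \<open>Mutual independence of three sigma-algebras is regrouped into two blocks, counts with
  service times against the chain; the boolean index names the block.\<close>

lemma prob_indep_chain:
  assumes B: "B \<in> \<X>" and A: "A \<in> sigma_sets (space M) (sets F \<union> sets G)"
  shows "prob (B \<inter> A) = prob B * prob A"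
proof -
  let ?I = "\<lambda>b. if b then {0, 2} else {1::nat}" and ?\<F> = "\<lambda>c. [sets F, \<X>, sets G] ! c"
  have "indep_sets (\<lambda>b. sigma_sets (space M) (\<Union>c\<in>?I b. ?\<F> c)) (UNIV :: bool set)"
  proof (rule indep_sets_collect_sigma)
    have "(\<Union>b\<in>UNIV. ?I b) = {..<3}" by (auto simp: UNIV_bool)
    then show "indep_sets ?\<F> (\<Union>b\<in>UNIV. ?I b)" using indep_all by (simp only:)
    show "Int_stable (?\<F> c)" if "b \<in> UNIV" "c \<in> ?I b" for b c
    proof -
      have "c = 0 \<or> c = 1 \<or> c = 2" using that by (auto split: if_splits)
      then show ?thesis
        by (elim disjE) (simp_all add: Int_stable_process sets_sigma_process numeral_2_eq_2 del: sets_measure_of_conv)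
    qed
    show "disjoint_family_on ?I UNIV" by (auto simp: disjoint_family_on_def)
  qed
  from indep_setsD[OF this, of UNIV "\<lambda>b. if b then A else B"] A B
  show ?thesis by (simp add: UNIV_bool sigma_sets_process Int_commute mult.commute)
qed

lemma Q_eq: "Q = (\<lambda>x y. mat_id x y + (1 / real n powr \<gamma>) * generator P x y)"
  by (intro ext) (simp add: scaled_transition_def generator_def algebra_simps diff_divide_distrib)

lemma Q_nonneg: "z \<in> S \<Longrightarrow> y \<in> S \<Longrightarrow> 0 \<le> Q z y"
proof -
  assume "z \<in> S" "y \<in> S"
  moreover have "1 \<le> real n powr \<gamma>" using n \<gamma> by (simp add: ge_one_powr_ge_zero)
  ultimately show ?thesis
    using stochastic unfolding scaled_transition_def mat_id_def stochastic_matrix_def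
    by (intro add_nonneg_nonneg mult_nonneg_nonneg divide_nonneg_nonneg) (auto simp: divide_le_eq_1)
qed

lemma Q_pow_nonneg: "z \<in> S \<Longrightarrow> y \<in> S \<Longrightarrow> 0 \<le> mat_pow S Q m z y"
  by (induction m arbitrary: z) (auto simp: mat_id_def mat_mult_def intro!: sum_nonneg mult_nonneg_nonneg Q_nonneg)

text \<open>The chain makes a Poisson number of steps of mean \<open>rate * s\<close>, each a
  perturbation of the identity of size n^(-\<gamma>). The powers of n cancel in the exponent, so the
  resulting flow is the same for every n.\<close>

lemma flow_sums:
  assumes "z \<in> S" "y \<in> S"
  shows "(\<lambda>a. poisson_weight (rate * s) a * mat_pow S Q a z y) sums flow s z y"
proof -
  have "rate * s * (1 / real n powr \<gamma>) = lam * s" using n by simp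
  then show ?thesis
    using poisson_weight_mat_pow_sums[OF finite_states assms, of "rate * s" "1 / real n powr \<gamma>" "generator P"]
    by (simp only: Q_eq)
qed

text \<open>The exponential series does not show this, as the generator can have negative diagonal
  entries; the Poisson mixture of nonnegative powers does.\<close>

lemma flow_nonneg: "0 \<le> s \<Longrightarrow> z \<in> S \<Longrightarrow> y \<in> S \<Longrightarrow> 0 \<le> flow s z y"
  using lam by (intro sums_le[OF _ sums_zero flow_sums])
    (auto intro!: mult_nonneg_nonneg poisson_weight_nonneg Q_pow_nonneg)

lemma prob_chain:
  assumes "z \<in> S" "y \<in> S" "i \<le> m"
  shows "prob {\<omega>\<in>space M. X i \<omega> = z \<and> X m \<omega> = y} = mat_pow S Q i x z * mat_pow S Q (m - i) z y"
  by (rule markov_chain_started_two_times[OF chain finite_states x assms])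

text \<open>The entry at \<open>x\<close>, \<open>y\<close> of the product of \<open>Q\<close>, the
  flow up to \<open>t - v\<close>, the diagonal matrix of \<open>f\<close> and the flow over the
  remaining time \<open>v\<close>. The leading \<open>Q\<close> is the step made at the late job
  itself.\<close>

definition weighted_path :: "((nat \<Rightarrow> nat) \<Rightarrow> real) \<Rightarrow> (nat \<Rightarrow> nat) \<Rightarrow> real \<Rightarrow> real \<Rightarrow> real" where
  "weighted_path f y t v = (\<Sum>z\<in>S. f z * ((\<Sum>w\<in>S. Q x w * flow (t - v) w z) * flow v z y))"

lemma weighted_path_nonneg:
  "(\<And>z. z \<in> S \<Longrightarrow> 0 \<le> f z) \<Longrightarrow> y \<in> S \<Longrightarrow> 0 \<le> v \<Longrightarrow> v \<le> t \<Longrightarrow> 0 \<le> weighted_path f y t v"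
  unfolding weighted_path_def
  by (intro sum_nonneg mult_nonneg_nonneg Q_nonneg flow_nonneg x) auto

text \<open>The i - 1 arrivals before time \<open>t - v\<close> and the m - i arrivals after it vary
  freely, so the double sum is a Cauchy product of two Poisson mixtures.\<close>

lemma weighted_path_sums:
  assumes y: "y \<in> S" and v: "0 \<le> v" "v \<le> t"
  shows "(\<lambda>m. \<Sum>i=1..m. \<Sum>z\<in>S. f z * (mat_pow S Q i x z * mat_pow S Q (m - i) z y)
      * (poisson_weight (rate * (t - v)) (i - 1) * poisson_weight (rate * v) (m - i)))
    sums weighted_path f y t v"
proof -
  let ?a = "\<lambda>z a. poisson_weight (rate * (t - v)) a * mat_pow S Q (Suc a) x z"
  let ?b = "\<lambda>z b. poisson_weight (rate * v) b * mat_pow S Q b z y"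
  let ?h = "\<lambda>m. \<Sum>i=1..m. \<Sum>z\<in>S. f z * (mat_pow S Q i x z * mat_pow S Q (m - i) z y)
      * (poisson_weight (rate * (t - v)) (i - 1) * poisson_weight (rate * v) (m - i))"
  have a: "?a z sums (\<Sum>w\<in>S. Q x w * flow (t - v) w z)" if "z \<in> S" for z
  proof -
    have "(\<lambda>a. \<Sum>w\<in>S. Q x w * (poisson_weight (rate * (t - v)) a * mat_pow S Q a w z))
        sums (\<Sum>w\<in>S. Q x w * flow (t - v) w z)"
      using that by (intro sums_sum sums_mult flow_sums)
    then show ?thesis by (simp add: mat_mult_def sum_distrib_left mult_ac)
  qed
  have b: "?b z sums flow v z y" if "z \<in> S" for z
    using that y by (rule flow_sums)
  have a0: "0 \<le> ?a z i" "0 \<le> ?b z i" if "z \<in> S" for z i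
    using lam v that x y by (auto intro!: mult_nonneg_nonneg poisson_weight_nonneg Q_pow_nonneg simp del: mat_pow.simps)
  have "(\<lambda>m. \<Sum>z\<in>S. f z * (\<Sum>i\<le>m. ?a z i * ?b z (m - i))) sums weighted_path f y t v"
    unfolding weighted_path_def
  proof (intro sums_sum sums_mult)
    fix z assume z: "z \<in> S"
    have "(\<lambda>m. \<Sum>i\<le>m. ?a z i * ?b z (m - i)) sums ((\<Sum>i. ?a z i) * (\<Sum>i. ?b z i))"
      using sums_summable[OF a[OF z]] sums_summable[OF b[OF z]] a0[OF z]
      by (intro Cauchy_product_sums) (simp_all only: real_norm_def abs_of_nonneg)
    then show "(\<lambda>m. \<Sum>i\<le>m. ?a z i * ?b z (m - i)) sums ((\<Sum>w\<in>S. Q x w * flow (t - v) w z) * flow v z y)"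
      by (simp only: sums_unique[OF a[OF z], symmetric] sums_unique[OF b[OF z], symmetric])
  qed
  \<comment> \<open>The late job is not counted by either Poisson weight, hence the shift to
    \<open>Suc m\<close>; the term at 0 is an empty sum.\<close>
  moreover have "(\<Sum>i=1..Suc m. \<Sum>z\<in>S. f z * (mat_pow S Q i x z * mat_pow S Q (Suc m - i) z y)
      * (poisson_weight (rate * (t - v)) (i - 1) * poisson_weight (rate * v) (Suc m - i)))
    = (\<Sum>z\<in>S. f z * (\<Sum>i\<le>m. ?a z i * ?b z (m - i)))" for m
  proof -
    have "(\<Sum>z\<in>S. f z * (\<Sum>i\<le>m. ?a z i * ?b z (m - i)))
        = (\<Sum>i\<le>m. \<Sum>z\<in>S. f z * (?a z i * ?b z (m - i)))"
      unfolding sum_distrib_left by (rule sum.swap)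
    also have "\<dots> = (\<Sum>i=1..Suc m. \<Sum>z\<in>S. f z * (?a z (i - 1) * ?b z (Suc m - i)))"
      unfolding One_nat_def sum.shift_bounds_cl_Suc_ivl by (simp add: atMost_atLeast0 del: mat_pow.simps)
    also have "\<dots> = (\<Sum>i=1..Suc m. \<Sum>z\<in>S. f z * (mat_pow S Q i x z * mat_pow S Q (Suc m - i) z y)
      * (poisson_weight (rate * (t - v)) (i - 1) * poisson_weight (rate * v) (Suc m - i)))"
      by (intro sum.cong refl) (simp add: mult_ac del: mat_pow.simps)
    finally show ?thesis by simp
  qed
  ultimately have "(\<lambda>m. ?h (Suc m)) sums weighted_path f y t v"
    by (simp only:)
  then have "?h sums (weighted_path f y t v + ?h 0)"
    by (rule iffD1[OF sums_Suc_iff])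
  then show ?thesis by simp
qed

end

lemma ennreal_double_sum:
  assumes "\<And>i z. i \<in> I \<Longrightarrow> z \<in> J \<Longrightarrow> 0 \<le> a i z"
  shows "ennreal (\<Sum>i\<in>I. \<Sum>z\<in>J. a i z) = (\<Sum>i\<in>I. \<Sum>z\<in>J. ennreal (a i z))"
  using assms by (simp add: sum_nonneg)

section \<open>Exact first moments\<close>

context started_queue
begin

text \<open>The state weight \<open>f\<close> and the service times \<open>R\<close> are left
  general, so that the result also serves the diagonal part of a second moment, with a product
  weight and the minimum of two service times.\<close>

lemma nn_integral_first_moment:
  fixes f :: "(nat \<Rightarrow> nat) \<Rightarrow> real" and R :: "nat \<Rightarrow> 'a \<Rightarrow> real"
  assumes f: "\<And>z. z \<in> S \<Longrightarrow> 0 \<le> f z"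
    and R: "\<And>i. R i \<in> borel_measurable G" "\<And>i. AE \<omega> in M. 0 \<le> R i \<omega>" "\<And>i. distr M borel (R i) = D0"
    and y: "y \<in> S" and t: "0 \<le> t"
  defines "Z \<equiv> \<lambda>\<omega>. (\<Sum>i=1..N t \<omega>. f (X i \<omega>) * of_bool (t < R i \<omega> / real n + jump_time N i \<omega>))
    * of_bool (X (N t \<omega>) \<omega> = y)"
  shows "(\<integral>\<^sup>+\<omega>. ennreal (Z \<omega>) \<partial>M)
    = (\<integral>\<^sup>+v. ennreal (rate * measure D0 {real n * v<..} * weighted_path f y t v) * indicator {0..t} v \<partial>lborel)"
    and "Z \<in> borel_measurable M"
proof -
  have n0: "0 < real n" using n by simp
  have RM: "R i \<in> borel_measurable M" for i using R(1) by (rule measurable_G_M)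
  note [measurable] = measurable_count[OF t] RM measurable_F_M[OF measurable_trunc_jump_time[OF t]]
  interpret D0: prob_space D0
    using prob_space_distr[OF RM[of 0]] by (simp add: R)
  have D0_sets: "sets D0 = sets borel" unfolding R(3)[of 0, symmetric] by simp
  \<comment> \<open>Splitting by the state \<open>z\<close> of the job separates an event of the
    chain, \<open>?B\<close>, from an event of counts and service times, \<open>?E\<close>, and
    these are independent.\<close>
  let ?B = "\<lambda>i z m. {\<omega>\<in>space M. X i \<omega> = z \<and> X m \<omega> = y}"
  let ?E = "\<lambda>i m. {\<omega>\<in>space M. N t \<omega> = m \<and> t < R i \<omega> / real n + trunc_jump_time t i \<omega>}"
  let ?g = "\<lambda>m \<omega>. \<Sum>i=1..m. \<Sum>z\<in>S. ennreal (f z) * (indicator (?B i z m \<inter> ?E i m) \<omega>)"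
  have Z0: "0 \<le> Z \<omega>" if "\<omega> \<in> space M" for \<omega>
    unfolding Z_def using f X_in[OF that] by (intro mult_nonneg_nonneg sum_nonneg) auto
  have Z: "ennreal (Z \<omega>) = ?g (N t \<omega>) \<omega>" if \<omega>: "\<omega> \<in> space M" for \<omega>
  proof -
    have "Z \<omega> = (\<Sum>i=1..N t \<omega>. \<Sum>z\<in>S. f z * indicator (?B i z (N t \<omega>) \<inter> ?E i (N t \<omega>)) \<omega>)"
      unfolding Z_def sum_distrib_right
    proof (intro sum.cong refl)
      fix i assume i: "i \<in> {1..N t \<omega>}"
      have "(\<Sum>z\<in>S. f z * indicator (?B i z (N t \<omega>) \<inter> ?E i (N t \<omega>)) \<omega>)
        = (\<Sum>z\<in>S. if z = X i \<omega> then f z * (of_bool (t < R i \<omega> / real n + jump_time N i \<omega>)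
            * of_bool (X (N t \<omega>) \<omega> = y)) else 0)"
        using i \<omega> by (intro sum.cong refl) (auto simp: indicator_def trunc_jump_time_def)
      also have "\<dots> = f (X i \<omega>) * (of_bool (t < R i \<omega> / real n + jump_time N i \<omega>) * of_bool (X (N t \<omega>) \<omega> = y))"
        using X_in[OF \<omega>] finite_states by (subst sum.delta) simp_all
      finally show "f (X i \<omega>) * of_bool (t < R i \<omega> / real n + jump_time N i \<omega>) * of_bool (X (N t \<omega>) \<omega> = y)
        = (\<Sum>z\<in>S. f z * indicator (?B i z (N t \<omega>) \<inter> ?E i (N t \<omega>)) \<omega>)" by (simp only: mult.assoc)
    qed
    note eq = this
    have "ennreal (Z \<omega>) = (\<Sum>i=1..N t \<omega>. \<Sum>z\<in>S. ennreal (f z * indicator (?B i z (N t \<omega>) \<inter> ?E i (N t \<omega>)) \<omega>))"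
      unfolding eq by (rule ennreal_double_sum) (simp add: f)
    also have "\<dots> = ?g (N t \<omega>) \<omega>"
      by (rule sum.cong[OF refl], rule sum.cong[OF refl]) (simp add: indicator_def)
    finally show ?thesis .
  qed
  \<comment> \<open>The event \<open>?E i m\<close> already forces \<open>N t \<omega> = m\<close>,
    so restricting to that value changes nothing.\<close>
  have g: "?g m \<omega> * indicator {\<omega>\<in>space M. N t \<omega> = m} \<omega> = ?g m \<omega>" for m \<omega>
  proof (cases "\<omega> \<in> space M \<and> N t \<omega> = m")
    case False
    then have "indicator (?B i z m \<inter> ?E i m) \<omega> = (0 :: ennreal)" for i z by (auto simp: indicator_def)
    then show ?thesis by simp
  qed simp
  note split = nn_integral_split_count[OF t, where g="?g", unfolded g]
  have gM: "?g m \<in> borel_measurable M" for m by measurable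
  \<comment> \<open>Measurability of the real variable is read off from its extended version, which
    is a countable sum of measurable pieces.\<close>
  have Z_enn: "Z \<omega> = enn2real (?g (N t \<omega>) \<omega>)" if "\<omega> \<in> space M" for \<omega>
    unfolding Z[OF that, symmetric] using Z0[OF that] by simp
  show "Z \<in> borel_measurable M"
  proof (rule measurable_cong[THEN iffD2])
    show "Z \<omega> = enn2real (?g (N t \<omega>) \<omega>)" if "\<omega> \<in> space M" for \<omega> by (rule Z_enn[OF that])
    show "(\<lambda>\<omega>. enn2real (?g (N t \<omega>) \<omega>)) \<in> borel_measurable M"
      by (rule borel_measurable_enn2real) (rule split(2)[OF gM])
  qed
  let ?w = "\<lambda>i m v. ennreal (rate * poisson_weight (rate * (t - v)) (i - 1) * poisson_weight (rate * v) (m - i))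
        * emeasure D0 {real n * v<..} * indicator {0..t} v"
  have D0_meas [measurable]: "(\<lambda>v. emeasure D0 {real n * v<..}) \<in> borel_measurable borel"
    by (rule borel_measurable_tail(1)[OF D0.prob_space_axioms D0_sets n0])
  have BE: "emeasure M (?B i z m \<inter> ?E i m) = ennreal (mat_pow S Q i x z * mat_pow S Q (m - i) z y) * (\<integral>\<^sup>+v. ?w i m v \<partial>lborel)"
    if i: "i \<in> {1..m}" and z: "z \<in> S" for i z m
  proof -
    have E_eq: "?E i m = {\<omega>\<in>space M. N t \<omega> = m \<and> t < R i \<omega> / real n + jump_time N i \<omega>}"
      using i by (auto simp: trunc_jump_time_def)
    have XX: "X i \<in> measurable (sigma (space M) \<X>) (count_space S)" for i
      by (rule measurable_process) auto
    have "{\<omega>\<in>space (sigma (space M) \<X>). X i \<omega> = z \<and> X m \<omega> = y} \<in> sets (sigma (space M) \<X>)"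
      using XX[of i] XX[of m] by measurable
    then have B: "?B i z m \<in> \<X>" by (simp only: space_sigma_process sets_sigma_process)
    have E: "?E i m \<in> sigma_sets (space M) (sets F \<union> sets G)"
      by (rule late_event_in_sigma_sets[OF R(1) t])
    have "emeasure M (?B i z m \<inter> ?E i m) = ennreal (prob (?B i z m)) * emeasure M (?E i m)"
      by (simp only: emeasure_eq_measure prob_indep_chain[OF B E] ennreal_mult measure_nonneg)
    moreover have "prob (?B i z m) = mat_pow S Q i x z * mat_pow S Q (m - i) z y"
      using i by (intro prob_chain z y) simp
    moreover have "emeasure M (?E i m) = (\<integral>\<^sup>+v. ?w i m v \<partial>lborel)"
      unfolding E_eq using emeasure_late[OF R(1,2) _ _ t n0, of i m] i by (simp add: R(3))
    ultimately show ?thesis by (simp only:)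
  qed
  have "(\<integral>\<^sup>+\<omega>. ennreal (Z \<omega>) \<partial>M) = (\<Sum>m. \<integral>\<^sup>+\<omega>. ?g m \<omega> \<partial>M)"
    unfolding split(1)[OF gM, symmetric] by (rule nn_integral_cong) (rule Z)
  also have "\<dots> = (\<Sum>m. \<Sum>i=1..m. \<Sum>z\<in>S. ennreal (f z) * emeasure M (?B i z m \<inter> ?E i m))"
    by (simp add: nn_integral_sum nn_integral_cmult)
  also have "\<dots> = (\<Sum>m. \<Sum>i=1..m. \<Sum>z\<in>S. ennreal (f z)
      * (ennreal (mat_pow S Q i x z * mat_pow S Q (m - i) z y) * (\<integral>\<^sup>+v. ?w i m v \<partial>lborel)))"
    by (rule suminf_cong, rule sum.cong[OF refl], rule sum.cong[OF refl]) (simp only: BE)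
  also have "\<dots> = (\<integral>\<^sup>+v. (\<Sum>m. \<Sum>i=1..m. \<Sum>z\<in>S. ennreal (f z)
      * (ennreal (mat_pow S Q i x z * mat_pow S Q (m - i) z y) * ?w i m v)) \<partial>lborel)"
    by (simp add: nn_integral_suminf nn_integral_sum nn_integral_cmult)
  also have "\<dots> = (\<integral>\<^sup>+v. ennreal (rate * measure D0 {real n * v<..} * weighted_path f y t v) * indicator {0..t} v \<partial>lborel)"
  proof (rule nn_integral_cong)
    fix v :: real
    let ?h = "measure D0 {real n * v<..}"
    show "(\<Sum>m. \<Sum>i=1..m. \<Sum>z\<in>S. ennreal (f z) * (ennreal (mat_pow S Q i x z * mat_pow S Q (m - i) z y) * ?w i m v))
      = ennreal (rate * ?h * weighted_path f y t v) * indicator {0..t} v"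
    proof (cases "v \<in> {0..t}")
      case True
      then have v: "0 \<le> v" "v \<le> t" by auto
      let ?c = "\<lambda>i m z. f z * (mat_pow S Q i x z * mat_pow S Q (m - i) z y)
          * (poisson_weight (rate * (t - v)) (i - 1) * poisson_weight (rate * v) (m - i))"
      have c0: "0 \<le> ?c i m z" if "z \<in> S" for i m z
        using f that x y lam v
        by (auto intro!: mult_nonneg_nonneg poisson_weight_nonneg Q_pow_nonneg simp del: mat_pow.simps)
      have pw0: "0 \<le> poisson_weight (rate * (t - v)) i" "0 \<le> poisson_weight (rate * v) i" for i
        using lam v by (auto intro!: poisson_weight_nonneg)
      have "(\<Sum>m. \<Sum>i=1..m. \<Sum>z\<in>S. ennreal (f z) * (ennreal (mat_pow S Q i x z * mat_pow S Q (m - i) z y) * ?w i m v))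
        = (\<Sum>m. \<Sum>i=1..m. \<Sum>z\<in>S. ennreal (rate * ?h * ?c i m z))"
      proof (rule suminf_cong, rule sum.cong[OF refl], rule sum.cong[OF refl])
        fix m i z assume z: "z \<in> S"
        have "?w i m v = ennreal (rate * poisson_weight (rate * (t - v)) (i - 1) * poisson_weight (rate * v) (m - i) * ?h)"
          using True lam pw0 by (simp add: D0.emeasure_eq_measure ennreal_mult[symmetric])
        then have "ennreal (f z) * (ennreal (mat_pow S Q i x z * mat_pow S Q (m - i) z y) * ?w i m v)
          = ennreal (f z * ((mat_pow S Q i x z * mat_pow S Q (m - i) z y) *
            (rate * poisson_weight (rate * (t - v)) (i - 1) * poisson_weight (rate * v) (m - i) * ?h)))"
          using lam pw0 f[OF z] Q_pow_nonneg[OF x z] Q_pow_nonneg[OF z y] by (simp add: ennreal_mult)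
        also have "\<dots> = ennreal (rate * ?h * ?c i m z)" by (simp add: mult_ac)
        finally show "ennreal (f z) * (ennreal (mat_pow S Q i x z * mat_pow S Q (m - i) z y) * ?w i m v)
          = ennreal (rate * ?h * ?c i m z)" .
      qed
      also have "\<dots> = (\<Sum>m. ennreal (rate * ?h * (\<Sum>i=1..m. \<Sum>z\<in>S. ?c i m z)))"
        unfolding sum_distrib_left
      proof (rule suminf_cong, rule ennreal_double_sum[symmetric])
        fix m i z assume "z \<in> S"
        then show "0 \<le> rate * ?h * ?c i m z"
          using lam by (intro mult_nonneg_nonneg[OF _ c0]) auto
      qed
      also have "\<dots> = ennreal (rate * ?h * weighted_path f y t v)"
      proof (rule suminf_ennreal_eq)
        show "0 \<le> rate * ?h * (\<Sum>i=1..m. \<Sum>z\<in>S. ?c i m z)" for m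
        proof (rule mult_nonneg_nonneg)
          show "0 \<le> rate * ?h" using lam by simp
          show "0 \<le> (\<Sum>i=1..m. \<Sum>z\<in>S. ?c i m z)" by (rule sum_nonneg, rule sum_nonneg, rule c0)
        qed
        show "(\<lambda>m. rate * ?h * (\<Sum>i=1..m. \<Sum>z\<in>S. ?c i m z)) sums (rate * ?h * weighted_path f y t v)"
          by (intro sums_mult weighted_path_sums y v)
      qed
      finally show ?thesis using True by simp
    qed simp
  qed
  finally show "(\<integral>\<^sup>+\<omega>. ennreal (Z \<omega>) \<partial>M)
    = (\<integral>\<^sup>+v. ennreal (rate * measure D0 {real n * v<..} * weighted_path f y t v) * indicator {0..t} v \<partial>lborel)" .
qed

lemma set_integrable_tail_mult:
  fixes g :: "real \<Rightarrow> real"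
  assumes "prob_space D0" "sets D0 = sets borel" and g: "continuous_on {0..t} g"
  shows "set_integrable lborel {0..t} (\<lambda>v. measure D0 {real n * v<..} * g v)"
proof -
  interpret D0: prob_space D0 by fact
  have n0: "0 < real n" using n by simp
  have g_int: "set_integrable lborel {0..t} g"
    using borel_integrable_atLeastAtMost'[OF g] .
  note [measurable] = borel_measurable_tail(2)[OF assms(1,2) n0]
  have "integrable lborel (\<lambda>v. measure D0 {real n * v<..} * (indicator {0..t} v *\<^sub>R g v))"
  proof (rule Bochner_Integration.integrable_bound)
    show "integrable lborel (\<lambda>v. indicator {0..t} v *\<^sub>R g v)"
      using g_int by (simp only: set_integrable_def)
    have "(\<lambda>v. indicator {0..t} v *\<^sub>R g v) \<in> borel_measurable lborel"
      using g_int unfolding set_integrable_def by (rule borel_measurable_integrable)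
    then show "(\<lambda>v. measure D0 {real n * v<..} * (indicator {0..t} v *\<^sub>R g v)) \<in> borel_measurable lborel"
      by measurable
    show "AE v in lborel. norm (measure D0 {real n * v<..} * (indicator {0..t} v *\<^sub>R g v))
        \<le> norm (indicator {0..t} v *\<^sub>R g v)"
      by (intro AE_I2) (simp add: abs_mult mult_left_le_one_le)
  qed
  then show ?thesis by (simp add: set_integrable_def mult_ac)
qed

text \<open>The transition factor \<open>Q\<close> is kept outside: it also varies with
  \<open>n\<close>, and its limit is taken separately from that of the integral.\<close>

definition late_weight :: "real measure \<Rightarrow> real \<Rightarrow> (nat \<Rightarrow> nat) \<Rightarrow> (nat \<Rightarrow> nat) \<Rightarrow> (nat \<Rightarrow> nat) \<Rightarrow> real" where
  "late_weight D0 t w z y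
    = (LINT v:{0..t}|lborel. measure D0 {real n * v<..} * (flow (t - v) w z * flow v z y))"

lemma has_integral_weighted_path:
  assumes "prob_space D0" "sets D0 = sets borel" and y: "y \<in> S"
  shows "has_bochner_integral lborel
    (\<lambda>v. indicator {0..t} v *\<^sub>R (rate * measure D0 {real n * v<..} * weighted_path f y t v))
    (rate * (\<Sum>z\<in>S. f z * (\<Sum>w\<in>S. Q x w * late_weight D0 t w z y)))"
proof -
  have "has_bochner_integral lborel (\<lambda>v. rate * (\<Sum>z\<in>S. f z * (\<Sum>w\<in>S. Q x w *
      (indicator {0..t} v *\<^sub>R (measure D0 {real n * v<..} * (flow (t - v) w z * flow v z y))))))
    (rate * (\<Sum>z\<in>S. f z * (\<Sum>w\<in>S. Q x w * late_weight D0 t w z y)))"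
  proof (intro has_bochner_integral_mult_right has_bochner_integral_sum)
    fix z w assume zw: "z \<in> S" "w \<in> S"
    have "set_integrable lborel {0..t} (\<lambda>v. measure D0 {real n * v<..} * (flow (t - v) w z * flow v z y))"
      using zw y by (intro set_integrable_tail_mult assms continuous_intros continuous_on_mat_exp_scale finite_states)
    then show "has_bochner_integral lborel
        (\<lambda>v. indicator {0..t} v *\<^sub>R (measure D0 {real n * v<..} * (flow (t - v) w z * flow v z y)))
        (late_weight D0 t w z y)"
      unfolding late_weight_def set_lebesgue_integral_def set_integrable_def
      by (rule has_bochner_integral_integrable)
  qed
  then show ?thesis
    by (simp add: weighted_path_def sum_distrib_left sum_distrib_right mult_ac)
qed

text \<open>The return from extended to real integrals: the right-hand side is finite because the
  tail is at most 1 and the flows are continuous on a compact interval.\<close>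

lemma has_integral_first_moment:
  fixes f :: "(nat \<Rightarrow> nat) \<Rightarrow> real" and R :: "nat \<Rightarrow> 'a \<Rightarrow> real"
  assumes f: "\<And>z. z \<in> S \<Longrightarrow> 0 \<le> f z"
    and R: "\<And>i. R i \<in> borel_measurable G" "\<And>i. AE \<omega> in M. 0 \<le> R i \<omega>" "\<And>i. distr M borel (R i) = D0"
    and y: "y \<in> S" and t: "0 \<le> t"
  shows "has_bochner_integral M
    (\<lambda>\<omega>. (\<Sum>i=1..N t \<omega>. f (X i \<omega>) * of_bool (t < R i \<omega> / real n + jump_time N i \<omega>))
      * of_bool (X (N t \<omega>) \<omega> = y))
    (rate * (\<Sum>z\<in>S. f z * (\<Sum>w\<in>S. Q x w * late_weight D0 t w z y)))"
proof -
  have D0: "prob_space D0" "sets D0 = sets borel"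
    using prob_space_distr[OF measurable_G_M[OF R(1)[of 0]]] unfolding R(3)[of 0, symmetric] by simp_all
  let ?J = "rate * (\<Sum>z\<in>S. f z * (\<Sum>w\<in>S. Q x w * late_weight D0 t w z y))"
  let ?g = "\<lambda>v. rate * measure D0 {real n * v<..} * weighted_path f y t v"
  note J = has_integral_weighted_path[OF D0 y, of t f]
  have g0: "0 \<le> indicator {0..t} v *\<^sub>R ?g v" for v
    using lam weighted_path_nonneg[OF f y, where v=v and t=t] by (auto simp: indicator_def)
  have J': "integrable lborel (\<lambda>v. indicator {0..t} v *\<^sub>R ?g v)"
    "integral\<^sup>L lborel (\<lambda>v. indicator {0..t} v *\<^sub>R ?g v) = ?J"
    using J by (simp_all only: has_bochner_integral_iff)
  have J0: "0 \<le> ?J"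
    unfolding J'(2)[symmetric] by (rule Bochner_Integration.integral_nonneg[OF g0])
  have "(\<integral>\<^sup>+v. ennreal (?g v) * indicator {0..t} v \<partial>lborel) = (\<integral>\<^sup>+v. ennreal (indicator {0..t} v *\<^sub>R ?g v) \<partial>lborel)"
    by (rule nn_integral_cong) (simp add: indicator_def)
  also have "\<dots> = ennreal ?J"
    unfolding J'(2)[symmetric] by (rule nn_integral_eq_integral[OF J'(1) AE_I2[OF g0]])
  finally have eq: "(\<integral>\<^sup>+v. ennreal (?g v) * indicator {0..t} v \<partial>lborel) = ennreal ?J" .
  show ?thesis
  proof (rule has_bochner_integral_nn_integral)
    show "AE \<omega> in M. 0 \<le> (\<Sum>i=1..N t \<omega>. f (X i \<omega>) * of_bool (t < R i \<omega> / real n + jump_time N i \<omega>))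
      * of_bool (X (N t \<omega>) \<omega> = y)"
      using f X_in by (intro AE_I2 mult_nonneg_nonneg sum_nonneg) auto
    show "(\<lambda>\<omega>. (\<Sum>i=1..N t \<omega>. f (X i \<omega>) * of_bool (t < R i \<omega> / real n + jump_time N i \<omega>))
      * of_bool (X (N t \<omega>) \<omega> = y)) \<in> borel_measurable M"
      by (rule nn_integral_first_moment(2)[OF f R y t])
    show "(\<integral>\<^sup>+\<omega>. ennreal ((\<Sum>i=1..N t \<omega>. f (X i \<omega>) * of_bool (t < R i \<omega> / real n + jump_time N i \<omega>))
      * of_bool (X (N t \<omega>) \<omega> = y)) \<partial>M) = ennreal ?J"
      unfolding eq[symmetric] by (rule nn_integral_first_moment(1)[OF f R y t])
  qed (rule J0)
qed

section \<open>Second moments: diagonal terms and pairs of distinct jobs\<close>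

definition min_law :: "nat \<Rightarrow> nat \<Rightarrow> real measure" where
  "min_law j j' = (if j = j' then D j else distr (D j \<Otimes>\<^sub>M D j') borel (\<lambda>p. min (fst p) (snd p)))"

lemma D_prob: "j \<in> {1..k} \<Longrightarrow> prob_space (D j)" and D_sets: "j \<in> {1..k} \<Longrightarrow> sets (D j) = sets borel"
  using prob_space_distr[OF measurable_L_M[of j 0]] distr_L[of j 0] sets_distr[of M borel "L 0 j"] by auto

text \<open>Equal components need their own case: a service time paired with itself does not follow
  a product law, and the minimum is then the service time itself.\<close>

lemma distr_min_L:
  assumes j: "j \<in> {1..k}" "j' \<in> {1..k}"
  shows "distr M borel (\<lambda>\<omega>. min (L i j \<omega>) (L i j' \<omega>)) = min_law j j'"
proof (cases "j = j'")
  case True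
  then show ?thesis using distr_L j by (simp add: min_law_def)
next
  case False
  then have "indep_var borel (L i j) borel (L i j')" using j by (intro indep_L) auto
  then have "distr M (borel \<Otimes>\<^sub>M borel) (\<lambda>\<omega>. (L i j \<omega>, L i j' \<omega>)) = D j \<Otimes>\<^sub>M D j'"
    using distr_L[OF j(1)] distr_L[OF j(2)] unfolding indep_var_distribution_eq by simp
  moreover have "distr (distr M (borel \<Otimes>\<^sub>M borel) (\<lambda>\<omega>. (L i j \<omega>, L i j' \<omega>))) borel (\<lambda>p. min (fst p) (snd p))
      = distr M borel (\<lambda>\<omega>. min (L i j \<omega>) (L i j' \<omega>))"
    using measurable_L_M[OF j(1), of i] measurable_L_M[OF j(2), of i]
    by (subst distr_distr) (auto simp: comp_def)
  ultimately show ?thesis using False by (simp add: min_law_def)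
qed

text \<open>A minimum exceeds \<open>u\<close> iff both entries do. For different components the two
  tails multiply, which is the source of the vanishing mixed moment.\<close>

lemma measure_min_law:
  assumes j: "j \<in> {1..k}" "j' \<in> {1..k}"
  shows "measure (min_law j j') {u<..}
    = (if j = j' then measure (D j) {u<..} else measure (D j) {u<..} * measure (D j') {u<..})"
proof (cases "j = j'")
  case False
  interpret D1: prob_space "D j" using j by (intro D_prob)
  interpret D2: prob_space "D j'" using j by (intro D_prob)
  interpret DD: pair_prob_space "D j" "D j'" ..
  note [measurable_cong] = D_sets[OF j(1)] D_sets[OF j(2)]
  have sp: "space (D j) = UNIV" "space (D j') = UNIV"
    using sets_eq_imp_space_eq[OF D_sets[OF j(1)]] sets_eq_imp_space_eq[OF D_sets[OF j(2)]] by auto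
  have "measure (min_law j j') {u<..} = measure (D j \<Otimes>\<^sub>M D j') ({u<..} \<times> {u<..})"
    using False unfolding min_law_def
    by (simp add: measure_distr) (auto simp: space_pair_measure sp intro!: arg_cong[where f="measure _"])
  also have "\<dots> = measure (D j) {u<..} * measure (D j') {u<..}"
    using D_sets j
    by (simp add: measure_def D2.emeasure_pair_measure_Times enn2real_mult)
  finally show ?thesis using False by simp
qed (simp add: min_law_def)

lemma states_le:
  assumes "z \<in> S" "j \<in> {1..k}"
  shows "real (z j) \<le> real K"
proof -
  have "z j \<in> {0..K}" using assms unfolding states_def by (rule PiE_mem)
  then show ?thesis by simp
qed

lemma has_integral_queue_moment1:
  assumes j: "j \<in> {1..k}" and y: "y \<in> S" and t: "0 \<le> t"
  shows "has_bochner_integral M (\<lambda>\<omega>. queue_Z N X L n j t \<omega> * of_bool (X (N t \<omega>) \<omega> = y))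
    (rate * (\<Sum>z\<in>S. real (z j) * (\<Sum>w\<in>S. Q x w * late_weight (D j) t w z y)))"
  unfolding queue_Z_def
  by (rule has_integral_first_moment[where f="\<lambda>z. real (z j)" and R="\<lambda>i. L i j"])
     (use j y t measurable_L L_nonneg distr_L in auto)

text \<open>By the layer-cake formula this is the mean of the service time divided by
  \<open>n\<close> and cut off at \<open>t\<close>.\<close>

definition late_mass :: "nat \<Rightarrow> real \<Rightarrow> real" where
  "late_mass j t = (LINT v:{0..t}|lborel. measure (D j) {real n * v<..})"

lemma nn_integral_late_mass:
  assumes j: "j \<in> {1..k}"
  shows "(\<integral>\<^sup>+v. emeasure (D j) {real n * v<..} * indicator {0..t} v \<partial>lborel) = ennreal (late_mass j t)"
    and "0 \<le> late_mass j t"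
proof -
  interpret D: prob_space "D j" using j by (rule D_prob)
  have "set_integrable lborel {0..t} (\<lambda>v. measure (D j) {real n * v<..} * 1)"
    by (intro set_integrable_tail_mult D_prob D_sets j continuous_intros)
  then have int: "integrable lborel (\<lambda>v. indicator {0..t} v *\<^sub>R measure (D j) {real n * v<..})"
    by (simp add: set_integrable_def)
  have "(\<integral>\<^sup>+v. emeasure (D j) {real n * v<..} * indicator {0..t} v \<partial>lborel)
      = (\<integral>\<^sup>+v. ennreal (indicator {0..t} v *\<^sub>R measure (D j) {real n * v<..}) \<partial>lborel)"
    by (rule nn_integral_cong) (simp add: indicator_def D.emeasure_eq_measure)
  also have "\<dots> = ennreal (late_mass j t)"
    unfolding late_mass_def set_lebesgue_integral_def
    by (rule nn_integral_eq_integral[OF int]) simp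
  finally show "(\<integral>\<^sup>+v. emeasure (D j) {real n * v<..} * indicator {0..t} v \<partial>lborel) = ennreal (late_mass j t)" .
  show "0 \<le> late_mass j t"
    unfolding late_mass_def set_lebesgue_integral_def by (rule Bochner_Integration.integral_nonneg) simp
qed

text \<open>The off-diagonal part is only estimated. Dropping the condition on the final state and
  bounding both coordinates by \<open>K\<close> removes the chain altogether and leaves the mean
  number of late pairs.\<close>

lemma queue_moment2_bounds:
  assumes j: "j \<in> {1..k}" "j' \<in> {1..k}" and y: "y \<in> S" and t: "0 \<le> t"
  defines "J \<equiv> rate * (\<Sum>z\<in>S. real (z j) * real (z j') * (\<Sum>w\<in>S. Q x w * late_weight (min_law j j') t w z y))"
  shows "\<bar>(\<integral>\<omega>. queue_Z N X L n j t \<omega> * queue_Z N X L n j' t \<omega> * of_bool (X (N t \<omega>) \<omega> = y) \<partial>M) - J\<bar>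
    \<le> (real K)\<^sup>2 * (rate\<^sup>2 * late_mass j t * late_mass j' t)"
proof -
  have n0: "0 < real n" using n by simp
  let ?Y = "\<lambda>\<omega>. of_bool (X (N t \<omega>) \<omega> = y) :: real"
  let ?a = "\<lambda>j i \<omega>. real (X i \<omega> j) * of_bool (t < L i j \<omega> / real n + jump_time N i \<omega>)"
  define Dg where "Dg = (\<lambda>\<omega>. (\<Sum>i=1..N t \<omega>. real (X i \<omega> j) * real (X i \<omega> j')
      * of_bool (t < min (L i j \<omega>) (L i j' \<omega>) / real n + jump_time N i \<omega>)) * ?Y \<omega>)"
  let ?I = "\<lambda>m::nat. {(i, i'). i \<in> {1..m} \<and> i' \<in> {1..m} \<and> i \<noteq> i'}"
  define W where "W = (\<lambda>\<omega>. (\<Sum>(i, i')\<in>?I (N t \<omega>). ?a j i \<omega> * ?a j' i' \<omega>) * ?Y \<omega>)"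
  have finI: "finite (?I m)" for m
    by (rule finite_subset[of _ "{1..m} \<times> {1..m}"]) auto
  have split: "queue_Z N X L n j t \<omega> * queue_Z N X L n j' t \<omega> * ?Y \<omega> = Dg \<omega> + W \<omega>" for \<omega>
  proof -
    let ?A = "{1..N t \<omega>}"
    have "queue_Z N X L n j t \<omega> * queue_Z N X L n j' t \<omega>
        = (\<Sum>(i, i')\<in>?A \<times> ?A. ?a j i \<omega> * ?a j' i' \<omega>)"
      unfolding queue_Z_def sum_product by (rule sum.cartesian_product)
    also have "?A \<times> ?A = (\<lambda>i. (i, i)) ` ?A \<union> ?I (N t \<omega>)" by auto
    also have "(\<Sum>(i, i')\<in>(\<lambda>i. (i, i)) ` ?A \<union> ?I (N t \<omega>). ?a j i \<omega> * ?a j' i' \<omega>)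
      = (\<Sum>(i, i')\<in>(\<lambda>i. (i, i)) ` ?A. ?a j i \<omega> * ?a j' i' \<omega>) + (\<Sum>(i, i')\<in>?I (N t \<omega>). ?a j i \<omega> * ?a j' i' \<omega>)"
      by (rule sum.union_disjoint) (use finI in auto)
    also have "(\<Sum>(i, i')\<in>(\<lambda>i. (i, i)) ` ?A. ?a j i \<omega> * ?a j' i' \<omega>) = (\<Sum>i\<in>?A. ?a j i \<omega> * ?a j' i \<omega>)"
      by (subst sum.reindex) (auto simp: inj_on_def)
    also have "\<dots> = (\<Sum>i\<in>?A. real (X i \<omega> j) * real (X i \<omega> j')
      * of_bool (t < min (L i j \<omega>) (L i j' \<omega>) / real n + jump_time N i \<omega>))"
    proof (rule sum.cong[OF refl])
      fix i
      have "min (L i j \<omega>) (L i j' \<omega>) / real n = min (L i j \<omega> / real n) (L i j' \<omega> / real n)"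
        using n0 by (auto simp: min_def divide_le_cancel)
      then show "?a j i \<omega> * ?a j' i \<omega> = real (X i \<omega> j) * real (X i \<omega> j')
        * of_bool (t < min (L i j \<omega>) (L i j' \<omega>) / real n + jump_time N i \<omega>)"
        by (auto simp: min_def)
    qed
    finally show ?thesis by (simp add: Dg_def W_def distrib_right)
  qed
  have Dg: "has_bochner_integral M Dg J"
    unfolding Dg_def J_def
  proof (rule has_integral_first_moment[where f="\<lambda>z. real (z j) * real (z j')" and R="\<lambda>i \<omega>. min (L i j \<omega>) (L i j' \<omega>)"])
    show "(\<lambda>\<omega>. min (L i j \<omega>) (L i j' \<omega>)) \<in> borel_measurable G" for i
      by (intro borel_measurable_min measurable_L j)
    show "AE \<omega> in M. 0 \<le> min (L i j \<omega>) (L i j' \<omega>)" for i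
      using L_nonneg[OF j(1), of i] L_nonneg[OF j(2), of i] by eventually_elim simp
    show "distr M borel (\<lambda>\<omega>. min (L i j \<omega>) (L i j' \<omega>)) = min_law j j'" for i
      by (rule distr_min_L[OF j])
  qed (use y t in auto)
  have indep_pairs: "indep_var borel (L i j) borel (L i' j')" if "i \<noteq> i'" for i i'
    using that j by (intro indep_L) auto
  note pairs = measurable_L[OF j(1)] measurable_L[OF j(2)] L_nonneg[OF j(1)] L_nonneg[OF j(2)]
    distr_L[OF j(1)] distr_L[OF j(2)] indep_pairs t n0
  have W0: "0 \<le> W \<omega>" for \<omega>
    unfolding W_def by (intro mult_nonneg_nonneg sum_nonneg) auto
  \<comment> \<open>The indicator \<open>?Y\<close> is idempotent, so the product of two
    first-moment integrands is \<open>Dg + W\<close>; measurability of \<open>W\<close> follows by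
    subtracting \<open>Dg\<close>.\<close>
  have "(\<lambda>\<omega>. (queue_Z N X L n j t \<omega> * ?Y \<omega>) * (queue_Z N X L n j' t \<omega> * ?Y \<omega>)) \<in> borel_measurable M"
    using has_integral_queue_moment1[OF j(1) y t] has_integral_queue_moment1[OF j(2) y t]
    by (intro borel_measurable_times[OF borel_measurable_has_bochner_integral borel_measurable_has_bochner_integral])
  also have "(\<lambda>\<omega>. (queue_Z N X L n j t \<omega> * ?Y \<omega>) * (queue_Z N X L n j' t \<omega> * ?Y \<omega>)) = (\<lambda>\<omega>. Dg \<omega> + W \<omega>)"
    by (rule ext) (simp add: split[symmetric])
  finally have "(\<lambda>\<omega>. Dg \<omega> + W \<omega> - Dg \<omega>) \<in> borel_measurable M"
    by (rule borel_measurable_diff[OF _ borel_measurable_has_bochner_integral[OF Dg]])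
  then have W_meas: "W \<in> borel_measurable M" by simp
  let ?C = "(real K)\<^sup>2 * (rate\<^sup>2 * late_mass j t * late_mass j' t)"
  have "(\<integral>\<^sup>+\<omega>. ennreal (W \<omega>) \<partial>M) \<le> (\<integral>\<^sup>+\<omega>. ennreal ((real K)\<^sup>2) * (\<Sum>(i, i')\<in>?I (N t \<omega>).
      ennreal (of_bool (t < L i j \<omega> / real n + jump_time N i \<omega> \<and> t < L i' j' \<omega> / real n + jump_time N i' \<omega>))) \<partial>M)"
  proof (rule nn_integral_mono)
    fix \<omega> assume \<omega>: "\<omega> \<in> space M"
    let ?b = "\<lambda>i i'. of_bool (t < L i j \<omega> / real n + jump_time N i \<omega> \<and> t < L i' j' \<omega> / real n + jump_time N i' \<omega>) :: real"
    have "W \<omega> \<le> (\<Sum>(i, i')\<in>?I (N t \<omega>). ?a j i \<omega> * ?a j' i' \<omega>) * 1"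
      unfolding W_def by (intro mult_left_mono sum_nonneg) auto
    also have "\<dots> \<le> (\<Sum>(i, i')\<in>?I (N t \<omega>). (real K)\<^sup>2 * ?b i i')"
    proof (simp only: mult_1_right, rule sum_mono, simp only: split_paired_all prod.case)
      fix i i'
      have "real (X i \<omega> j) * real (X i' \<omega> j') \<le> real K * real K"
        by (intro mult_mono states_le X_in \<omega> j) auto
      then show "?a j i \<omega> * ?a j' i' \<omega> \<le> (real K)\<^sup>2 * ?b i i'"
        by (simp add: power2_eq_square)
    qed
    finally have "ennreal (W \<omega>) \<le> ennreal (\<Sum>(i, i')\<in>?I (N t \<omega>). (real K)\<^sup>2 * ?b i i')"
      by (rule ennreal_leI)
    also have "\<dots> = ennreal ((real K)\<^sup>2) * (\<Sum>(i, i')\<in>?I (N t \<omega>). ennreal (?b i i'))"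
      unfolding split_beta' sum_distrib_left[symmetric] by (subst ennreal_mult) (auto intro: sum_nonneg)
    finally show "ennreal (W \<omega>) \<le> ennreal ((real K)\<^sup>2) * (\<Sum>(i, i')\<in>?I (N t \<omega>). ennreal (?b i i'))" .
  qed
  also have "\<dots> = ennreal ((real K)\<^sup>2) * (\<integral>\<^sup>+\<omega>. (\<Sum>(i, i')\<in>?I (N t \<omega>).
      ennreal (of_bool (t < L i j \<omega> / real n + jump_time N i \<omega> \<and> t < L i' j' \<omega> / real n + jump_time N i' \<omega>))) \<partial>M)"
    by (rule nn_integral_cmult) (rule nn_integral_late_pairs(2)[OF pairs])
  also have "\<dots> = ennreal ((real K)\<^sup>2) * (ennreal (rate\<^sup>2) * ennreal (late_mass j t) * ennreal (late_mass j' t))"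
    unfolding nn_integral_late_mass(1)[OF j(1), symmetric] nn_integral_late_mass(1)[OF j(2), symmetric]
    by (rule arg_cong[OF nn_integral_late_pairs(1)[OF pairs]])
  also have "\<dots> = ennreal ?C"
    using nn_integral_late_mass(2)[OF j(1), of t] nn_integral_late_mass(2)[OF j(2), of t] by (simp add: ennreal_mult)
  finally have W_le: "(\<integral>\<^sup>+\<omega>. ennreal (W \<omega>) \<partial>M) \<le> ennreal ?C" .
  have W_int: "integrable M W"
    using W_meas W0 W_le by (intro integrableI_nonneg) (auto simp: le_less_trans[OF _ ennreal_less_top])
  have C0: "0 \<le> ?C"
    using nn_integral_late_mass(2)[OF j(1), of t] nn_integral_late_mass(2)[OF j(2), of t] by simp
  have "ennreal (integral\<^sup>L M W) \<le> ennreal ?C"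
    using W_le unfolding nn_integral_eq_integral[OF W_int AE_I2[OF W0]] .
  then have W_le': "integral\<^sup>L M W \<le> ?C" using C0 by (simp only: ennreal_le_iff)
  have W_ge: "0 \<le> integral\<^sup>L M W" using W0 by (rule Bochner_Integration.integral_nonneg)
  have "(\<integral>\<omega>. queue_Z N X L n j t \<omega> * queue_Z N X L n j' t \<omega> * ?Y \<omega> \<partial>M) = J + integral\<^sup>L M W"
    unfolding split using Dg W_int by (simp add: has_bochner_integral_iff)
  then show ?thesis using W_le' W_ge by simp
qed

end

section \<open>Heavy-tailed limits\<close>

lemma set_integrable_powr_from_0:
  fixes a t :: real
  assumes "- 1 < a" "0 \<le> t"
  shows "set_integrable lborel {0..t} (\<lambda>v. v powr a)"
proof -
  have "(\<lambda>v. v powr a) absolutely_integrable_on {0..t}"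
    using assms by (intro nonnegative_absolutely_integrable_1 integrable_on_powr_from_0) auto
  then have "integrable (completion lborel) (\<lambda>v. indicator {0..t} v *\<^sub>R (v powr a))"
    unfolding set_integrable_def .
  then show ?thesis
    unfolding set_integrable_def by (subst (asm) integrable_completion) auto
qed

lemma
  fixes D :: "real measure" and \<alpha> :: real
  assumes "prob_space D" and "0 < \<alpha>"
    and equiv: "(\<lambda>s. measure D {s<..}) \<sim>[at_top] (\<lambda>s. s powr (- \<alpha>))"
  shows regularly_varying_tail_limit:
    "\<And>v. 0 < v \<Longrightarrow> (\<lambda>n. real n powr \<alpha> * measure D {real n * v<..}) \<longlonglongrightarrow> v powr (- \<alpha>)"
    and regularly_varying_tail_bound: "\<exists>C\<ge>0. \<forall>u>0. measure D {u<..} \<le> C * u powr (- \<alpha>)"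
proof -
  interpret D: prob_space D by fact
  \<comment> \<open>Asymptotic equivalence speaks of a quotient with the convention that 0 / 0 is 1;
    for positive \<open>s\<close> the denominator is not zero and the plain quotient
    remains.\<close>
  have lim: "((\<lambda>s. measure D {s<..} / s powr (- \<alpha>)) \<longlongrightarrow> 1) at_top"
  proof (rule Lim_transform_eventually[OF asymp_equivD[OF equiv]])
    show "\<forall>\<^sub>F s in at_top. (if measure D {s<..} = 0 \<and> s powr (- \<alpha>) = 0 then 1
        else measure D {s<..} / s powr (- \<alpha>)) = measure D {s<..} / s powr (- \<alpha>)"
      using eventually_gt_at_top[of "0::real"] by eventually_elim auto
  qed
  show "(\<lambda>n. real n powr \<alpha> * measure D {real n * v<..}) \<longlonglongrightarrow> v powr (- \<alpha>)" if v: "0 < v" for v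
  proof -
    have "filterlim (\<lambda>n. real n * v) at_top sequentially"
      using v by (intro filterlim_at_top_mult_tendsto_pos[OF tendsto_const] filterlim_real_sequentially)
    from tendsto_mult[OF filterlim_compose[OF lim this] tendsto_const[of "v powr (- \<alpha>)"]]
    have "(\<lambda>n. measure D {real n * v<..} / (real n * v) powr (- \<alpha>) * v powr (- \<alpha>)) \<longlonglongrightarrow> v powr (- \<alpha>)"
      by simp
    then show ?thesis
    proof (rule Lim_transform_eventually)
      show "\<forall>\<^sub>F n in sequentially. measure D {real n * v<..} / (real n * v) powr (- \<alpha>) * v powr (- \<alpha>)
          = real n powr \<alpha> * measure D {real n * v<..}"
        using eventually_gt_at_top[of 0]
      proof eventually_elim
        case (elim n)
        then show ?case using v by (simp add: powr_mult powr_minus field_simps)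
      qed
    qed
  qed
  have "\<forall>\<^sub>F s in at_top. measure D {s<..} / s powr (- \<alpha>) < 2"
    using lim by (rule order_tendstoD) simp
  then obtain s0 where s0: "\<And>s. s0 \<le> s \<Longrightarrow> measure D {s<..} / s powr (- \<alpha>) < 2"
    by (auto simp: eventually_at_top_linorder)
  \<comment> \<open>Beyond \<open>?s\<close> the quotient is below 2. Below it the probability is at
    most 1, which the factor \<open>?s powr \<alpha>\<close> compensates. Adding the two constants
    covers both ranges.\<close>
  let ?s = "max s0 1"
  show "\<exists>C\<ge>0. \<forall>u>0. measure D {u<..} \<le> C * u powr (- \<alpha>)"
  proof (intro exI[of _ "2 + ?s powr \<alpha>"] conjI allI impI)
    fix u :: real assume u: "0 < u"
    show "measure D {u<..} \<le> (2 + ?s powr \<alpha>) * u powr (- \<alpha>)"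
    proof (cases "?s \<le> u")
      case True
      then have "measure D {u<..} \<le> 2 * u powr (- \<alpha>)"
        using s0[of u] u by (simp add: divide_less_eq)
      also have "\<dots> \<le> (2 + ?s powr \<alpha>) * u powr (- \<alpha>)"
        by (intro mult_right_mono) auto
      finally show ?thesis .
    next
      case False
      have "measure D {u<..} \<le> 1" by simp
      also have "\<dots> = u powr \<alpha> * u powr (- \<alpha>)" using u by (simp add: powr_minus)
      also have "\<dots> \<le> (2 + ?s powr \<alpha>) * u powr (- \<alpha>)"
      proof (intro mult_right_mono)
        have "u powr \<alpha> \<le> ?s powr \<alpha>" using False u assms(2) by (intro powr_mono2) auto
        then show "u powr \<alpha> \<le> 2 + ?s powr \<alpha>" by simp
      qed simp
      finally show ?thesis .
    qed
  qed simp
qed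

text \<open>The case \<open>c = 0\<close> covers products of two tails.\<close>

locale heavy_tail =
  fixes h :: "real \<Rightarrow> real" and \<alpha> c C :: real
  assumes \<alpha>: "0 < \<alpha>" "\<alpha> < 1" and h_meas: "h \<in> borel_measurable borel" and h_nonneg: "\<And>u. 0 \<le> h u"
    and h_lim: "\<And>v. 0 < v \<Longrightarrow> (\<lambda>n. real n powr \<alpha> * h (real n * v)) \<longlonglongrightarrow> c * v powr (- \<alpha>)"
    and h_bound: "\<And>u. 0 < u \<Longrightarrow> h u \<le> C * u powr (- \<alpha>)"
begin

text \<open>In the bound on \<open>h (real n * v)\<close> the power of n cancels against the
  prefactor exactly, so one multiple of \<open>v powr (- \<alpha>)\<close> dominates for all n. It
  is integrable at 0 because \<alpha> < 1.\<close>

lemma scaled_integral_limit: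
  fixes g :: "real \<Rightarrow> real"
  assumes g: "continuous_on {0..t} g" and t: "0 \<le> t"
  shows "(\<lambda>n. real n powr \<alpha> * (LINT v:{0..t}|lborel. h (real n * v) * g v))
      \<longlonglongrightarrow> (LINT v:{0..t}|lborel. c * v powr (- \<alpha>) * g v)"
    and "set_integrable lborel {0..t} (\<lambda>v. c * v powr (- \<alpha>) * g v)"
proof -
  have "compact (g ` {0..t})" using g by (intro compact_continuous_image) auto
  then obtain B where B: "\<And>v. v \<in> {0..t} \<Longrightarrow> \<bar>g v\<bar> \<le> B"
    using compact_imp_bounded[of "g ` {0..t}"] by (fastforce simp: bounded_iff)
  have g_meas: "(\<lambda>v. indicator {0..t} v *\<^sub>R g v) \<in> borel_measurable borel"
    using borel_integrable_atLeastAtMost'[OF g] unfolding set_integrable_def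
    by (auto dest: borel_measurable_integrable)
  note [measurable] = h_meas
  let ?s = "\<lambda>n v. (real n powr \<alpha> * h (real n * v)) * (indicator {0..t} v *\<^sub>R g v)"
  let ?f = "\<lambda>v. (c * v powr (- \<alpha>)) * (indicator {0..t} v *\<^sub>R g v)"
  let ?w = "\<lambda>v. (\<bar>C\<bar> * B) * (indicator {0..t} v *\<^sub>R (v powr (- \<alpha>)))"
  have ae: "AE v in lborel. v \<noteq> (0::real)" by (rule AE_lborel_singleton)
  have f_meas: "?f \<in> borel_measurable lborel" using g_meas by measurable
  have s_meas: "?s n \<in> borel_measurable lborel" for n using g_meas by measurable
  have w: "integrable lborel ?w"
    using set_integrable_powr_from_0[of "- \<alpha>" t] \<alpha> t unfolding set_integrable_def by simp
  have lim: "AE v in lborel. (\<lambda>n. ?s n v) \<longlonglongrightarrow> ?f v"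
    using ae
  proof (rule AE_mp, intro AE_I2 impI)
    fix v :: real assume "v \<noteq> 0"
    then show "(\<lambda>n. ?s n v) \<longlonglongrightarrow> ?f v"
      using h_lim[of v] by (cases "v \<in> {0..t}") (auto intro!: tendsto_mult_right)
  qed
  have bound: "AE v in lborel. norm (?s n v) \<le> ?w v" for n
    using ae
  proof (rule AE_mp, intro AE_I2 impI)
    fix v :: real assume v0: "v \<noteq> 0"
    show "norm (?s n v) \<le> ?w v"
    proof (cases "v \<in> {0..t} \<and> n > 0")
      case True
      then have v: "0 < v" "0 < real n" using v0 by auto
      have "h (real n * v) \<le> \<bar>C\<bar> * (real n * v) powr (- \<alpha>)"
        using h_bound[of "real n * v"] v by (auto intro: order_trans mult_right_mono)
      then have "real n powr \<alpha> * h (real n * v) \<le> real n powr \<alpha> * (\<bar>C\<bar> * (real n * v) powr (- \<alpha>))"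
        by (intro mult_left_mono) auto
      also have "\<dots> = \<bar>C\<bar> * v powr (- \<alpha>)"
        using v by (simp add: powr_mult powr_minus)
      finally have "(real n powr \<alpha> * h (real n * v)) * \<bar>g v\<bar> \<le> (\<bar>C\<bar> * v powr (- \<alpha>)) * B"
        using B[of v] True by (intro mult_mono[of "real n powr \<alpha> * h (real n * v)"]) auto
      then show ?thesis using True h_nonneg by (simp add: abs_mult mult_ac)
    next
      \<comment> \<open>At \<open>n = 0\<close> the prefactor \<open>0 powr \<alpha>\<close> is
        zero, and outside the interval the indicator is; in both cases the majorant only has to be
        nonnegative.\<close>
      case False
      have "0 \<le> B" using B[of 0] t by auto
      then show ?thesis using False by (cases "v \<in> {0..t}") auto
    qed
  qed
  note dom = f_meas s_meas w lim bound
  have "integrable lborel ?f"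
    by (rule integrable_dominated_convergence[OF dom])
  also have "?f = (\<lambda>v. indicator {0..t} v *\<^sub>R (c * v powr (- \<alpha>) * g v))" by (rule ext) (simp add: mult_ac)
  finally show "set_integrable lborel {0..t} (\<lambda>v. c * v powr (- \<alpha>) * g v)"
    unfolding set_integrable_def .
  have "(\<lambda>n. integral\<^sup>L lborel (?s n)) \<longlonglongrightarrow> integral\<^sup>L lborel ?f"
    by (rule integral_dominated_convergence[OF dom])
  also have "(\<lambda>n. integral\<^sup>L lborel (?s n))
      = (\<lambda>n. real n powr \<alpha> * (LINT v:{0..t}|lborel. h (real n * v) * g v))"
    unfolding set_lebesgue_integral_def integral_mult_right_zero[symmetric]
    by (rule ext, rule Bochner_Integration.integral_cong[OF refl]) (simp add: mult_ac)
  also have "integral\<^sup>L lborel ?f = (LINT v:{0..t}|lborel. c * v powr (- \<alpha>) * g v)"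
    unfolding set_lebesgue_integral_def
    by (rule Bochner_Integration.integral_cong[OF refl]) (simp add: mult_ac)
  finally show "(\<lambda>n. real n powr \<alpha> * (LINT v:{0..t}|lborel. h (real n * v) * g v))
      \<longlonglongrightarrow> (LINT v:{0..t}|lborel. c * v powr (- \<alpha>) * g v)" .
qed

end

section \<open>Passage to the limit and the limit matrix\<close>

definition flow_product :: "'s set \<Rightarrow> real \<Rightarrow> 's matrix \<Rightarrow> real \<Rightarrow> 's \<Rightarrow> 's \<Rightarrow> 's \<Rightarrow> real \<Rightarrow> real" where
  "flow_product S lam P t w z y v = mat_exp S (mat_scale (lam * (t - v)) (generator P)) w z
    * mat_exp S (mat_scale (lam * v) (generator P)) z y"

lemma continuous_on_flow_product:
  "finite S \<Longrightarrow> w \<in> S \<Longrightarrow> z \<in> S \<Longrightarrow> y \<in> S \<Longrightarrow> continuous_on A (flow_product S lam P t w z y)"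
  unfolding flow_product_def by (intro continuous_intros continuous_on_mat_exp_scale)

text \<open>The scaled transition matrix tends to the identity, so the sum over \<open>w\<close>
  collapses to \<open>x\<close> and the additional chain step leaves no trace. The rate turns the
  prefactor n^(\<alpha>-\<gamma>) into the n^\<alpha> that the tail requires.\<close>

lemma (in heavy_tail) weighted_limit:
  fixes S :: "'s set" and P :: "'s matrix"
  assumes S: "finite S" "x \<in> S" "y \<in> S" and t: "0 \<le> t" and \<gamma>: "0 < \<gamma>"
  shows "(\<lambda>n. real n powr (\<alpha> - \<gamma>) * (lam * real n powr \<gamma> * (\<Sum>z\<in>S. f z * (\<Sum>w\<in>S. scaled_transition \<gamma> P n x w
      * (LINT v:{0..t}|lborel. h (real n * v) * flow_product S lam P t w z y v)))))
    \<longlonglongrightarrow> lam * (\<Sum>z\<in>S. f z * (LINT v:{0..t}|lborel. c * v powr (- \<alpha>) * flow_product S lam P t x z y v))"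
proof -
  let ?I = "\<lambda>n w z. LINT v:{0..t}|lborel. h (real n * v) * flow_product S lam P t w z y v"
  let ?J = "\<lambda>w z. LINT v:{0..t}|lborel. c * v powr (- \<alpha>) * flow_product S lam P t w z y v"
  have inv: "(\<lambda>n. 1 / real n powr \<gamma>) \<longlonglongrightarrow> 0"
    using \<gamma> by real_asymp
  have Q: "(\<lambda>n. scaled_transition \<gamma> P n x w) \<longlonglongrightarrow> mat_id x w" for w
  proof -
    have "(\<lambda>n. P x w * (1 / real n powr \<gamma>) + (1 - 1 / real n powr \<gamma>) * mat_id x w)
        \<longlonglongrightarrow> P x w * 0 + (1 - 0) * mat_id x w"
      by (intro tendsto_intros inv)
    then show ?thesis by (simp add: scaled_transition_def)
  qed
  have "(\<lambda>n. lam * (\<Sum>z\<in>S. f z * (\<Sum>w\<in>S. scaled_transition \<gamma> P n x w * (real n powr \<alpha> * ?I n w z))))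
      \<longlonglongrightarrow> lam * (\<Sum>z\<in>S. f z * (\<Sum>w\<in>S. mat_id x w * ?J w z))"
    by (intro tendsto_mult_left tendsto_sum tendsto_mult Q scaled_integral_limit continuous_on_flow_product S t)
  moreover have "(\<Sum>w\<in>S. mat_id x w * ?J w z) = ?J x z" for z
    using mat_mult_id_left[OF S(1,2), of "\<lambda>w z. ?J w z" z] by (simp add: mat_mult_def)
  ultimately have lim: "(\<lambda>n. lam * (\<Sum>z\<in>S. f z * (\<Sum>w\<in>S. scaled_transition \<gamma> P n x w * (real n powr \<alpha> * ?I n w z))))
      \<longlonglongrightarrow> lam * (\<Sum>z\<in>S. f z * ?J x z)" by simp
  show ?thesis
  proof (rule Lim_transform_eventually[OF lim])
    show "\<forall>\<^sub>F n in sequentially. lam * (\<Sum>z\<in>S. f z * (\<Sum>w\<in>S. scaled_transition \<gamma> P n x w * (real n powr \<alpha> * ?I n w z)))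
      = real n powr (\<alpha> - \<gamma>) * (lam * real n powr \<gamma> * (\<Sum>z\<in>S. f z * (\<Sum>w\<in>S. scaled_transition \<gamma> P n x w * ?I n w z)))"
      using eventually_gt_at_top[of 0]
    proof eventually_elim
      case (elim n)
      then have n: "real n powr \<alpha> = real n powr (\<alpha> - \<gamma>) * real n powr \<gamma>" by (simp flip: powr_add)
      show ?case unfolding n by (simp add: sum_distrib_left mult_ac)
    qed
  qed
qed

lemma set_integral_sum_mult:
  fixes f :: "'b \<Rightarrow> 'a \<Rightarrow> real"
  assumes "\<And>i. i \<in> I \<Longrightarrow> set_integrable M A (f i)"
  shows "(LINT v:A|M. \<Sum>i\<in>I. a i * f i v) = (\<Sum>i\<in>I. a i * (LINT v:A|M. f i v))"
proof -
  have "integral\<^sup>L M (\<lambda>v. \<Sum>i\<in>I. a i * (indicator A v *\<^sub>R f i v))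
      = (\<Sum>i\<in>I. a i * integral\<^sup>L M (\<lambda>v. indicator A v *\<^sub>R f i v))"
    using assms unfolding set_integrable_def by (subst Bochner_Integration.integral_sum) auto
  then show ?thesis
    by (simp add: set_lebesgue_integral_def sum_distrib_left mult_ac)
qed

text \<open>The outer exponential is moved under the entrywise integral, where it merges with the
  backward one into the flow over \<open>t - v\<close>. That \<open>B\<close> is diagonal is asked
  only on \<open>S\<close>, since a matrix product over \<open>S\<close> is not diagonal with the
  same formula outside.\<close>

lemma limit_matrix_eq:
  fixes S :: "'s set" and P B :: "'s matrix"
  assumes S: "finite S" "x \<in> S" "y \<in> S" and t: "0 \<le> t" and \<alpha>: "0 < \<alpha>" "\<alpha> < 1"
    and B: "\<And>z w. z \<in> S \<Longrightarrow> w \<in> S \<Longrightarrow> B z w = mat_diag d z w"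
  shows "limit_matrix S lam \<alpha> P B t x y
    = lam * (\<Sum>z\<in>S. d z * (LINT v:{0..t}|lborel. 1 * v powr (- \<alpha>) * flow_product S lam P t x z y v))"
proof -
  let ?E = "\<lambda>s. mat_exp S (mat_scale s (generator P))"
  let ?g = "\<lambda>u v. 1 / v powr \<alpha> * mat_mult S (mat_mult S (?E (- lam * v)) B) (?E (lam * v)) u y"
  have E_add: "(\<Sum>u\<in>S. ?E (lam * t) x u * ?E (- lam * v) u z) = ?E (lam * (t - v)) x z" if "z \<in> S" for z v
    using mat_exp_add[OF S(1,2) that, of "lam * t" "generator P" "- lam * v"]
    by (simp add: mat_mult_def algebra_simps)
  have EB: "mat_mult S (?E (- lam * v)) B u z = ?E (- lam * v) u z * d z" if "u \<in> S" "z \<in> S" for u z v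
  proof -
    have "mat_mult S (?E (- lam * v)) B u z = mat_mult S (?E (- lam * v)) (mat_diag d) u z"
      using that B by (intro mat_mult_cong) auto
    then show ?thesis using S(1) that by (simp add: mat_mult_diag_right)
  qed
  have pw: "1 / v powr \<alpha> = 1 * v powr (- \<alpha>)" for v :: real by (simp add: powr_minus_divide)
  \<comment> \<open>The pure power is its own scaling limit; viewing it as a heavy tail yields the
    integrability of a singular power times a continuous function.\<close>
  have "heavy_tail (\<lambda>u. u powr (- \<alpha>)) \<alpha> 1 1"
  proof
    show "(\<lambda>n. real n powr \<alpha> * (real n * v) powr (- \<alpha>)) \<longlonglongrightarrow> 1 * v powr (- \<alpha>)" if "0 < v" for v
    proof (rule tendsto_eventually)
      show "\<forall>\<^sub>F n in sequentially. real n powr \<alpha> * (real n * v) powr (- \<alpha>) = 1 * v powr (- \<alpha>)"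
        using eventually_gt_at_top[of 0]
        by eventually_elim (use that in \<open>simp add: powr_mult powr_minus\<close>)
    qed
  qed (use \<alpha> in auto)
  note int = heavy_tail.scaled_integral_limit(2)[OF this _ t]
  have g_int: "set_integrable lborel {0..t} (?g u)" if "u \<in> S" for u
  proof -
    have "continuous_on {0..t} (\<lambda>v. mat_mult S (mat_mult S (?E (- lam * v)) B) (?E (lam * v)) u y)"
      unfolding mat_mult_def using that
      by (intro continuous_intros continuous_on_mat_exp_scale S)
    then show ?thesis unfolding pw by (rule int)
  qed
  have "(\<Sum>u\<in>S. ?E (lam * t) x u * (LINT v:{0..t}|lborel. ?g u v))
      = (LINT v:{0..t}|lborel. \<Sum>u\<in>S. ?E (lam * t) x u * ?g u v)"
    by (rule set_integral_sum_mult[symmetric]) (rule g_int)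
  also have "\<dots> = (LINT v:{0..t}|lborel. \<Sum>z\<in>S. d z * (1 * v powr (- \<alpha>) * flow_product S lam P t x z y v))"
  proof (rule set_lebesgue_integral_cong)
    have "(\<Sum>u\<in>S. ?E (lam * t) x u * ?g u v)
      = (\<Sum>z\<in>S. d z * (1 * v powr (- \<alpha>) * flow_product S lam P t x z y v))" for v
    proof -
      have "(\<Sum>u\<in>S. ?E (lam * t) x u * ?g u v)
        = (\<Sum>u\<in>S. \<Sum>z\<in>S. v powr (- \<alpha>) * d z * (?E (lam * t) x u * ?E (- lam * v) u z) * ?E (lam * v) z y)"
      proof (rule sum.cong[OF refl])
        fix u assume u: "u \<in> S"
        have "mat_mult S (mat_mult S (?E (- lam * v)) B) (?E (lam * v)) u y
          = (\<Sum>z\<in>S. (?E (- lam * v) u z * d z) * ?E (lam * v) z y)"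
          unfolding mat_mult_def[of S "mat_mult S (?E (- lam * v)) B"]
          using u by (intro sum.cong refl) (simp only: EB)
        then show "?E (lam * t) x u * ?g u v
          = (\<Sum>z\<in>S. v powr (- \<alpha>) * d z * (?E (lam * t) x u * ?E (- lam * v) u z) * ?E (lam * v) z y)"
          unfolding pw by (simp only: sum_distrib_left mult_1 mult_ac)
      qed
      also have "\<dots> = (\<Sum>z\<in>S. v powr (- \<alpha>) * d z * (\<Sum>u\<in>S. ?E (lam * t) x u * ?E (- lam * v) u z) * ?E (lam * v) z y)"
        by (subst sum.swap) (simp only: sum_distrib_left sum_distrib_right)
      also have "\<dots> = (\<Sum>z\<in>S. d z * (1 * v powr (- \<alpha>) * flow_product S lam P t x z y v))"
        by (intro sum.cong refl) (simp only: E_add flow_product_def, simp only: mult_1 mult_ac)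
      finally show ?thesis .
    qed
    then show "\<forall>v. v \<in> {0..t} \<longrightarrow> (\<Sum>u\<in>S. ?E (lam * t) x u * ?g u v)
      = (\<Sum>z\<in>S. d z * (1 * v powr (- \<alpha>) * flow_product S lam P t x z y v))" by blast
  qed simp
  also have "\<dots> = (\<Sum>z\<in>S. d z * (LINT v:{0..t}|lborel. 1 * v powr (- \<alpha>) * flow_product S lam P t x z y v))"
    by (intro set_integral_sum_mult int continuous_on_flow_product S)
  finally show ?thesis
    by (simp add: limit_matrix_def mat_scale_def mat_mult_def[of S "?E (lam * t)"])
qed

section \<open>Convergence of the rescaled moments\<close>

theorem theorem3:
  fixes k K :: nat
    and lam \<gamma> \<alpha> t :: real
    and P :: "(nat \<Rightarrow> nat) matrix"
    and \<pi> :: "(nat \<Rightarrow> nat) \<Rightarrow> real"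
    and D :: "nat \<Rightarrow> real measure"
    and M :: "'a measure"
    and Mx :: "nat \<Rightarrow> (nat \<Rightarrow> nat) \<Rightarrow> 'a measure"
    and N :: "nat \<Rightarrow> real \<Rightarrow> 'a \<Rightarrow> nat"
    and X :: "nat \<Rightarrow> nat \<Rightarrow> 'a \<Rightarrow> nat \<Rightarrow> nat"
    and L :: "nat \<Rightarrow> nat \<Rightarrow> 'a \<Rightarrow> real"
  assumes "k \<ge> 1" and "K \<ge> 1"
    and "lam > 0" and "\<gamma> > 0" and "0 < \<alpha>" and "\<alpha> < 1"
    and "stochastic_matrix (states k K) P"
    and "stationary_distribution (states k K) P \<pi>"
    and tail: "\<And>j. j \<in> {1..k} \<Longrightarrow>
      (\<lambda>s. measure (D j) {s<..}) \<sim>[at_top] (\<lambda>s. s powr (- \<alpha>))"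
    and model: "\<And>n. n \<ge> 1 \<Longrightarrow> rescaled_model k K lam \<gamma> P D n \<pi> M (N n) (X n) L"
    and started: "\<And>n x. n \<ge> 1 \<Longrightarrow> x \<in> states k K \<Longrightarrow>
      started_model k K lam \<gamma> P D n \<pi> M (N n) (X n) L x (Mx n x)"
    and "\<gamma> < \<alpha>"
    and "t \<in> {0..1}"
    and "j \<in> {1..k}"
    and "x \<in> states k K" and "y \<in> states k K"
  shows "((\<lambda>n. real n powr (\<alpha> - \<gamma>) * moment1 (Mx n) (N n) (X n) L n j t x y)
            \<longlonglongrightarrow> limit_matrix (states k K) lam \<alpha> P (Delta j) t x y)
       \<and> ((\<lambda>n. real n powr (\<alpha> - \<gamma>) * moment2 (Mx n) (N n) (X n) L n j j t x y)
            \<longlonglongrightarrow> limit_matrix (states k K) lam \<alpha> P (mat_pow (states k K) (Delta j) 2) t x y)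
       \<and> (\<forall>j'\<in>{1..k}. j' \<noteq> j \<longrightarrow>
            (\<lambda>n. real n powr (\<alpha> - \<gamma>) * moment2 (Mx n) (N n) (X n) L n j j' t x y)
              \<longlonglongrightarrow> 0)"
proof -
  let ?S = "states k K" and ?F = "\<lambda>j u. measure (D j) {u<..}"
  let ?I = "\<lambda>h n z. \<Sum>w\<in>?S. scaled_transition \<gamma> P n x w
      * (LINT v:{0..t}|lborel. h (real n * v) * flow_product ?S lam P t w z y v)"
  have t: "0 \<le> t" using assms by simp
  have queue: "started_queue k K n lam \<gamma> P D x (Mx n x) (N n) (X n) L" if "n \<ge> 1" for n
    using started[OF that assms(15)] assms that by (simp add: started_queue_def started_model_def)
  have D_prob: "prob_space (D j)" "sets (D j) = sets borel" if "j \<in> {1..k}" for j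
    using started_queue.D_prob[OF queue[of 1]] started_queue.D_sets[OF queue[of 1]] that by auto
  have D_meas: "?F j \<in> borel_measurable borel" if "j \<in> {1..k}" for j
    using borel_measurable_tail(2)[OF D_prob[OF that], of 1] by simp
  have D_lim: "(\<lambda>n. real n powr \<alpha> * ?F j (real n * v)) \<longlonglongrightarrow> 1 * v powr (- \<alpha>)" if "j \<in> {1..k}" "0 < v" for j v
    using regularly_varying_tail_limit[OF D_prob(1)[OF that(1)] assms(5) tail[OF that(1)] that(2)] by simp
  have D_le_1: "?F j u \<le> 1" if "j \<in> {1..k}" for j u
    using prob_space.prob_le_1[OF D_prob(1)[OF that]] .
  have D_heavy: "\<exists>C. heavy_tail (?F j) \<alpha> 1 C" if j: "j \<in> {1..k}" for j
  proof -
    obtain C where "\<And>u. u > 0 \<Longrightarrow> ?F j u \<le> C * u powr (- \<alpha>)"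
      using regularly_varying_tail_bound[OF D_prob(1)[OF j] assms(5) tail[OF j]] by blast
    then have "heavy_tail (?F j) \<alpha> 1 C"
      using assms(5,6) D_meas[OF j] D_lim[OF j] by unfold_locales auto
    then show ?thesis ..
  qed
  \<comment> \<open>This extra decay is what makes a product of two tails vanish at the scale
    n^\<alpha> of a single tail.\<close>
  have F_tendsto_0: "(\<lambda>n. ?F j (real n * v)) \<longlonglongrightarrow> 0" if "j \<in> {1..k}" "0 < v" for j v
  proof -
    have "(\<lambda>n. real n powr (- \<alpha>)) \<longlonglongrightarrow> 0" using assms(5) by real_asymp
    from tendsto_mult[OF this D_lim[OF that]]
    have "(\<lambda>n. real n powr (- \<alpha>) * (real n powr \<alpha> * ?F j (real n * v))) \<longlonglongrightarrow> 0" by simp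
    then show ?thesis
    proof (rule Lim_transform_eventually)
      show "\<forall>\<^sub>F n in sequentially. real n powr (- \<alpha>) * (real n powr \<alpha> * ?F j (real n * v)) = ?F j (real n * v)"
        using eventually_gt_at_top[of 0] by eventually_elim (simp add: powr_minus)
    qed
  qed
  \<comment> \<open>The value of the limit is immaterial: what matters is that the mass has order
    n^(-\<alpha>).\<close>
  have mass_limit: "\<exists>a. (\<lambda>n. real n powr \<alpha> * (LINT v:{0..t}|lborel. ?F j (real n * v))) \<longlonglongrightarrow> a"
    if j: "j \<in> {1..k}" for j
  proof -
    obtain C where "heavy_tail (?F j) \<alpha> 1 C" using D_heavy[OF j] ..
    from heavy_tail.scaled_integral_limit(1)[OF this continuous_on_const[of _ 1] t] show ?thesis by auto
  qed

  have moment1: "moment1 (Mx n) (N n) (X n) L n j t x y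
      = lam * real n powr \<gamma> * (\<Sum>z\<in>?S. real (z j) * ?I (?F j) n z)" if "n \<ge> 1" for n
  proof -
    interpret q: started_queue k K n lam \<gamma> P D x "Mx n x" "N n" "X n" L by (rule queue[OF that])
    show ?thesis
      using has_bochner_integral_integral_eq[OF q.has_integral_queue_moment1[OF assms(14,16) t]]
      by (simp only: moment1_def q.late_weight_def flow_product_def)
  qed

  \<comment> \<open>Both claims on second moments at once: \<open>h\<close> is the tail of the
    minimum of the two service times, later used with \<open>c = 1\<close> for equal components and
    with \<open>c = 0\<close> for different ones.\<close>
  have moment2: "(\<lambda>n. real n powr (\<alpha> - \<gamma>) * moment2 (Mx n) (N n) (X n) L n j j' t x y)
      \<longlonglongrightarrow> lam * (\<Sum>z\<in>?S. (real (z j) * real (z j'))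
        * (LINT v:{0..t}|lborel. c * v powr (- \<alpha>) * flow_product ?S lam P t x z y v))"
    if j': "j' \<in> {1..k}" and h: "heavy_tail h \<alpha> c C" "h = (\<lambda>u. if j = j' then ?F j u else ?F j u * ?F j' u)"
    for j' h c C
  proof -
    let ?J = "\<lambda>n. lam * real n powr \<gamma> * (\<Sum>z\<in>?S. (real (z j) * real (z j')) * ?I h n z)"
    let ?A = "\<lambda>j n. LINT v:{0..t}|lborel. ?F j (real n * v)"
    let ?M = "\<lambda>n. moment2 (Mx n) (N n) (X n) L n j j' t x y"
    have bound: "\<bar>?M n - ?J n\<bar> \<le> (real K)\<^sup>2 * ((lam * real n powr \<gamma>)\<^sup>2 * ?A j n * ?A j' n)" if "n \<ge> 1" for n
    proof -
      interpret q: started_queue k K n lam \<gamma> P D x "Mx n x" "N n" "X n" L by (rule queue[OF that])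
      show ?thesis
        using q.queue_moment2_bounds[OF assms(14) j' assms(16) t]
        by (simp only: moment2_def q.late_weight_def q.late_mass_def flow_product_def h(2)
            q.measure_min_law[OF assms(14) j'])
    qed
    obtain a a' where a: "(\<lambda>n. real n powr \<alpha> * ?A j n) \<longlonglongrightarrow> a" "(\<lambda>n. real n powr \<alpha> * ?A j' n) \<longlonglongrightarrow> a'"
      using mass_limit[OF assms(14)] mass_limit[OF j'] by blast
    \<comment> \<open>The pairs of distinct jobs bring n^(2\<gamma>) from the squared rate and
      n^(-2\<alpha>) from the two masses; times n^(\<alpha>-\<gamma>) this is n^(\<gamma>-\<alpha>),
      and here \<gamma> < \<alpha> enters.\<close>
    have "(\<lambda>n. real n powr (\<gamma> - \<alpha>)) \<longlonglongrightarrow> 0" using assms(12) by real_asymp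
    from tendsto_mult_left[OF tendsto_mult[OF this tendsto_mult[OF a]], of "(real K)\<^sup>2 * lam\<^sup>2"]
    have err: "(\<lambda>n. (real K)\<^sup>2 * lam\<^sup>2 * (real n powr (\<gamma> - \<alpha>) * (real n powr \<alpha> * ?A j n * (real n powr \<alpha> * ?A j' n)))) \<longlonglongrightarrow> 0"
      by simp
    have "(\<lambda>n. real n powr (\<alpha> - \<gamma>) * (?M n - ?J n)) \<longlonglongrightarrow> 0"
    proof (rule Lim_null_comparison[OF _ err])
      show "\<forall>\<^sub>F n in sequentially. norm (real n powr (\<alpha> - \<gamma>) * (?M n - ?J n))
        \<le> (real K)\<^sup>2 * lam\<^sup>2 * (real n powr (\<gamma> - \<alpha>) * (real n powr \<alpha> * ?A j n * (real n powr \<alpha> * ?A j' n)))"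
        using eventually_ge_at_top[of 1]
      proof eventually_elim
        case (elim n)
        have "real n powr (\<alpha> - \<gamma>) * (real n powr \<gamma>)\<^sup>2 = real n powr (\<gamma> - \<alpha>) * (real n powr \<alpha> * real n powr \<alpha>)"
          using elim by (simp add: power2_eq_square add.commute flip: powr_add)
        then have scale: "real n powr (\<alpha> - \<gamma>) * ((real K)\<^sup>2 * ((lam * real n powr \<gamma>)\<^sup>2 * ?A j n * ?A j' n))
          = (real K)\<^sup>2 * lam\<^sup>2 * (real n powr (\<gamma> - \<alpha>) * (real n powr \<alpha> * ?A j n * (real n powr \<alpha> * ?A j' n)))"
          by (simp add: power_mult_distrib)
        have norm: "norm (real n powr (\<alpha> - \<gamma>) * (?M n - ?J n)) = real n powr (\<alpha> - \<gamma>) * \<bar>?M n - ?J n\<bar>"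
          by (simp add: abs_mult)
        show ?case
          unfolding norm scale[symmetric] by (rule mult_left_mono[OF bound[OF elim]]) simp
      qed
    qed
    moreover have "(\<lambda>n. real n powr (\<alpha> - \<gamma>) * ?J n)
      \<longlonglongrightarrow> lam * (\<Sum>z\<in>?S. (real (z j) * real (z j'))
        * (LINT v:{0..t}|lborel. c * v powr (- \<alpha>) * flow_product ?S lam P t x z y v))"
      by (rule heavy_tail.weighted_limit[OF h(1) finite_states assms(15,16) t assms(4)])
    ultimately have "(\<lambda>n. real n powr (\<alpha> - \<gamma>) * (?M n - ?J n) + real n powr (\<alpha> - \<gamma>) * ?J n)
      \<longlonglongrightarrow> 0 + lam * (\<Sum>z\<in>?S. (real (z j) * real (z j'))
        * (LINT v:{0..t}|lborel. c * v powr (- \<alpha>) * flow_product ?S lam P t x z y v))"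
      by (rule tendsto_add)
    then show ?thesis by (simp add: right_diff_distrib)
  qed

  obtain C where C: "heavy_tail (?F j) \<alpha> 1 C" using D_heavy[OF assms(14)] ..
  show ?thesis
  proof (intro conjI ballI impI)
    have "(\<lambda>n. real n powr (\<alpha> - \<gamma>) * (lam * real n powr \<gamma> * (\<Sum>z\<in>?S. real (z j) * ?I (?F j) n z)))
      \<longlonglongrightarrow> limit_matrix ?S lam \<alpha> P (Delta j) t x y"
      unfolding limit_matrix_eq[OF finite_states assms(15,16) t assms(5,6),
          where B="Delta j" and d="\<lambda>z. real (z j)", unfolded Delta_def, OF refl] Delta_def
      by (rule heavy_tail.weighted_limit[OF C finite_states assms(15,16) t assms(4)])
    then show "(\<lambda>n. real n powr (\<alpha> - \<gamma>) * moment1 (Mx n) (N n) (X n) L n j t x y)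
        \<longlonglongrightarrow> limit_matrix ?S lam \<alpha> P (Delta j) t x y"
    proof (rule Lim_transform_eventually)
      show "\<forall>\<^sub>F n in sequentially. real n powr (\<alpha> - \<gamma>) * (lam * real n powr \<gamma> * (\<Sum>z\<in>?S. real (z j) * ?I (?F j) n z))
        = real n powr (\<alpha> - \<gamma>) * moment1 (Mx n) (N n) (X n) L n j t x y"
        using eventually_ge_at_top[of 1] by eventually_elim (simp only: moment1)
    qed
  next
    have "mat_pow ?S (Delta j) 2 z w = mat_diag (\<lambda>z. real (z j) * real (z j)) z w" if "z \<in> ?S" "w \<in> ?S" for z w
    proof -
      have "mat_pow ?S (Delta j) 2 z w = real (z j) * mat_mult ?S (Delta j) mat_id z w"
        unfolding numeral_2_eq_2 mat_pow.simps Delta_def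
        using that by (simp only: mat_mult_diag_left[OF finite_states])
      then show ?thesis
        using that by (simp add: mat_mult_id_right[OF finite_states] Delta_def mat_diag_def)
    qed
    note limit_matrix_eq[OF finite_states assms(15,16) t assms(5,6) this]
    moreover have "(\<lambda>n. real n powr (\<alpha> - \<gamma>) * moment2 (Mx n) (N n) (X n) L n j j t x y)
      \<longlonglongrightarrow> lam * (\<Sum>z\<in>?S. (real (z j) * real (z j))
        * (LINT v:{0..t}|lborel. 1 * v powr (- \<alpha>) * flow_product ?S lam P t x z y v))"
      by (rule moment2[OF assms(14) C]) simp
    ultimately show "(\<lambda>n. real n powr (\<alpha> - \<gamma>) * moment2 (Mx n) (N n) (X n) L n j j t x y)
        \<longlonglongrightarrow> limit_matrix ?S lam \<alpha> P (mat_pow ?S (Delta j) 2) t x y"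
      by (simp only:)
  next
    fix j' assume j': "j' \<in> {1..k}" "j' \<noteq> j"
    let ?h = "\<lambda>u. ?F j u * ?F j' u"
    \<comment> \<open>The second tail is at most 1, so the constant of the first still dominates the
      product, and it tends to 0, so the scaled limit is 0.\<close>
    have "heavy_tail ?h \<alpha> 0 C"
    proof
      show "?h \<in> borel_measurable borel"
        by (intro borel_measurable_times D_meas assms(14) j'(1))
      show "(\<lambda>n. real n powr \<alpha> * ?h (real n * v)) \<longlonglongrightarrow> 0 * v powr (- \<alpha>)" if "0 < v" for v
        using tendsto_mult[OF D_lim[OF assms(14) that] F_tendsto_0[OF j'(1) that]] by (simp add: mult_ac)
      show "?h u \<le> C * u powr (- \<alpha>)" if "0 < u" for u
      proof -
        have "?h u \<le> ?F j u * 1" by (intro mult_left_mono D_le_1 j'(1)) simp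
        also have "\<dots> \<le> C * u powr (- \<alpha>)" using heavy_tail.h_bound[OF C that] by simp
        finally show ?thesis .
      qed
    qed (use assms in auto)
    from moment2[OF j'(1) this] j'(2)
    show "(\<lambda>n. real n powr (\<alpha> - \<gamma>) * moment2 (Mx n) (N n) (X n) L n j j' t x y) \<longlonglongrightarrow> 0"
      by simp
  qed
qed

end
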